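(* Let $z\in I^{\mathrm{fpf}}_\mathbb{Z}$ and let $\mathcal{K}\subseteq\mathcal{R}^{\mathsf{Sp}}(z)$ be a symplectic Coxeter–Knuth equivalence class. Then $\mathcal{K}$ contains the row reading word of a unique increasing shifted tableau $U$ and of a unique decreasing shifted tableau $V$, and $U$ and $V$ have the same shape.
   Context: $S_\mathbb{Z}$ is the group of finitary permutations of $\mathbb{Z}$ generated by $s_i=(i\ i+1)$; $\mathcal{R}(w)$ is the set of reduced words of $w$. Let $1_{\mathrm{fpf}}:\mathbb{Z}\to\mathbb{Z}$, $i\mapsto i-(-1)^i$, and $I^{\mathrm{fpf}}_\mathbb{Z}=\{w^{-1}1_{\mathrm{fpf}}w:w\in S_\mathbb{Z}\}$. For $z\in I^{\mathrm{fpf}}_\mathbb{Z}$, $\mathcal{A}^{\mathsf{Sp}}(z)$ is the set of minimal-length $w\in S_\mathbb{Z}$ with $z=w^{-1}1_{\mathrm{fpf}}w$, and $\mathcal{R}^{\mathsf{Sp}}(z)=\bigsqcup_{w\in\mathcal{A}^{\mathsf{Sp}}(z)}\mathcal{R}(w)$. Coxeter–Knuth equivalence is generated by $\cdots acb\cdots\sim\cdots cab\cdots$, $\cdots bca\cdots\sim\cdots bac\cdots$ ($a<b<c$) and $\cdots aba\cdots\sim\cdots bab\cdots$ ($|a-b|=1$); symplectic Coxeter–Knuth equivalence is the transitive closure of Coxeter–Knuth equivalence together with $a(a-1)\cdots\sim a(a+1)\cdots$ for all $a\in\mathbb{Z}$ and $ab\cdots\sim ba\cdots$ for all $a,b\in\mathbb{Z}$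 with $a\equiv b\pmod 2$ (these change only the first two letters). For a strict partition $\mu$, the shifted diagram is $\{(i,i+j-1):1\le j\le\mu_i\}$; a shifted tableau of shape $\mu$ is a filling of it by elements of $\mathbb{Z}\sqcup(\mathbb{Z}-\tfrac12)$; it is increasing (decreasing) if rows and columns strictly increase (decrease). Its row reading word reads rows left to right, starting with the last row. *)

theory Defs
  imports Complex_Main "HOL-Combinatorics.Permutations"
begin

definition S_int :: "(int \<Rightarrow> int) set" where
  "S_int = {w. permutation w}"

definition simple_transposition :: "int \<Rightarrow> int \<Rightarrow> int" where
  "simple_transposition i = transpose i (i + 1)"

fun word_perm :: "int list \<Rightarrow> int \<Rightarrow> int" where
  "word_perm [] = id"
| "word_perm (a # as) = simple_transposition a \<circ> word_perm as"

definition perm_length :: "(int \<Rightarrow> int) \<Rightarrow> nat" where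
  "perm_length w = (LEAST n. \<exists>as. length as = n \<and> word_perm as = w)"

definition reduced_words :: "(int \<Rightarrow> int) \<Rightarrow> int list set" where
  "reduced_words w = {as. word_perm as = w \<and> length as = perm_length w}"

(* The map i |-> i - (-1)^i. *)
definition one_fpf :: "int \<Rightarrow> int" where
  "one_fpf i = (if even i then i - 1 else i + 1)"

definition I_fpf :: "(int \<Rightarrow> int) set" where
  "I_fpf = {inv w \<circ> one_fpf \<circ> w | w. w \<in> S_int}"

definition A_Sp :: "(int \<Rightarrow> int) \<Rightarrow> (int \<Rightarrow> int) set" where
  "A_Sp z = {w \<in> S_int. z = inv w \<circ> one_fpf \<circ> w \<and>
     (\<forall>v\<in>S_int. z = inv v \<circ> one_fpf \<circ> v \<longrightarrow> perm_length w \<le> perm_length v)}"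

definition R_Sp :: "(int \<Rightarrow> int) \<Rightarrow> int list set" where
  "R_Sp z = (\<Union>w\<in>A_Sp z. reduced_words w)"

inductive ck_step :: "int list \<Rightarrow> int list \<Rightarrow> bool" where
  "a < b \<Longrightarrow> b < c \<Longrightarrow> ck_step (p @ [a, c, b] @ q) (p @ [c, a, b] @ q)"
| "a < b \<Longrightarrow> b < c \<Longrightarrow> ck_step (p @ [b, c, a] @ q) (p @ [b, a, c] @ q)"
| "\<bar>a - b\<bar> = 1 \<Longrightarrow> ck_step (p @ [a, b, a] @ q) (p @ [b, a, b] @ q)"

definition coxeter_knuth :: "int list \<Rightarrow> int list \<Rightarrow> bool" where
  "coxeter_knuth = equivclp ck_step"

inductive initial_step :: "int list \<Rightarrow> int list \<Rightarrow> bool" where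
  "initial_step (a # (a - 1) # q) (a # (a + 1) # q)"
| "a mod 2 = b mod 2 \<Longrightarrow> initial_step (a # b # q) (b # a # q)"

definition symplectic_coxeter_knuth :: "int list \<Rightarrow> int list \<Rightarrow> bool" where
  "symplectic_coxeter_knuth = equivclp (sup coxeter_knuth initial_step)"

definition strict_partition :: "nat list \<Rightarrow> bool" where
  "strict_partition \<mu> \<longleftrightarrow> sorted_wrt (>) \<mu> \<and> 0 \<notin> set \<mu>"

(* Boxes are (row, column), both counted from 1, in matrix orientation;
   the list index of the i-th part is i - 1. *)
definition shifted_diagram :: "nat list \<Rightarrow> (nat \<times> nat) set" where
  "shifted_diagram \<mu> =
     {(i, i + j - 1) | i j. 1 \<le> i \<and> i \<le> length \<mu> \<and> 1 \<le> j \<and> j \<le> \<mu> ! (i - 1)}"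

(* A filling is a partial map defined exactly on the boxes of the diagram, so two tableaux
   are equal iff they have the same shape and the same entries. *)
type_synonym filling = "nat \<times> nat \<rightharpoonup> rat"

definition has_shifted_shape :: "filling \<Rightarrow> nat list \<Rightarrow> bool" where
  "has_shifted_shape T \<mu> \<longleftrightarrow> strict_partition \<mu> \<and> dom T = shifted_diagram \<mu>"

definition shifted_tableau :: "filling \<Rightarrow> bool" where
  "shifted_tableau T \<longleftrightarrow>
     (\<exists>\<mu>. has_shifted_shape T \<mu>) \<and> ran T \<subseteq> \<int> \<union> {x - 1/2 | x. x \<in> \<int>}"

definition increasing_shifted_tableau :: "filling \<Rightarrow> bool" where
  "increasing_shifted_tableau T \<longleftrightarrow> shifted_tableau T \<and>
     (\<forall>i j j' x y. j < j' \<and> T (i, j) = Some x \<and> T (i, j') = Some y \<longrightarrow> x < y) \<and>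
     (\<forall>i i' j x y. i < i' \<and> T (i, j) = Some x \<and> T (i', j) = Some y \<longrightarrow> x < y)"

definition decreasing_shifted_tableau :: "filling \<Rightarrow> bool" where
  "decreasing_shifted_tableau T \<longleftrightarrow> shifted_tableau T \<and>
     (\<forall>i j j' x y. j < j' \<and> T (i, j) = Some x \<and> T (i, j') = Some y \<longrightarrow> x > y) \<and>
     (\<forall>i i' j x y. i < i' \<and> T (i, j) = Some x \<and> T (i', j) = Some y \<longrightarrow> x > y)"

definition row_word :: "filling \<Rightarrow> nat \<Rightarrow> rat list" where
  "row_word T i = map (\<lambda>j. the (T (i, j))) (sorted_list_of_set {j. (i, j) \<in> dom T})"

definition row_reading_word :: "filling \<Rightarrow> rat list" where
  "row_reading_word T = concat (map (row_word T) (rev (sorted_list_of_set (fst ` dom T))))"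

(* Letters of words are integers whereas tableau entries may be half-integers,
   hence the embedding of words over int into words over rat. *)
definition contains_row_reading_word :: "int list set \<Rightarrow> filling \<Rightarrow> bool" where
  "contains_row_reading_word K T \<longleftrightarrow> row_reading_word T \<in> map rat_of_int ` K"

end

theory Submission
  imports Defs
begin

text \<open>
  Reverse all words, so that the initial moves act on the right end. Edelman--Greene insertion assigns
  to a word its first row and an emitted word of the remaining rows, and Coxeter--Knuth equivalent
  reduced words have the same first row and equivalent emitted words. Popping the letters of the first
  row one by one from the right and applying an initial move whenever the last two letters increase
  turns a word of a symplectic class into a word ending in a single letter, the first column of a
  shifted tableau, preceded by a shorter word. This letter is an invariant of the class, and two words
  of the class leave shorter words that are related by Coxeter--Knuth moves and by moves of the same
  kind behind one fixed letter. Iterating, with columns of height \<open>1, 2, 3, \<dots>\<close>, gives a unique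
  sequence of columns, which are those of a unique increasing shifted tableau \<open>U\<close>.

  Negating all letters exchanges increasing and decreasing tableaux and preserves the hypotheses, which
  yields the decreasing tableau \<open>V\<close>. A count of the cells in the first \<open>r\<close> rows and \<open>t\<close> columns of the
  insertion tableaux along the iteration shows that the first \<open>J\<close> rows of \<open>V\<close> have at most as many
  cells as those of \<open>U\<close>; by the symmetry under negation the shapes agree.
\<close>

text \<open>The obstacle is promotion: popping may raise the last entry of the new column by one, so
  that this column can touch the first row of what is left instead of lying strictly over it. What
  is left is then no legitimate start for the next column. Popping once more behind the same column
  repairs this, and it is the word after two rounds whose class is an invariant. Bumping only meets
  the local patterns \<open>x x\<close> and \<open>x y x\<close>, so permutations enter solely
  through three facts about reduced words of minimal conjugators: these patterns are absent, the
  first letter is even (for odd \<open>a\<close>, the transposition of \<open>a\<close> and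
  \<open>a + 1\<close> commutes with \<open>one_fpf\<close>), and the second is even or adjacent to
  the first. Parity deeper in the word is pulled back to these by carrying letters past the columns
  already split off. In reversed words, rows of the insertion tableau play the part of columns of
  the shifted tableau. The cell count therefore mixes rows and columns: each split-off column
  consumes one insertion row, and the letters popped with it return as a vertical strip, absorbed by
  counting one more insertion column.\<close>

abbreviation inc :: "int list \<Rightarrow> bool" where
  "inc \<equiv> sorted_wrt (<)"

subsection \<open>Coxeter--Knuth equivalence\<close>

notation coxeter_knuth (infix "\<approx>" 50)

lemma ck_refl [simp, intro!]: "u \<approx> u"
  by (simp add: coxeter_knuth_def)

lemma ck_sym: "u \<approx> v \<Longrightarrow> v \<approx> u"
  by (simp add: coxeter_knuth_def equivclp_sym)

lemma ck_trans [trans]: "u \<approx> v \<Longrightarrow> v \<approx> w \<Longrightarrow> u \<approx> w"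
  unfolding coxeter_knuth_def by (rule equivclp_trans)

lemma ck_eq_trans [trans]: "u = v \<Longrightarrow> v \<approx> w \<Longrightarrow> u \<approx> w"
  "u \<approx> v \<Longrightarrow> v = w \<Longrightarrow> u \<approx> w"
  by simp_all

lemma ck_stepI: "ck_step u v \<Longrightarrow> u \<approx> v"
  by (simp add: coxeter_knuth_def r_into_equivclp)

lemma equivclp_map:
  assumes "\<And>u v. R u v \<Longrightarrow> equivclp S (f u) (f v)" and "equivclp R u v"
  shows "equivclp S (f u) (f v)"
  using assms(2)
proof (induction rule: equivclp_induct)
  case base
  show ?case by simp
next
  case (step y z)
  then have "equivclp S (f y) (f z)"
    using assms(1) equivclp_sym by metis
  with step show ?case
    using equivclp_trans by metis
qed

lemma ck_step_context: "ck_step u v \<Longrightarrow> ck_step (p @ u @ q) (p @ v @ q)"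
proof (induction rule: ck_step.induct)
  case (1 a b c p' q')
  then show ?case using ck_step.intros(1)[of a b c "p @ p'" "q' @ q"] by simp
next
  case (2 a b c p' q')
  then show ?case using ck_step.intros(2)[of a b c "p @ p'" "q' @ q"] by simp
next
  case (3 a b p' q')
  then show ?case using ck_step.intros(3)[of a b "p @ p'" "q' @ q"] by simp
qed

lemma ck_context: "u \<approx> v \<Longrightarrow> p @ u @ q \<approx> p @ v @ q"
  unfolding coxeter_knuth_def
  by (rule equivclp_map[of ck_step]) (auto intro: ck_step_context)

lemma ck_append1: "u \<approx> v \<Longrightarrow> p @ u \<approx> p @ v"
  using ck_context[of u v p "[]"] by simp

lemma ck_append2: "u \<approx> v \<Longrightarrow> u @ q \<approx> v @ q"
  using ck_context[of u v "[]" q] by simp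

lemma ck_append: "u \<approx> v \<Longrightarrow> u' \<approx> v' \<Longrightarrow> u @ u' \<approx> v @ v'"
  by (meson ck_append1 ck_append2 ck_trans)

lemma ck_Cons: "u \<approx> v \<Longrightarrow> x # u \<approx> x # v"
  using ck_append1[of u v "[x]"] by simp

lemma ck_acb: "a < b \<Longrightarrow> b < c \<Longrightarrow> [a, c, b] \<approx> [c, a, b]"
  using ck_step.intros(1)[of a b c "[]" "[]"] by (simp add: ck_stepI)

lemma ck_bca: "a < b \<Longrightarrow> b < c \<Longrightarrow> [b, c, a] \<approx> [b, a, c]"
  using ck_step.intros(2)[of a b c "[]" "[]"] by (simp add: ck_stepI)

lemma ck_braid: "\<bar>a - b\<bar> = 1 \<Longrightarrow> [a, b, a] \<approx> [b, a, b]"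
  using ck_step.intros(3)[of a b "[]" "[]"] by (simp add: ck_stepI)

lemma ck_length: "u \<approx> v \<Longrightarrow> length u = length v"
  unfolding coxeter_knuth_def
proof (induction rule: equivclp_induct)
  case (step y z)
  then show ?case by (auto elim!: ck_step.cases)
qed simp

lemma ck_step_rev: "ck_step u v \<Longrightarrow> rev u \<approx> rev v"
proof (induction rule: ck_step.induct)
  case (1 a b c p q)
  have "rev q @ [b, c, a] @ rev p \<approx> rev q @ [b, a, c] @ rev p"
    using 1 by (intro ck_context ck_bca)
  then show ?case by simp
next
  case (2 a b c p q)
  have "rev q @ [a, c, b] @ rev p \<approx> rev q @ [c, a, b] @ rev p"
    using 2 by (intro ck_context ck_acb)
  then show ?case by simp
next
  case (3 a b p q)
  have "rev q @ [a, b, a] @ rev p \<approx> rev q @ [b, a, b] @ rev p"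
    using 3 by (intro ck_context ck_braid)
  then show ?case by simp
qed

lemma ck_rev: "u \<approx> v \<Longrightarrow> rev u \<approx> rev v"
  using equivclp_map[of ck_step ck_step rev u v] ck_step_rev
  unfolding coxeter_knuth_def by blast

lemma ck_rev_iff [simp]: "rev u \<approx> rev v \<longleftrightarrow> u \<approx> v"
  using ck_rev[of u v] ck_rev[of "rev u" "rev v"] by auto

subsection \<open>Coxeter--Knuth reduced words\<close>

text \<open>The local patterns that never occur in a reduced word: \<open>x x\<close> cancels, and
  in \<open>x y x\<close> with distant letters the outer two meet after commuting past
  \<open>y\<close>.\<close>

definition unreduced :: "int list \<Rightarrow> bool" where
  "unreduced w \<longleftrightarrow> (\<exists>p x q. w = p @ [x, x] @ q) \<or>
     (\<exists>p x y q. \<bar>x - y\<bar> \<ge> 2 \<and> w = p @ [x, y, x] @ q)"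

text \<open>Asked of the whole Coxeter--Knuth class, so that it passes to equivalent words and to
  factors and survives every bump.\<close>

definition ck_reduced :: "int list \<Rightarrow> bool" where
  "ck_reduced w \<longleftrightarrow> (\<forall>v. w \<approx> v \<longrightarrow> \<not> unreduced v)"

lemma unreduced_context: "unreduced u \<Longrightarrow> unreduced (p @ u @ q)"
  unfolding unreduced_def by (metis append.assoc)

lemma unreduced_rev_aux: "unreduced u \<Longrightarrow> unreduced (rev u)"
  unfolding unreduced_def
proof (elim disjE exE conjE)
  fix p x q assume "u = p @ [x, x] @ q"
  then have "rev u = rev q @ [x, x] @ rev p" by simp
  then show "(\<exists>p x q. rev u = p @ [x, x] @ q) \<or> (\<exists>p x y q. \<bar>x - y\<bar> \<ge> 2 \<and> rev u = p @ [x, y, x] @ q)"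
    by blast
next
  fix p x y q assume "\<bar>x - y\<bar> \<ge> 2" "u = p @ [x, y, x] @ q"
  then have "\<bar>x - y\<bar> \<ge> 2" "rev u = rev q @ [x, y, x] @ rev p" by simp_all
  then show "(\<exists>p x q. rev u = p @ [x, x] @ q) \<or> (\<exists>p x y q. \<bar>x - y\<bar> \<ge> 2 \<and> rev u = p @ [x, y, x] @ q)"
    by blast
qed

lemma unreduced_rev [simp]: "unreduced (rev u) \<longleftrightarrow> unreduced u"
  using unreduced_rev_aux[of u] unreduced_rev_aux[of "rev u"] by auto

lemma ck_reduced_ck: "ck_reduced u \<Longrightarrow> u \<approx> v \<Longrightarrow> ck_reduced v"
  unfolding ck_reduced_def by (meson ck_trans)

lemma ck_reduced_factor: "ck_reduced (p @ u @ q) \<Longrightarrow> ck_reduced u"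
  unfolding ck_reduced_def using ck_context unreduced_context by blast

lemma ck_reduced_prefix: "ck_reduced (u @ q) \<Longrightarrow> ck_reduced u"
  using ck_reduced_factor[of "[]" u q] by simp

lemma ck_reduced_suffix: "ck_reduced (p @ u) \<Longrightarrow> ck_reduced u"
  using ck_reduced_factor[of p u "[]"] by simp

lemma ck_reduced_Cons: "ck_reduced (x # u) \<Longrightarrow> ck_reduced u"
  using ck_reduced_suffix[of "[x]" u] by simp

lemma ck_reduced_rev [simp]: "ck_reduced (rev u) \<longleftrightarrow> ck_reduced u"
  unfolding ck_reduced_def by (metis ck_rev rev_rev_ident unreduced_rev)

lemma not_ck_reduced_xx: "\<not> ck_reduced (p @ x # x # q)"
  unfolding ck_reduced_def unreduced_def by force

lemma not_ck_reduced_xyx: "\<bar>x - y\<bar> \<ge> 2 \<Longrightarrow> \<not> ck_reduced (p @ x # y # x # q)"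
  unfolding ck_reduced_def unreduced_def by force

subsection \<open>Edelman--Greene bumping\<close>

text \<open>The second component is the list of emitted letters; it has length at most one.\<close>

fun bump :: "int list \<Rightarrow> int \<Rightarrow> int list \<times> int list" where
  "bump [] u = ([u], [])"
| "bump (s # S) u =
     (if u < s then (u # S, [s]) else if u = s then (s # S, [u + 1])
      else (s # fst (bump S u), snd (bump S u)))"

lemma bump_append: "\<forall>s\<in>set L. s < u \<Longrightarrow> bump (L @ S) u = (L @ fst (bump S u), snd (bump S u))"
  by (induction L) auto

lemma bump_cases:
  assumes "inc S"
  obtains (snoc) "\<forall>s\<in>set S. s < u" "bump S u = (S @ [u], [])"
  | (less) L m M where "S = L @ m # M" "\<forall>s\<in>set L. s < u" "u < m" "bump S u = (L @ u # M, [m])"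
  | (eq) L M where "S = L @ u # M" "\<forall>s\<in>set L. s < u" "bump S u = (S, [u + 1])"
proof -
  define L where "L = takeWhile (\<lambda>s. s < u) S"
  define M where "M = dropWhile (\<lambda>s. s < u) S"
  have S: "S = L @ M" and L: "\<forall>s\<in>set L. s < u"
    using set_takeWhileD by (fastforce simp: L_def M_def)+
  show thesis
  proof (cases M)
    case Nil
    then show thesis using S L bump_append[of L u "[]"] by (intro snoc) auto
  next
    case (Cons m M')
    then have "\<not> m < u" using hd_dropWhile[of "\<lambda>s. s < u" S] by (auto simp: M_def)
    then consider "u < m" | "m = u" by linarith
    then show thesis
    proof cases
      case 1
      then show thesis using S L Cons bump_append[OF L, of M] by (intro less[of L m M']) auto
    next
      case 2
      then show thesis using S L Cons bump_append[OF L, of M] by (intro eq[of L M']) auto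
    qed
  qed
qed

lemma inc_bump [intro]:
  assumes "inc S"
  shows "inc (fst (bump S u))"
  using assms
proof (cases rule: bump_cases[where u = u])
  case (less L m M)
  then show ?thesis using assms by (fastforce simp: sorted_wrt_append)
qed (use assms in \<open>auto simp: sorted_wrt_append\<close>)

lemma bump_mem [simp]: "u \<in> set (fst (bump S u))"
  by (induction S) auto

lemma bump_keep: "x \<in> set S \<Longrightarrow> x \<le> u \<Longrightarrow> inc S \<Longrightarrow> x \<in> set (fst (bump S u))"
  by (induction S) auto

lemma bump_subset: "set (fst (bump S u)) \<subseteq> insert u (set S)"
  by (induction S) auto

lemma bump_not_Nil [simp]: "fst (bump S u) \<noteq> []"
  by (cases S) auto

lemma length_bump: "length (fst (bump S u)) + length (snd (bump S u)) = Suc (length S)"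
  by (induction S) auto

lemma length_bump_ge: "length S \<le> length (fst (bump S u))"
  by (induction S) auto

lemma bump_out_gt: "inc S \<Longrightarrow> bump S u = (S', [b]) \<Longrightarrow> u < b"
  by (erule bump_cases[where u = u]) auto

lemma bump_out_cases: "snd (bump S u) = [] \<or> (\<exists>b. snd (bump S u) = [b])"
  by (induction S) auto

lemma bump_out_le:
  assumes "inc S" "w \<in> set S" "u < w"
  shows "\<exists>b. snd (bump S u) = [b] \<and> b \<le> w \<and> u < b"
  using assms(1) by (cases rule: bump_cases[where u = u]) (use assms in \<open>auto simp: sorted_wrt_append\<close>)

lemma bump_none: "inc S \<Longrightarrow> snd (bump S u) = [] \<Longrightarrow> (\<forall>s\<in>set S. s < u) \<and> fst (bump S u) = S @ [u]"
  by (erule bump_cases[where u = u]) auto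

text \<open>Because of \<open>b < v\<close>, the place where \<open>u\<close> acts lies strictly to
  the left of the place where \<open>v\<close> acts, so the two insertions touch disjoint segments
  of the row.\<close>

lemma bump_commute:
  assumes "inc S" "u < v" "bump S u = (S1, [b])" "b < v"
  shows "bump (fst (bump S v)) u = (fst (bump S1 v), [b])" "snd (bump S v) = snd (bump S1 v)"
proof -
  have "bump (fst (bump S v)) u = (fst (bump S1 v), [b]) \<and> snd (bump S v) = snd (bump S1 v)"
    using assms(1)
  proof (cases rule: bump_cases[where u = u])
    case snoc
    then show ?thesis using assms by simp
  next
    case (less L m M)
    then have m: "S1 = L @ u # M" "m = b" using assms by auto
    have L: "\<forall>s\<in>set L. s < v" using less assms by auto
    have "bump S v = (L @ m # fst (bump M v), snd (bump M v))"
      using bump_append[OF L, of "m # M"] less m assms by simp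
    moreover have "bump S1 v = (L @ u # fst (bump M v), snd (bump M v))"
      using bump_append[OF L, of "u # M"] less m assms by simp
    ultimately show ?thesis
      using bump_append[of L u "m # fst (bump M v)"] less m by simp
  next
    case (eq L M)
    have L: "\<forall>s\<in>set L. s < v" using eq assms by auto
    have "bump S v = (L @ u # fst (bump M v), snd (bump M v))"
      using bump_append[OF L, of "u # M"] eq assms by simp
    then show ?thesis
      using bump_append[of L u "u # fst (bump M v)"] eq assms by auto
  qed
  then show "bump (fst (bump S v)) u = (fst (bump S1 v), [b])" "snd (bump S v) = snd (bump S1 v)"
    by auto
qed

text \<open>One half of the row bumping lemma for an increasing pair; \<open>bump_none_mono\<close>
  treats the case in which the first letter bumps nothing.\<close>

lemma bump_mono:
  assumes "inc S" "u < v" "bump S u = (S1, [b])" "bump S1 v = (S2, [b'])"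
  shows "b < b'"
  using assms(1)
proof (cases rule: bump_cases[where u = u])
  case snoc
  then show ?thesis using assms by simp
next
  case (less L m M)
  then have m: "S1 = L @ u # M" "m = b" using assms by auto
  have L: "\<forall>s\<in>set (L @ [u]). s < v" using less assms by auto
  have out: "snd (bump M v) = [b']"
    using bump_append[OF L, of M] assms(4) m by simp
  have "inc M" "\<forall>x\<in>set M. m < x"
    using assms(1) less by (auto simp: sorted_wrt_append)
  then show ?thesis
    using out m by (elim bump_cases[where u = v]) auto
next
  case (eq L M)
  then show ?thesis using assms bump_out_gt[of S v S2 b'] by auto
qed

lemma bump_none_mono:
  assumes "inc S" "u < v" "bump S u = (S1, [])"
  shows "bump S1 v = (S1 @ [v], [])"
proof -
  have "\<forall>s\<in>set S. s < u" "S1 = S @ [u]" using bump_none[of S u] assms by auto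
  then have "\<forall>s\<in>set S1. s < v" using assms by auto
  then show ?thesis using bump_append[of S1 v "[]"] by simp
qed

subsection \<open>Bumping and Coxeter--Knuth equivalence\<close>

text \<open>A Knuth move takes \<open>u\<close> left past an entry if a letter of intermediate size
  stands before that entry; the preceding entry of the row serves until only \<open>m\<close> is
  left.\<close>

lemma ck_move_small:
  "inc (m # M) \<Longrightarrow> u < m \<Longrightarrow> m # M @ [u] \<approx> [m, u] @ M"
proof (induction M rule: rev_induct)
  case (snoc x M)
  obtain N y where N: "m # M = N @ [y]" by (metis append_butlast_last_id list.distinct(1))
  have "y < x" "u < y"
    using snoc.prems N by (auto simp: sorted_wrt_append) (metis append.assoc append_Cons
      append_Nil in_set_conv_decomp less_trans list.set_intros(1) set_ConsD sorted_wrt_append sorted_wrt.simps(2))+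
  then have "N @ [y, x, u] \<approx> N @ [y, u, x]"
    using ck_append1[OF ck_bca] by blast
  then have "m # (M @ [x]) @ [u] \<approx> (m # M @ [u]) @ [x]"
    using N by (metis append.assoc append_Cons append_Nil)
  also have "\<dots> \<approx> ([m, u] @ M) @ [x]"
    using snoc by (intro ck_append2) (auto simp: sorted_wrt_append)
  finally show ?case by simp
qed simp

text \<open>Mirror image of \<open>ck_move_small\<close>: the large letter travels left, and the
  witness of intermediate size is the letter to its right.\<close>

lemma ck_move_large:
  assumes "inc (L @ [u])" "u < m"
  shows "L @ [m, u] \<approx> m # L @ [u]"
  using assms
proof (induction L arbitrary: u rule: rev_induct)
  case (snoc x L)
  have "x < u" using snoc.prems by (auto simp: sorted_wrt_append)
  then have "L @ [x, m, u] \<approx> L @ [m, x, u]"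
    using snoc.prems by (intro ck_append1 ck_acb) auto
  then have "(L @ [x]) @ [m, u] \<approx> (L @ [m, x]) @ [u]" by simp
  also have "\<dots> \<approx> (m # L @ [x]) @ [u]"
    using snoc \<open>x < u\<close> by (intro ck_append2 snoc.IH) (auto simp: sorted_wrt_append)
  finally show ?case by simp
qed simp

text \<open>Otherwise \<open>u\<close> could travel left until it forms \<open>u u\<close>, or
  \<open>u m u\<close> with \<open>m\<close> at distance at least 2. This is why \<open>bump\<close>
  may emit \<open>u + 1\<close> when \<open>u\<close> is already present.\<close>

lemma bump_eq_next:
  assumes "inc (L @ u # M)" "ck_reduced (L @ u # M @ [u])"
  obtains M' where "M = (u + 1) # M'"
proof (cases M)
  case Nil
  then show ?thesis using assms(2) not_ck_reduced_xx[of L u "[]"] by simp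
next
  case (Cons m M')
  have m: "inc (m # M')" "u < m" using assms(1) Cons by (auto simp: sorted_wrt_append)
  have "L @ u # M @ [u] \<approx> (L @ [u]) @ [m, u] @ M'"
    using ck_append1[OF ck_move_small[OF m], of "L @ [u]"] Cons by simp
  then have "ck_reduced (L @ u # m # u # M')"
    using assms(2) ck_reduced_ck by fastforce
  then have "\<not> \<bar>u - m\<bar> \<ge> 2" using not_ck_reduced_xyx by blast
  then have "m = u + 1" using m by linarith
  then show ?thesis using Cons that by blast
qed

text \<open>Moving the new \<open>u\<close> left produces the factor \<open>u (u+1) u\<close>; a
  braid move turns it into a copy of \<open>u + 1\<close> that can leave to the left.\<close>

lemma ck_bump_eq:
  assumes "inc (L @ u # (u + 1) # M)"
  shows "L @ u # (u + 1) # M @ [u] \<approx> (u + 1) # L @ u # (u + 1) # M"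
proof -
  have "L @ u # (u + 1) # M @ [u] = (L @ [u]) @ ((u + 1) # M @ [u])" by simp
  also have "\<dots> \<approx> (L @ [u]) @ ([u + 1, u] @ M)"
    using assms by (intro ck_append1 ck_move_small) (auto simp: sorted_wrt_append)
  also have "(L @ [u]) @ ([u + 1, u] @ M) = L @ [u, u + 1, u] @ M" by simp
  also have "\<dots> \<approx> L @ [u + 1, u, u + 1] @ M"
    by (intro ck_context ck_braid) simp
  also have "L @ [u + 1, u, u + 1] @ M = (L @ [u + 1, u]) @ (u + 1) # M" by simp
  also have "\<dots> \<approx> ((u + 1) # L @ [u]) @ (u + 1) # M"
    using assms by (intro ck_append2 ck_move_large) (auto simp: sorted_wrt_append)
  finally show ?thesis by simp
qed

lemma ck_bump_less:
  assumes "inc (L @ m # M)" "\<forall>s\<in>set L. s < u" "u < m"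
  shows "L @ m # M @ [u] \<approx> m # L @ u # M"
proof -
  have "L @ m # M @ [u] \<approx> L @ [m, u] @ M"
    using assms ck_append1[OF ck_move_small[of m M u]] by (auto simp: sorted_wrt_append)
  also have "L @ [m, u] @ M = (L @ [m, u]) @ M" by simp
  also have "\<dots> \<approx> (m # L @ [u]) @ M"
    using assms by (intro ck_append2 ck_move_large) (auto simp: sorted_wrt_append)
  finally show ?thesis by simp
qed

lemma ck_bump:
  assumes "inc S" "ck_reduced (S @ [u])"
  shows "S @ [u] \<approx> snd (bump S u) @ fst (bump S u)"
  using assms(1)
proof (cases rule: bump_cases[where u = u])
  case (less L m M)
  then show ?thesis using ck_bump_less[of L m M u] assms by simp
next
  case (eq L M)
  then obtain M' where "M = (u + 1) # M'" using assms bump_eq_next[of L u M] by auto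
  then show ?thesis using ck_bump_eq[of L u M'] assms eq by simp
qed simp

text \<open>The reversal of \<open>ck_bump\<close>. Popping leaves a decreasing run at the end of a
  word; letters in front of the run are inserted into it from the left, and what they bump out
  appears at the right end.\<close>

lemma ck_bump_left:
  assumes "inc X" "ck_reduced (u # rev X)"
  shows "u # rev X \<approx> rev (fst (bump X u)) @ snd (bump X u)"
proof -
  have "X @ [u] \<approx> snd (bump X u) @ fst (bump X u)"
    using assms ck_bump[of X u] ck_reduced_rev[of "X @ [u]"] by simp
  then have "rev (X @ [u]) \<approx> rev (snd (bump X u) @ fst (bump X u))" by (rule ck_rev)
  then show ?thesis using bump_out_cases[of X u] by auto
qed

lemma bump_mem_next:
  assumes "inc S" "ck_reduced (S @ [u])" "u \<in> set S"
  shows "u + 1 \<in> set S"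
proof -
  obtain L M where S: "S = L @ u # M" using assms(3) by (meson split_list)
  then obtain M' where "M = (u + 1) # M'" using assms bump_eq_next[of L u M] by auto
  then show ?thesis using S by simp
qed

lemma bump_out_mem: "inc S \<Longrightarrow> bump S u = (S', [b]) \<Longrightarrow> b \<in> set S \<or> u \<in> set S \<and> b = u + 1"
  by (erule bump_cases[where u = u]) auto

lemma bump_gap:
  assumes "inc S" "bump S a = (S1, [w])" "s \<in> set S1" "a < s"
  shows "w < s \<or> (a \<in> set S \<and> w = a + 1)"
  using assms(1)
  by (cases rule: bump_cases[where u = a]) (use assms in \<open>fastforce simp: sorted_wrt_append\<close>)+

section \<open>Row insertion of whole words and its behaviour under Coxeter--Knuth moves\<close>

fun bumps :: "int list \<Rightarrow> int list \<Rightarrow> int list \<times> int list" where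
  "bumps S [] = (S, [])"
| "bumps S (x # xs) =
     (fst (bumps (fst (bump S x)) xs), snd (bump S x) @ snd (bumps (fst (bump S x)) xs))"

lemma bumps_append:
  "bumps S (u @ v) =
     (fst (bumps (fst (bumps S u)) v), snd (bumps S u) @ snd (bumps (fst (bumps S u)) v))"
  by (induction u arbitrary: S) auto

lemma bumps_prefix:
  "\<forall>s\<in>set L. \<forall>u\<in>set w. s < u \<Longrightarrow> bumps (L @ S) w = (L @ fst (bumps S w), snd (bumps S w))"
  by (induction w arbitrary: S) (auto simp: bump_append)

lemma length_bumps: "length (fst (bumps S w)) + length (snd (bumps S w)) = length S + length w"
proof (induction w arbitrary: S)
  case (Cons x w)
  show ?case using Cons[of "fst (bump S x)"] length_bump[of S x] by simp
qed simp

lemma ck_bumps: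
  assumes "inc S" "ck_reduced (S @ w)"
  shows "S @ w \<approx> snd (bumps S w) @ fst (bumps S w) \<and> inc (fst (bumps S w))"
  using assms
proof (induction w arbitrary: S)
  case (Cons x w)
  define S1 where "S1 = fst (bump S x)"
  have 1: "S @ [x] \<approx> snd (bump S x) @ S1"
    unfolding S1_def using Cons.prems ck_reduced_prefix[of "S @ [x]" w] by (intro ck_bump) auto
  have 2: "S @ x # w \<approx> snd (bump S x) @ S1 @ w"
    using ck_append2[OF 1, of w] by simp
  then have "ck_reduced (S1 @ w)"
    using Cons.prems ck_reduced_ck ck_reduced_suffix by blast
  then have 3: "S1 @ w \<approx> snd (bumps S1 w) @ fst (bumps S1 w) \<and> inc (fst (bumps S1 w))"
    using Cons.IH[of S1] Cons.prems inc_bump by (auto simp: S1_def)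
  then have "S @ x # w \<approx> snd (bump S x) @ snd (bumps S1 w) @ fst (bumps S1 w)"
    using 2 ck_append1 ck_trans by blast
  then show ?case using 3 by (simp add: S1_def)
qed simp

lemma inc_bumps: "inc S \<Longrightarrow> inc (fst (bumps S w))"
  by (induction w arbitrary: S) auto

text \<open>If the letter \<open>w\<close> bumped out by \<open>a\<close> is below \<open>c\<close>,
  then \<open>a\<close> and \<open>c\<close> commute, and \<open>b\<close> afterwards bumps out a
  letter strictly between \<open>w\<close> and whatever \<open>c\<close> bumps out: the emitted
  letters differ by a move of the same type. Otherwise \<open>a\<close> acts at the end of the row
  or on an entry at least \<open>c\<close>, and the results are computed outright.\<close>

lemma bumps_acb:
  assumes "a < b" "b < c" "inc S" "ck_reduced (S @ [a, c, b])"
  shows "fst (bumps S [a, c, b]) = fst (bumps S [c, a, b])"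
    and "snd (bumps S [a, c, b]) \<approx> snd (bumps S [c, a, b])"
proof -
  have red': "ck_reduced (S @ [c, a, b])"
    using assms ck_reduced_ck ck_append1 ck_acb by blast
  let ?goal = "fst (bumps S [a, c, b]) = fst (bumps S [c, a, b]) \<and>
    snd (bumps S [a, c, b]) \<approx> snd (bumps S [c, a, b])"
  have main: ?goal if w: "bump S a = (S1, [w])" "w < c" for S1 w
  proof -
    obtain S2 oc where 2: "bump S1 c = (S2, oc)" by fastforce
    have S1: "inc S1" using inc_bump[of S a] assms w by simp
    have S2: "inc S2" using inc_bump[of S1 c] S1 2 by simp
    obtain Sc where c: "bump S c = (Sc, oc)" "bump Sc a = (S2, [w])"
      using bump_commute[of S a c S1 w] assms w 2 by (metis fst_conv less_trans prod.exhaust_sel snd_conv)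
    have "c \<in> set S2" using bump_mem[of c S1] 2 by simp
    then obtain S3 \<beta> where 3: "bump S2 b = (S3, [\<beta>])" "\<beta> \<le> c"
      using bump_out_le[of S2 c b] S2 assms by (metis prod.exhaust_sel)
    have "w < \<beta>"
    proof -
      have sub: "set S2 \<subseteq> insert c (set S1)" using bump_subset[of S1 c] 2 by simp
      have "b < \<beta>" using bump_out_gt 3 S2 by blast
      have "\<beta> \<in> set S2 \<or> b \<in> set S2 \<and> \<beta> = b + 1" using bump_out_mem 3 S2 by blast
      then consider "\<beta> = c" | "\<beta> \<in> set S1" | "b \<in> set S1" using sub assms by auto
      then show ?thesis
        using w \<open>b < \<beta>\<close> assms bump_gap[of S a S1 w \<beta>] bump_gap[of S a S1 w b] by cases force+
    qed
    have "\<gamma> > \<beta>" if "oc = [\<gamma>]" for \<gamma>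
      using that bump_out_gt[of S1 c S2 \<gamma>] 2 3 S1 by simp
    then have "[w] @ oc @ [\<beta>] \<approx> oc @ [w, \<beta>]"
      using bump_out_cases[of S1 c] 2 \<open>w < \<beta>\<close> ck_acb[of w \<beta>] by fastforce
    then show ?thesis using w 2 c 3 by simp
  qed
  have ?goal
    using assms(3)
  proof (cases rule: bump_cases[where u = a])
    case snoc
    then have "\<forall>s\<in>set S. s < b" "\<forall>s\<in>set S. s < c" using assms by auto
    then show ?thesis using snoc assms bump_append[of S c "[]"] by (auto simp: bump_append)
  next
    case (eq L M)
    then show ?thesis using main[of S "a + 1"] assms by simp
  next
    case (less L m M)
    show ?thesis
    proof (cases "m < c")
      case True
      then show ?thesis using main less by simp
    next
      case mc: False
      have La: "\<forall>s\<in>set L. s < a" "\<forall>s\<in>set L. s < b" "\<forall>s\<in>set L. s < c"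
        using less assms by auto
      have incM: "inc (m # M)" using assms less by (auto simp: sorted_wrt_append)
      show ?thesis
      proof (cases M)
        case Nil
        have "m \<noteq> c"
          using bump_mem_next[of S c] assms red' ck_reduced_prefix[of "S @ [c]" "[a, b]"] less La Nil
          by fastforce
        then show ?thesis using less La Nil assms mc by (auto simp: bump_append)
      next
        case (Cons z M')
        have z: "m < z" using incM Cons by simp
        show ?thesis
        proof (cases "m = c")
          case True
          have "ck_reduced (S @ [c])" using red' ck_reduced_prefix[of "S @ [c]" "[a, b]"] by simp
          then have "z = c + 1"
            using bump_mem_next[of S c] assms less La Cons True incM by auto
          moreover have "[c, c + 1, c] \<approx> [c + 1, c, c + 1]" by (rule ck_braid) simp
          ultimately show ?thesis using less La Cons assms True by (auto simp: bump_append)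
        next
          case False
          have "[m, z, c] \<approx> [m, c, z]" using mc z False by (intro ck_bca) auto
          then show ?thesis using less La Cons assms mc z False by (auto simp: bump_append)
        qed
      qed
    qed
  qed
  then show "fst (bumps S [a, c, b]) = fst (bumps S [c, a, b])"
    and "snd (bumps S [a, c, b]) \<approx> snd (bumps S [c, a, b])" by auto
qed

text \<open>Once \<open>b\<close> is in the row, \<open>a\<close> bumps out some \<open>w\<close>
  with \<open>w \<le> b < c\<close>, so \<open>a\<close> and \<open>c\<close> commute. The letter
  bumped out by \<open>b\<close>, if any, exceeds \<open>w\<close> and is the witness for exchanging
  the other two.\<close>

lemma bumps_bca:
  assumes "a < b" "b < c" "inc S"
  shows "fst (bumps S [b, c, a]) = fst (bumps S [b, a, c])"
    and "snd (bumps S [b, c, a]) \<approx> snd (bumps S [b, a, c])"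
proof -
  obtain T ob where b: "bump S b = (T, ob)" by fastforce
  have T: "inc T" "b \<in> set T" using b inc_bump[of S b] assms bump_mem[of b S] by auto
  obtain T1 w where w: "bump T a = (T1, [w])" "w \<le> b" "a < w"
    using bump_out_le[of T b a] T assms by (metis prod.exhaust_sel)
  obtain T2 oc where c: "bump T1 c = (T2, oc)" by fastforce
  obtain Tc where c': "bump T c = (Tc, oc)" "bump Tc a = (T2, [w])"
    using bump_commute[of T a c T1 w] assms w c T by (metis fst_conv less_trans prod.exhaust_sel snd_conv
        order.strict_trans1)
  have "ob @ oc @ [w] \<approx> ob @ [w] @ oc"
  proof (cases "ob = [] \<or> oc = []")
    case True
    then show ?thesis using bump_none_mono[of S b c T] assms b c' by auto
  next
    case False
    then obtain \<beta> \<gamma> where bg: "ob = [\<beta>]" "oc = [\<gamma>]"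
      using bump_out_cases[of S b] bump_out_cases[of T c] b c' by auto
    have "\<beta> < \<gamma>" "b < \<beta>" using bump_mono[of S b c T \<beta> Tc \<gamma>] bump_out_gt[of S b T \<beta>] assms b c' bg by auto
    then show ?thesis using bg ck_bca[of w \<beta> \<gamma>] w by simp
  qed
  then show "fst (bumps S [b, c, a]) = fst (bumps S [b, a, c])"
    and "snd (bumps S [b, c, a]) \<approx> snd (bumps S [b, a, c])"
    using b c c' w by simp_all
qed

text \<open>If \<open>a\<close> is in the row or bumps out \<open>b\<close>, reducedness puts
  \<open>a + 2\<close> behind, and the emitted letters are the braid raised by one. In the remaining
  cases they agree or differ by a \<open>bca\<close> move.\<close>

lemma bumps_braid:
  assumes b: "b = a + 1" and "inc S" "ck_reduced (S @ [a, b, a])"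
  shows "fst (bumps S [a, b, a]) = fst (bumps S [b, a, b])"
    and "snd (bumps S [a, b, a]) \<approx> snd (bumps S [b, a, b])"
proof -
  have br: "[a, a + 1, a] \<approx> [a + 1, a, a + 1]" "[a + 1, 2 + a, a + 1] \<approx> [2 + a, a + 1, 2 + a]" for a :: int
    by (rule ck_braid, simp)+
  have red': "ck_reduced (S @ [b, a, b])"
    using assms ck_reduced_ck ck_append1 br by blast
  have ra: "ck_reduced (S @ [a])" and rb: "ck_reduced (S @ [b])"
    using assms(3) red' ck_reduced_prefix[of "S @ [a]" "[b, a]"] ck_reduced_prefix[of "S @ [b]" "[a, b]"] by auto
  have rb': "b \<in> set S \<Longrightarrow> a + 2 \<in> set S" using bump_mem_next[of S b] rb assms by (auto simp: add.commute)
  have "fst (bumps S [a, b, a]) = fst (bumps S [b, a, b]) \<and>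
    snd (bumps S [a, b, a]) \<approx> snd (bumps S [b, a, b])"
    using assms(2)
  proof (cases rule: bump_cases[where u = a])
    case snoc
    then have "\<forall>s\<in>set S. s < b" using b by auto
    then show ?thesis using snoc b bump_append[of S b "[]"] by (auto simp: bump_append)
  next
    case (eq L M)
    then have "b \<in> set S" using bump_mem_next[of S a] ra assms by auto
    then obtain M' where M: "M = b # M'"
      using bump_eq_next[of L a M] ra eq assms by auto
    have "\<forall>s\<in>set L. s < b" using eq b by auto
    then show ?thesis using eq M b br(2)[of a] by (auto simp: bump_append)
  next
    case (less L m M)
    have La: "\<forall>s\<in>set L. s < a" "\<forall>s\<in>set L. s < b"
      using less b by auto
    have incM: "inc (m # M)" using assms less by (auto simp: sorted_wrt_append)
    show ?thesis
    proof (cases "m = b")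
      case True
      then have "a + 2 \<in> set M" using rb' less La b incM by auto
      then obtain M' where M: "M = (2 + a) # M'"
      proof (cases M)
        case (Cons x M')
        then have "x = 2 + a" using \<open>a + 2 \<in> set M\<close> incM True b by fastforce
        then show ?thesis using Cons that by simp
      qed (use \<open>a + 2 \<in> set M\<close> in simp)
      then show ?thesis using less La b True br(2)[of a] by (auto simp: bump_append)
    next
      case False
      then have m: "b < m" using less b by simp
      show ?thesis
      proof (cases M)
        case Nil
        then show ?thesis using less La b m by (auto simp: bump_append)
      next
        case (Cons z M')
        then have z: "m < z" using incM by simp
        have "[m, z, b] \<approx> [m, b, z]" using m z by (intro ck_bca) auto
        then show ?thesis using less La b m z Cons by (auto simp: bump_append)
      qed
    qed
  qed
  then show "fst (bumps S [a, b, a]) = fst (bumps S [b, a, b])"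
    and "snd (bumps S [a, b, a]) \<approx> snd (bumps S [b, a, b])" by auto
qed

subsection \<open>First row and emitted word\<close>

definition frow :: "int list \<Rightarrow> int list" where "frow w = fst (bumps [] w)"
definition emit :: "int list \<Rightarrow> int list" where "emit w = snd (bumps [] w)"

lemma frow_append: "frow (u @ v) = fst (bumps (frow u) v)"
  and emit_append: "emit (u @ v) = emit u @ snd (bumps (frow u) v)"
  by (simp_all add: frow_def emit_def bumps_append)

lemma inc_frow [simp, intro]: "inc (frow w)"
  by (simp add: frow_def inc_bumps)

lemma ck_emit_frow: "ck_reduced w \<Longrightarrow> w \<approx> emit w @ frow w"
  using ck_bumps[of "[]" w] by (simp add: frow_def emit_def)

lemma length_frow_emit: "length (frow w) + length (emit w) = length w"
  using length_bumps[of "[]" w] by (simp add: frow_def emit_def)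

lemma frow_Nil [simp]: "frow [] = []" and emit_Nil [simp]: "emit [] = []"
  by (simp_all add: frow_def emit_def)

lemma bumps_not_Nil: "S \<noteq> [] \<or> w \<noteq> [] \<Longrightarrow> fst (bumps S w) \<noteq> []"
  by (induction w arbitrary: S) auto

lemma frow_eq_Nil [simp]: "frow w = [] \<longleftrightarrow> w = []"
  by (metis bumps_not_Nil frow_Nil frow_def)

lemma ck_reduced_frow_append:
  assumes "ck_reduced (u @ v)"
  shows "ck_reduced (frow u @ v)"
proof -
  have "u @ v \<approx> emit u @ frow u @ v"
    using ck_append2[OF ck_emit_frow[of u], of v] assms ck_reduced_prefix by auto
  then show ?thesis
    using assms ck_reduced_ck ck_reduced_suffix by blast
qed

lemma ck_step_frow_emit:
  assumes "ck_step u v" "ck_reduced u"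
  shows "frow u = frow v \<and> emit u \<approx> emit v"
proof -
  have *: "frow u = frow v \<and> emit u \<approx> emit v"
    if "u = p @ t @ q" "v = p @ t' @ q"
      "ck_reduced (frow p @ t) \<Longrightarrow> fst (bumps (frow p) t) = fst (bumps (frow p) t')
        \<and> snd (bumps (frow p) t) \<approx> snd (bumps (frow p) t')" for p t t' q
  proof -
    have "ck_reduced (p @ t)" using assms(2) that(1) ck_reduced_prefix[of "p @ t" q] by simp
    then have "ck_reduced (frow p @ t)" by (rule ck_reduced_frow_append)
    with that show ?thesis
      by (auto simp: frow_append emit_append bumps_append intro!: ck_append)
  qed
  from assms(1) show ?thesis
  proof cases
    case (1 a b c p q)
    then show ?thesis using bumps_acb[of a b c "frow p"] by (intro *[of p _ q]) auto
  next
    case (2 a b c p q)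
    then show ?thesis using bumps_bca[of a b c "frow p"] by (intro *[of p _ q]) auto
  next
    case (3 a b p q)
    then have "b = a + 1 \<or> a = b + 1" by linarith
    then show ?thesis
    proof
      assume "b = a + 1"
      then show ?thesis using bumps_braid[of b a "frow p"] 3 by (intro *[of p _ q]) auto
    next
      assume ab: "a = b + 1"
      show ?thesis
      proof (rule *[OF 3(1,2)])
        assume "ck_reduced (frow p @ [a, b, a])"
        then have "ck_reduced (frow p @ [b, a, b])"
          using ck_reduced_ck ck_append1 ck_braid[of a b] 3 by blast
        then show "fst (bumps (frow p) [a, b, a]) = fst (bumps (frow p) [b, a, b]) \<and>
            snd (bumps (frow p) [a, b, a]) \<approx> snd (bumps (frow p) [b, a, b])"
          using bumps_braid[of a b "frow p"] ab ck_sym by auto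
      qed
    qed
  qed
qed

lemma ck_frow_emit:
  assumes "u \<approx> v" "ck_reduced u"
  shows "frow u = frow v \<and> emit u \<approx> emit v"
proof -
  have "equivclp ck_step u v" using assms(1) by (simp add: coxeter_knuth_def)
  then show ?thesis
  proof (induction rule: equivclp_induct)
    case (step y z)
    have "ck_reduced y" "ck_reduced z"
      using step assms(2) by (metis ck_reduced_ck coxeter_knuth_def equivclp_into_equivclp)+
    then have "frow y = frow z \<and> emit y \<approx> emit z"
      using step(2) ck_step_frow_emit ck_sym by metis
    then show ?case using step ck_trans by metis
  qed simp
qed

lemma ck_reduced_emit: "ck_reduced w \<Longrightarrow> ck_reduced (emit w)"
  using ck_emit_frow ck_reduced_ck ck_reduced_prefix by blast

subsection \<open>The tail of the first row\<close>

text \<open>The shape that parity imposes on a tail that can be popped: an odd letter occurs only as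
  the first half of a pair of consecutive integers.\<close>

fun paired :: "int list \<Rightarrow> bool" where
  "paired [] = True"
| "paired (x # xs) =
     (if even x then paired xs else xs \<noteq> [] \<and> hd xs = x + 1 \<and> paired (tl xs))"

text \<open>Collects the letters split off when the tail of a row is popped from the right by
  \<open>x y \<mapsto> y x\<close> for even \<open>x\<close>, \<open>y\<close> and \<open>(y - 1) y \<mapsto> (y + 1) y\<close> for even \<open>y\<close>;
  the head is the letter that remains.\<close>

fun promote :: "int list \<Rightarrow> int list" where
  "promote [] = []"
| "promote (x # xs) =
     (if even x then x # promote xs else (x + 1) # (x + 2) # promote (tl xs))"

lemma paired_append: "paired L \<Longrightarrow> paired (L @ M) = paired M"
proof (induction L rule: paired.induct)
  case (2 x xs)
  then show ?case by (cases xs) (auto split: if_splits)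
qed simp

lemma promote_append: "paired L \<Longrightarrow> promote (L @ M) = promote L @ promote M"
proof (induction L rule: paired.induct)
  case (2 x xs)
  then show ?case by (cases xs) (auto split: if_splits)
qed simp

lemma paired_split_even:
  "paired (L @ x # M) \<Longrightarrow> even x \<Longrightarrow> paired (L @ [x]) \<and> paired M"
proof (induction L rule: paired.induct)
  case (2 l L)
  then show ?case by (cases L) (auto split: if_splits)
qed simp

lemma paired_split_odd:
  "paired (L @ x # M) \<Longrightarrow> odd x \<Longrightarrow> paired L \<and> paired (x # M)"
proof (induction L rule: paired.induct)
  case (2 l L)
  show ?case
  proof (cases "even l")
    case True
    then show ?thesis using 2 by simp
  next
    case False
    then have "hd (L @ x # M) = l + 1" "paired (tl (L @ x # M))" using 2 by auto
    moreover from this have "L \<noteq> []" using 2(4) False by force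
    ultimately show ?thesis using 2 False by simp
  qed
qed simp

lemma promote_mem:
  "paired xs \<Longrightarrow> g \<in> set (promote xs) \<longleftrightarrow> (even g \<and> g \<in> set xs) \<or> (odd g \<and> g - 2 \<in> set xs)"
proof (induction xs rule: paired.induct)
  case (2 x xs)
  then show ?case by (cases xs) (auto split: if_splits)
qed simp

lemma length_promote [simp]: "paired xs \<Longrightarrow> length (promote xs) = length xs"
proof (induction xs rule: paired.induct)
  case (2 x xs)
  then show ?case by (cases xs) (auto split: if_splits)
qed simp

lemma promote_eq_Nil [simp]: "promote xs = [] \<longleftrightarrow> xs = []"
  by (cases xs) auto

lemma inc_promote: "paired xs \<Longrightarrow> inc xs \<Longrightarrow> inc (promote xs)"
proof (induction xs rule: paired.induct)
  case (2 x xs)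
  show ?case
  proof (cases "even x")
    case True
    then have "\<forall>g\<in>set (promote xs). x < g"
      using 2 by (force simp: promote_mem)
    then show ?thesis using 2 True by auto
  next
    case False
    then obtain ys where xs: "xs = (x + 1) # ys" using 2 by (cases xs) auto
    have "x + 2 < g" if "g \<in> set (promote ys)" for g
    proof -
      have ge: "\<forall>y\<in>set ys. x + 2 \<le> y" using 2 xs by auto
      have "(even g \<and> g \<in> set ys) \<or> (odd g \<and> g - 2 \<in> set ys)"
        using that promote_mem[of ys g] 2 xs False by simp
      then have "x + 2 \<le> g" "odd g \<Longrightarrow> x + 4 \<le> g" using ge by auto
      moreover have "even g \<Longrightarrow> g \<noteq> x + 2" using False by auto
      ultimately show ?thesis by (cases "even g") auto
    qed
    then show ?thesis using 2 False xs by (fastforce)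
  qed
qed simp

lemma hd_le_inc: "inc xs \<Longrightarrow> x \<in> set xs \<Longrightarrow> hd xs \<le> x"
  by (cases xs) auto

section \<open>How a swap of the last two letters changes the result of popping\<close>

lemma ck_bump_left2:
  assumes "inc X" "ck_reduced ([u, v] @ rev X)" "bump X v = (X1, o1)" "bump X1 u = (X2, o2)"
  shows "[u, v] @ rev X \<approx> rev X2 @ o2 @ o1"
proof -
  have "v # rev X \<approx> rev X1 @ o1"
    using ck_bump_left[of X v] assms ck_reduced_suffix[of "[u]" "v # rev X"] by simp
  then have 1: "[u, v] @ rev X \<approx> (u # rev X1) @ o1" using ck_Cons by simp
  then have "ck_reduced (u # rev X1)" using assms(2) ck_reduced_ck ck_reduced_prefix by blast
  moreover have "inc X1" using inc_bump[of X v] assms by simp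
  ultimately have "u # rev X1 \<approx> rev X2 @ o2" using ck_bump_left[of X1 u] assms by simp
  then have "(u # rev X1) @ o1 \<approx> (rev X2 @ o2) @ o1" by (rule ck_append2)
  then show ?thesis using 1 ck_trans by simp
qed

text \<open>From here on words are reversed, so that the initial steps act on the last two letters.\<close>

definition swap_end :: "int \<Rightarrow> int \<Rightarrow> int list" where
  "swap_end x y = (if even x then [y, x] else [y + 1, y])"

text \<open>The two words again differ by a move on their last two letters, now behind a decreasing
  run. The letter \<open>w\<close> below \<open>b\<close> is recorded so that
  \<open>left_bumps\<close> can later produce increasing letters in front of \<open>b b'\<close>.
  The parity of \<open>b\<close> is still unknown here, hence \<open>v\<close> is not given as
  \<open>swap_end b b'\<close>.\<close>

definition tail_related :: "int \<Rightarrow> int list \<Rightarrow> int list \<Rightarrow> bool" where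
  "tail_related w W W' \<longleftrightarrow> W \<approx> W' \<or>
     (\<exists>Z b b' v. inc Z \<and> w \<in> set Z \<and> w < b \<and> b < b' \<and> W \<approx> rev Z @ [b, b'] \<and> W' \<approx> rev Z @ v \<and>
        (v = [b', b] \<or> b = b' - 1 \<and> even b' \<and> v = [b' + 1, b']))"

lemma tail_relatedI:
  "inc Z \<Longrightarrow> w \<in> set Z \<Longrightarrow> w < b \<Longrightarrow> b < b' \<Longrightarrow> W \<approx> rev Z @ [b, b'] \<Longrightarrow> W' \<approx> rev Z @ v \<Longrightarrow>
    v = [b', b] \<or> b = b' - 1 \<and> even b' \<and> v = [b' + 1, b'] \<Longrightarrow> tail_related w W W'"
  unfolding tail_related_def by blast

text \<open>Here two letters act next to each other. In one order they bump out the adjacent entries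
  \<open>z\<close>, \<open>z'\<close>; in the other the larger one bumps out \<open>zz\<close> and
  is then bumped out itself as \<open>y\<close>. \<open>G\<close> is the part of the promoted row to
  the left of this place, without the letter that remains.\<close>

lemma tail_adjacent:
  assumes "inc (G @ y # promote M)" "inc (G @ promote (z' # M))" "y \<le> z" "inc (z # z' # M)"
    and "z = y \<Longrightarrow> z' = y + 1" "paired (z' # M)" "paired M"
    and zz: "zz = (if z = y then y + 1 else z)"
    and r: "ck_reduced ([z, z'] @ rev (G @ y # promote M))"
    and r': "ck_reduced ([zz, y] @ rev (G @ promote (z' # M)))"
  shows "tail_related z ([z, z'] @ rev (G @ y # promote M)) ([zz, y] @ rev (G @ promote (z' # M)))"
proof -
  have zz': "z < z'" using assms by simp
  have Gy: "\<forall>s\<in>set G. s < y" using assms(1) by (simp add: sorted_wrt_append)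
  then have G: "\<forall>s\<in>set G. s < z" "\<forall>s\<in>set G. s < z'" "\<forall>s\<in>set G. s < y + 1" using assms(3) zz' by auto
  have zzG: "\<forall>s\<in>set G. s < zz" using G zz by auto
  have Mz: "\<forall>g\<in>set (promote M). z' < g"
    using assms(4,7) by (force simp: promote_mem)
  \<comment> \<open>The entry next to \<open>y\<close> after \<open>z\<close> has been inserted from
    the left: \<open>z\<close> itself, unless \<open>z = y\<close>; then \<open>y\<close> stays and
    so does its successor \<open>z'\<close>.\<close>
  define m where "m = (if z = y then z' else z)"
  have m: "y < m" "m \<le> z'" "z \<le> m" using assms(3) zz' by (auto simp: m_def)
  have ym: "z = y \<Longrightarrow> z' = y + 1 \<and> m = z' \<and> zz = y + 1" "z \<noteq> y \<Longrightarrow> m = z \<and> zz = z"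
    using assms(5) zz by (auto simp: m_def)
  have zZ: "z \<in> set (G @ y # m # Q)" for Q using ym by (cases "z = y") auto
  have bm: "bump (G @ y # z' # Q) z = (G @ y # m # Q, [z'])" for Q
    using G zz' assms(3) ym by (cases "z = y") (simp_all add: bump_append)
  have bmq: "bump (G @ y # q # Q) zz = (G @ y # m # Q, [q])" if "z' < q" for q Q
    using zzG zz' assms(3) ym that by (cases "z = y") (simp_all add: bump_append)
  have by': "bump (G @ q # Q) y = (G @ y # Q, [q])" if "z' \<le> q" for q Q
    using that Gy assms(3) zz' by (simp add: bump_append)
  show ?thesis
  proof (cases "even z'")
    case ev: True
    then have p: "promote (z' # M) = z' # promote M" by simp
    show ?thesis
    proof (cases "promote M")
      case Nil
      have "bump (G @ y # promote M) z' = (G @ [y, z'], [])"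
        using G zz' assms(3) Nil by (simp add: bump_append)
      from ck_bump_left2[OF assms(1) r this bm]
      have 1: "[z, z'] @ rev (G @ y # promote M) \<approx> rev (G @ [y, m]) @ [z']" by simp
      have "bump (G @ promote (z' # M)) y = (G @ [y], [z'])"
        unfolding p Nil by (rule by') simp
      moreover have "bump (G @ [y]) zz = (G @ [y, m], [])"
        using zzG zz' assms(3) ym by (cases "z = y") (simp_all add: bump_append)
      ultimately have "[zz, y] @ rev (G @ promote (z' # M)) \<approx> rev (G @ [y, m]) @ [z']"
        using ck_bump_left2[OF assms(2) r'] by fastforce
      with 1 show ?thesis unfolding tail_related_def using ck_trans ck_sym by blast
    next
      case (Cons q Q)
      then have q: "z' < q" using Mz by simp
      have "bump (G @ y # promote M) z' = (G @ y # z' # Q, [q])"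
        using G zz' assms(3) Cons q by (simp add: bump_append)
      from ck_bump_left2[OF assms(1) r this bm]
      have 1: "[z, z'] @ rev (G @ y # promote M) \<approx> rev (G @ y # m # Q) @ [z', q]" by simp
      have "bump (G @ promote (z' # M)) y = (G @ y # q # Q, [z'])"
        unfolding p Cons by (rule by') simp
      from ck_bump_left2[OF assms(2) r' this bmq[OF q]]
      have 2: "[zz, y] @ rev (G @ promote (z' # M)) \<approx> rev (G @ y # m # Q) @ [q, z']" by simp
      have "inc (G @ y # q # Q)" using assms(1) Cons zz' q assms(3)
        by (auto simp: sorted_wrt_append)
      then have "inc (G @ y # m # Q)"
        using m q Gy by (auto simp: sorted_wrt_append)
      then show ?thesis
        by (rule tail_relatedI[OF _ zZ zz' q 1 2]) simp
    qed
  next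
    case odd: False
    then obtain N where M: "M = (z' + 1) # N" using assms(6) by (cases M) auto
    then have p: "promote M = (z' + 1) # promote N" "promote (z' # M) = (z' + 1) # (z' + 2) # promote N"
      using odd by simp_all
    have "bump (G @ y # promote M) z' = (G @ y # z' # promote N, [z' + 1])"
      using G zz' assms(3) p(1) by (simp add: bump_append)
    from ck_bump_left2[OF assms(1) r this bm]
    have 1: "[z, z'] @ rev (G @ y # promote M) \<approx> rev (G @ y # m # promote N) @ [z', z' + 1]" by simp
    have "bump (G @ promote (z' # M)) y = (G @ y # (z' + 2) # promote N, [z' + 1])"
      unfolding p(2) by (rule by') simp
    from ck_bump_left2[OF assms(2) r' this bmq]
    have 2: "[zz, y] @ rev (G @ promote (z' # M)) \<approx> rev (G @ y # m # promote N) @ [z' + 2, z' + 1]"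
      by simp
    have "inc (G @ y # m # promote N)"
      using assms(1) p(1) m Gy by (auto simp: sorted_wrt_append)
    then show ?thesis
      by (rule tail_relatedI[OF _ zZ zz' _ 1 2]) (use odd in simp_all)
  qed
qed

text \<open>The exceptional configuration: an odd letter \<open>y - 1\<close> sits at the beginning of the tail
  and an entry \<open>y\<close> in the second row below it.\<close>

definition tail_special :: "int \<Rightarrow> int list \<Rightarrow> int list \<Rightarrow> bool" where
  "tail_special y W W' \<longleftrightarrow> (\<exists>Z. inc Z \<and> (\<forall>z\<in>set Z. y + 1 < z) \<and>
     W \<approx> rev (y # Z) @ [y + 1, y + 2] \<and> W' \<approx> rev ((y + 1) # Z) @ [y + 3, y + 2])"

text \<open>By \<open>u < y\<close> the insertions of \<open>x\<close> and \<open>y\<close> commute,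
  so the rows agree and the emitted letters only change order. Their left insertions into the popped
  run commute for the same reason, since \<open>u\<close> bumps out some
  \<open>b \<le> y < v\<close>.\<close>

lemma tail_independent:
  assumes "inc S" "x < y" "even x" "even y"
    and S1: "bump S x = (S1, [u])" and "u < y"
    and T: "bumps S [x, y] = (T, out)" "bumps S [y, x] = (T', out')"
    and "paired T" and r: "ck_reduced (out @ rev (tl (promote T)))"
    "ck_reduced (out' @ rev (tl (promote T')))"
  shows "T' = T" "out \<noteq> []"
    "tail_related (hd out) (out @ rev (tl (promote T))) (out' @ rev (tl (promote T')))"
proof -
  obtain oy where 1: "bump S1 y = (T, oy)" "out = u # oy"
    using T S1 by (metis append_Cons append_Nil append_Nil2 bumps.simps fst_conv prod.exhaust_sel snd_conv)
  note c = bump_commute[OF assms(1,2) S1 assms(6)]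
  have 2: "T' = T" "out' = oy @ [u]"
    using c T(2) 1 by auto
  show "T' = T" "out \<noteq> []" using 1 2 by auto
  have iS1: "inc S1" and iT: "inc T" using inc_bump[of S x] inc_bump[of S1 y] assms(1) S1 1 by auto
  have xT: "x \<in> set T" "y \<in> set T"
    using bump_mem[of x S] bump_keep[of x S1 y] bump_mem[of y S1] S1 1 iS1 assms(2) by auto
  define X where "X = tl (promote T)"
  have iP: "inc (promote T)" using inc_promote iT assms by blast
  have xP: "x \<in> set (promote T)" "y \<in> set (promote T)"
    using xT assms promote_mem by auto
  then obtain c where P: "promote T = c # X" by (cases "promote T") (auto simp: X_def)
  have iX: "inc X" using iP P by simp
  \<comment> \<open>The letter that remains is at most \<open>x\<close>, so \<open>y\<close> is
    among the popped letters and bounds what \<open>u\<close> bumps out of them.\<close>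
  have "c \<le> x" using xP iP P by auto
  then have yX: "y \<in> set X" using xP P assms(2) by auto
  obtain b where b: "snd (bump X u) = [b]" "b \<le> y" "u < b"
    using bump_out_le[OF iX yX assms(6)] by blast
  show "tail_related (hd out) (out @ rev (tl (promote T))) (out' @ rev (tl (promote T')))"
  proof (cases "oy = []")
    case True
    then show ?thesis using 1 2 by (simp add: tail_related_def)
  next
    case False
    then obtain v where v: "oy = [v]" using bump_out_cases[of S1 y] 1 by auto
    then have yv: "y < v" using bump_out_gt[of S1 y T v] 1 iS1 by simp
    obtain X1 where X1: "bump X u = (X1, [b])" using b by (metis prod.exhaust_sel)
    obtain X2 ov where X2: "bump X1 v = (X2, ov)" by fastforce
    have "u < v" "b < v" using b yv assms(6) by auto
    note cX = bump_commute[OF iX \<open>u < v\<close> X1 \<open>b < v\<close>]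
    obtain X1' where X1': "bump X v = (X1', ov)" "bump X1' u = (X2, [b])"
      using cX X2 by (metis fst_conv prod.exhaust_sel snd_conv)
    have W: "[u, v] @ rev X \<approx> rev X2 @ [b] @ ov"
      using ck_bump_left2[OF iX _ X1'] r(1) 1 2 v P by simp
    have W': "[v, u] @ rev X \<approx> rev X2 @ ov @ [b]"
      using ck_bump_left2[OF iX _ X1 X2] r(2) 1 2 v P by simp
    have iX1: "inc X1" "inc X2" using inc_bump[of X u] inc_bump[of X1 v] iX X1 X2 by auto
    have uX2: "u \<in> set X2"
      using bump_mem[of u X] bump_keep[of u X1 v] X1 X2 iX1 \<open>u < v\<close> by auto
    show ?thesis
    proof (cases "ov = []")
      case True
      then have "[u, v] @ rev X \<approx> rev X2 @ [b]" "[v, u] @ rev X \<approx> rev X2 @ [b]"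
        using W W' by auto
      then have "[u, v] @ rev X \<approx> [v, u] @ rev X" using ck_trans ck_sym by blast
      then show ?thesis using 1 2 v P by (simp add: tail_related_def)
    next
      case False
      then obtain b' where b': "ov = [b']" using bump_out_cases[of X1 v] X2 by auto
      then have "v < b'" using bump_out_gt[of X1 v X2 b'] X2 iX1 by simp
      then have "b < b'" using b yv by simp
      have "tail_related u ([u, v] @ rev X) ([v, u] @ rev X)"
        by (rule tail_relatedI[OF iX1(2) uX2 b(3) \<open>b < b'\<close>]) (use W W' b' in auto)
      then show ?thesis using 1 2 v P by simp
    qed
  qed
qed

text \<open>If something precedes \<open>y\<close> in the promoted tail, then \<open>y\<close> is
  popped and can serve as the bounding letter of \<open>tail_related\<close>. If \<open>y\<close> is
  the letter that remains, it is missing from the run and the results differ in three letters. The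
  alternatives for \<open>Q\<close> and \<open>Q'\<close> are the rows in which \<open>y - 1\<close>
  bumps out \<open>y\<close> and in which \<open>y - 1\<close> was already present.\<close>

lemma tail_exceptional:
  assumes out: "out = [y, y + 1]" "out' = [y + 2, y + 1]" and "even y"
    and P: "P \<noteq> [] \<Longrightarrow> \<forall>p\<in>set (tl P). p < y"
    and X: "X = tl (P @ [y, y + 1] @ Q)" "X' = tl (P @ [y] @ Q')" and "inc X" "inc X'"
    and Q: "Q = (y + 2) # R \<and> Q' = (y + 2) # (y + 3) # R \<and> Z = (y + 2) # R \<or>
        Q = (y + 2) # (y + 3) # R \<and> Q' = (y + 1) # (y + 2) # (y + 3) # R \<and> Z = (y + 2) # (y + 3) # R"
    and r: "ck_reduced (out @ rev X)" "ck_reduced (out' @ rev X')"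
  shows "P \<noteq> [] \<and> tail_related y (out @ rev X) (out' @ rev X') \<or>
    P = [] \<and> tail_special y (out @ rev X) (out' @ rev X')"
proof (cases P)
  case Nil
  have iZ: "inc (y # Z)" "inc Z" "\<forall>z\<in>set Z. y + 1 < z"
    using assms(7) X Q Nil by auto
  have "bump X (y + 1) = (X, [y + 2])" "bump X y = (y # Z, [y + 1])"
    using X Q Nil by auto
  from ck_bump_left2[OF assms(7) _ this] have 1: "out @ rev X \<approx> rev (y # Z) @ [y + 1, y + 2]"
    using r(1) out by simp
  have "\<exists>X1. bump X' (y + 1) = (X1, [y + 2]) \<and> bump X1 (y + 2) = ((y + 1) # Z, [y + 3])"
    using X Q Nil by auto
  then obtain X1 where "bump X' (y + 1) = (X1, [y + 2])" "bump X1 (y + 2) = ((y + 1) # Z, [y + 3])"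
    by blast
  from ck_bump_left2[OF assms(8) _ this] have "out' @ rev X' \<approx> rev ((y + 1) # Z) @ [y + 3, y + 2]"
    using r(2) out by simp
  then show ?thesis using Nil 1 iZ unfolding tail_special_def by blast
next
  case (Cons p P')
  have P': "\<forall>p\<in>set P'. p < y" "\<forall>p\<in>set P'. p < y + 1" "\<forall>p\<in>set P'. p < y + 2"
    using P Cons by auto
  have X0: "X = P' @ y # (y + 1) # Z" using X Q Cons by auto
  have "bump X (y + 1) = (X, [y + 2])" "bump X y = (X, [y + 1])"
    using X0 Q P' by (auto simp: bump_append)
  from ck_bump_left2[OF assms(7) _ this] have 1: "out @ rev X \<approx> rev X @ [y + 1, y + 2]"
    using r(1) out by simp
  have "\<exists>X1. bump X' (y + 1) = (X1, [y + 2]) \<and> bump X1 (y + 2) = (X, [y + 3])"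
    using X X0 Q P' Cons by (auto simp: bump_append)
  then obtain X1 where "bump X' (y + 1) = (X1, [y + 2])" "bump X1 (y + 2) = (X, [y + 3])"
    by blast
  from ck_bump_left2[OF assms(8) _ this] have "out' @ rev X' \<approx> rev X @ [y + 3, y + 2]"
    using r(2) out by simp
  then have "tail_related y (out @ rev X) (out' @ rev X')"
    using 1 assms(3,7) X0 by (intro tail_relatedI[of X y "y + 1" "y + 2"]) auto
  then show ?thesis using Cons by simp
qed

text \<open>The place where \<open>x\<close> acts decides. At the end of the row, at most one of the
  two orders emits anything. If \<open>x\<close> is even and bumps out a letter below
  \<open>y\<close>, the insertions are independent. If it bumps out a larger entry, both letters act
  on adjacent entries. For \<open>x = y - 1\<close>, a row containing \<open>x\<close> or
  \<open>y\<close> leads to the exceptional configuration.\<close>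

lemma tail_core:
  assumes S: "inc S" and xy: "x < y" "even y" "even x \<or> x = y - 1"
    and T: "bumps S [x, y] = (T, out)" "bumps S (swap_end x y) = (T', out')"
    and red: "ck_reduced (S @ [x, y])" "ck_reduced (S @ swap_end x y)"
    and pair: "paired T" "paired T'"
    and r: "ck_reduced (out @ rev (tl (promote T)))" "ck_reduced (out' @ rev (tl (promote T')))"
  shows "hd (promote T) = hd (promote T') \<and> (even x \<longrightarrow> hd T = hd T') \<and>
    (out @ rev (tl (promote T)) \<approx> out' @ rev (tl (promote T')) \<or>
     out \<noteq> [] \<and> tail_related (hd out) (out @ rev (tl (promote T))) (out' @ rev (tl (promote T'))) \<or>
     out \<noteq> [] \<and> odd x \<and> hd (promote T) = y \<and> hd T = x \<and> hd out = y \<and>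
       tail_special y (out @ rev (tl (promote T))) (out' @ rev (tl (promote T'))))"
proof (cases "even x")
  case ex: True
  then have swap_end: "swap_end x y = [y, x]" by (simp add: swap_end_def)
  have xy2: "x + 2 \<le> y" using xy ex by presburger
  note T' = T(2)[unfolded swap_end]
  note red' = red(2)[unfolded swap_end]
  have indep: ?thesis if "bump S x = (S1, [u])" "u < y" for S1 u
    using tail_independent[OF S xy(1) ex xy(2) that T(1) T' pair(1) r] by auto
  from S show ?thesis
  proof (cases rule: bump_cases[where u = x])
    case (eq L M)
    show ?thesis by (rule indep[OF eq(3)]) (use xy2 in simp)
  next
    case snoc
    then have "\<forall>s\<in>set S. s < y" using xy by auto
    then have TT: "T = S @ [x, y]" "out = []" "T' = S @ [x]" "out' = [y]"
      using snoc T(1) T' xy bump_append[of S y "[]"] by (auto simp: bump_append)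
    then have "paired (S @ [x])" using pair by simp
    then have "promote T = promote (S @ [x]) @ [y]" "promote (S @ [x]) \<noteq> []"
      using TT promote_append[of "S @ [x]" "[y]"] xy by auto
    then show ?thesis using TT by (auto simp: hd_append)
  next
    case (less L z M)
    show ?thesis
    proof (cases "z < y")
      case True
      then show ?thesis using indep less by blast
    next
      case zy: False
      define zz where "zz = (if z = y then y + 1 else z)"
      have incM: "inc (z # M)" using S less by (simp add: sorted_wrt_append)
      have Lx: "\<forall>s\<in>set L. s < x" "\<forall>s\<in>set L. s < y" using less xy by auto
      \<comment> \<open>Whether \<open>z\<close> is replaced or equals \<open>y\<close>, the entry
        there is \<open>y\<close> afterwards; only the emitted letter \<open>zz\<close>
        distinguishes the cases.\<close>
      have "bump S y = (L @ (if z = y then y else y) # M, [zz])"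
        using less Lx zy by (auto simp: bump_append zz_def)
      then have T'2: "T' = L @ x # M" "out' = [zz, y]"
        using T' Lx xy by (auto simp: bump_append)
      have zy1: "y + 1 \<in> set M" if "z = y"
        using bump_mem_next[of S y] S red' ck_reduced_prefix[of "S @ [y]" "[x]"] less that Lx by auto
      have pLx: "paired (L @ [x])" "paired M"
        using paired_split_even[of L x M] pair T'2 ex by auto
      define G where "G = tl (promote (L @ [x]))"
      obtain c where c: "promote (L @ [x]) = c # G"
        by (cases "promote (L @ [x])") (auto simp: G_def)
      have pT': "promote T' = c # G @ promote M"
        using T'2 promote_append[OF pLx(1), of M] c by simp
      show ?thesis
      proof (cases M)
        case Nil
        then have "z \<noteq> y" using zy1 by auto
        then have zz: "zz = z" by (simp add: zz_def)
        have "T = L @ [x, y]" "out = [z]"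
          using T(1) less Nil Lx xy by (auto simp: bump_append)
        moreover from this have "promote T = c # G @ [y]"
          using promote_append[OF pLx(1), of "[y]"] c xy by simp
        ultimately show ?thesis using pT' T'2 Nil zz by (auto simp: hd_append)
      next
        case (Cons z' N)
        have z': "z < z'" "y < z'" using incM Cons zy by auto
        have T2: "T = L @ x # y # N" "out = [z, z']"
          using T(1) less Cons Lx xy z' by (auto simp: bump_append)
        have "paired N" using paired_split_even[of "L @ [x]" y N] pair T2 xy by simp
        have pT: "promote T = c # G @ y # promote N"
          using T2 promote_append[OF pLx(1), of "y # N"] c xy by simp
        have iT: "inc T" "inc T'" using inc_bumps[OF S] T by (metis fst_conv)+
        have "inc (promote T)" "inc (promote T')" using iT pair inc_promote by auto
        then have "tail_related z ([z, z'] @ rev (G @ y # promote N))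
            ([zz, y] @ rev (G @ promote (z' # N)))"
          using pT pT' Cons zy incM z' zy1 pLx \<open>paired N\<close> r T2 T'2
          by (intro tail_adjacent) (auto simp: zz_def)
        then show ?thesis using pT pT' Cons T2 T'2 by (auto simp: hd_append)
      qed
    qed
  qed
next
  case ox: False
  then have x: "x = y - 1" using xy by simp
  have swap_end: "swap_end x y = [y + 1, y]" using ox by (simp add: swap_end_def)
  note T' = T(2)[unfolded swap_end]
  note red' = red(2)[unfolded swap_end]
  have ry1: "ck_reduced (S @ [y + 1])" using red' ck_reduced_prefix[of "S @ [y + 1]" "[y]"] by simp
  have rx1: "ck_reduced (S @ [x])" using red ck_reduced_prefix[of "S @ [x]" "[y]"] by simp
  have iT: "inc T" "inc T'" using inc_bumps[OF S] T by (metis fst_conv)+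
  have iP: "inc (promote T)" "inc (promote T')" using iT pair inc_promote by auto
  then have iX: "inc (tl (promote T))" "inc (tl (promote T'))"
    by (cases "promote T"; cases "promote T'"; simp)+
  from S show ?thesis
  proof (cases rule: bump_cases[where u = x])
    case snoc
    have Sy: "\<forall>s\<in>set S. s < y" "\<forall>s\<in>set S. s < y + 1" using snoc x by auto
    have TT: "T = S @ [x, y]" "out = []" "T' = S @ [y]" "out' = [y + 1]"
      using snoc Sy T(1) T' x bump_append[of S y "[]"] bump_append[of S "y + 1" "[]"]
      by (auto simp: bump_append)
    then have "paired S" using paired_split_odd[of S x "[y]"] pair ox by simp
    then have "promote T = promote S @ [y, y + 1]" "promote T' = promote S @ [y]"
      using TT promote_append[of S "[x, y]"] promote_append[of S "[y]"] xy x ox by auto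
    then show ?thesis using TT ox by (cases "promote S") (auto simp: add.commute)
  next
    case (eq L M)
    obtain M1 where M1: "M = y # M1" using bump_eq_next[of L x M] eq S rx1 x by auto
    have Ly: "\<forall>s\<in>set L. s < y" "\<forall>s\<in>set L. s < y + 1" using eq x by auto
    \<comment> \<open>Emitting \<open>y\<close> to the left shows that \<open>S @ [y]\<close> is
      reduced too. Each of \<open>x\<close>, \<open>y\<close>, \<open>y + 1\<close> then forces its
      successor, so the row contains \<open>x, y, y + 1, y + 2\<close> in a run.\<close>
    have "S @ [x] \<approx> [y] @ S" using ck_bump[OF S rx1] eq x by simp
    then have "S @ [x, y] \<approx> y # S @ [y]" using ck_append2[of "S @ [x]" "[y] @ S" "[y]"] by simp
    then have "ck_reduced (S @ [y])" using red ck_reduced_ck ck_reduced_Cons by blast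
    then obtain M2 where M2: "M1 = (y + 1) # M2"
      using bump_eq_next[of "L @ [x]" y M1] eq S M1 by auto
    obtain R where R: "M2 = (y + 2) # R"
      using bump_eq_next[of "L @ [x, y]" "y + 1" M2] eq S M1 M2 ry1 by (auto simp: add.commute)
    have TT: "T = S" "out = [y, y + 1]" "T' = S" "out' = [y + 2, y + 1]"
      using T(1) T' eq M1 M2 Ly x by (auto simp: bump_append)
    have pL: "paired L" "paired (x # M)" using paired_split_odd[of L x M] pair TT eq ox by auto
    have pT: "promote T = promote L @ [y, y + 1] @ (y + 2) # (y + 3) # promote R"
      using TT eq M1 M2 R promote_append[OF pL(1), of "x # M"] ox x xy by simp
    have "\<forall>p\<in>set (promote L). p < y" using iP pT by (simp add: sorted_wrt_append)
    then have "\<forall>p\<in>set (tl (promote L)). p < y" by (cases "promote L") auto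
    then have "promote L \<noteq> [] \<and> tail_related y (out @ rev (tl (promote T))) (out' @ rev (tl (promote T'))) \<or>
        promote L = [] \<and> tail_special y (out @ rev (tl (promote T))) (out' @ rev (tl (promote T')))"
      using TT pT xy iX r
      by (intro tail_exceptional[where P = "promote L" and Q = "(y + 2) # (y + 3) # promote R"
            and R = "promote R" and Z = "(y + 2) # (y + 3) # promote R"
            and Q' = "(y + 1) # (y + 2) # (y + 3) # promote R"])
        auto
    then show ?thesis using TT pT eq ox x by auto
  next
    case (less L m M)
    have Ly: "\<forall>s\<in>set L. s < x" "\<forall>s\<in>set L. s < y" "\<forall>s\<in>set L. s < y + 1" using less x by auto
    have incM: "inc (m # M)" using S less by (simp add: sorted_wrt_append)
    show ?thesis
    proof (cases "m = y")
      case my: True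
      show ?thesis
      proof (cases M)
        case Nil
        \<comment> \<open>Impossible, because the odd letter \<open>y + 1\<close> would have no
          partner.\<close>
        then have "T' = L @ [y, y + 1]" using T' less my Ly by (auto simp: bump_append)
        then have False using paired_split_even[of L y "[y + 1]"] pair xy by simp
        then show ?thesis ..
      next
        case (Cons z N)
        have z: "y < z" "inc (z # N)" using incM Cons my by auto
        have T2: "T = L @ x # y # N" "out = [y, z]"
          using T(1) less my Cons Ly xy z by (auto simp: bump_append)
        show ?thesis
        proof (cases "z = y + 1")
          case True
          obtain R where R: "N = (y + 2) # R"
            using bump_eq_next[of "L @ [y]" "y + 1" N] S less my Cons True ry1 by (auto simp: add.commute)
          have T'2: "T' = L @ y # z # N" "out' = [y + 2, y + 1]"
            using T' less my Cons Ly True by (auto simp: bump_append)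
          have pL: "paired L" using paired_split_odd[of L x "y # N"] pair T2 ox by auto
          have pT: "promote T = promote L @ [y, y + 1] @ (y + 2) # promote R"
            using T2 R promote_append[OF pL(1), of "x # y # N"] ox x xy by simp
          have pT': "promote T' = promote L @ [y] @ (y + 2) # (y + 3) # promote R"
            using T'2 R True promote_append[OF pL(1), of "y # z # N"] ox x xy by simp
          have "\<forall>p\<in>set (promote L). p < y" using iP pT by (simp add: sorted_wrt_append)
          then have "\<forall>p\<in>set (tl (promote L)). p < y" by (cases "promote L") auto
          then have "promote L \<noteq> [] \<and> tail_related y (out @ rev (tl (promote T))) (out' @ rev (tl (promote T'))) \<or>
              promote L = [] \<and> tail_special y (out @ rev (tl (promote T))) (out' @ rev (tl (promote T')))"
            using T2 T'2 pT pT' xy iX r True iP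
            by (intro tail_exceptional[where P = "promote L" and Q = "(y + 2) # promote R"
                  and R = "promote R" and Z = "(y + 2) # promote R"
                  and Q' = "(y + 2) # (y + 3) # promote R"])
              auto
          moreover have "hd (promote T) = hd (promote T')"
            using pT pT' by (auto simp: hd_append)
          moreover have "promote L = [] \<Longrightarrow> hd T = x \<and> hd (promote T) = y" using T2 pT by simp
          ultimately show ?thesis using ox T2 by auto
        next
          case False
          then have "y + 1 < z" using z by simp
          \<comment> \<open>The odd letter \<open>y + 1\<close> would need the partner
            \<open>y + 2\<close>, but all entries of \<open>N\<close> exceed
            \<open>z \<ge> y + 2\<close>.\<close>
          then have "T' = L @ y # (y + 1) # N"
            using T' less my Cons Ly by (auto simp: bump_append)
          then have "paired ((y + 1) # N)"
            using paired_split_even[of L y "(y + 1) # N"] pair xy by simp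
          then have "hd N = y + 2" "N \<noteq> []" using xy by auto
          then have False using z \<open>y + 1 < z\<close> by (cases N) auto
          then show ?thesis ..
        qed
      qed
    next
      case False
      then have my: "y + 1 \<le> m" using less x by simp
      define zz where "zz = (if m = y + 1 then y + 1 + 1 else m)"
      have my1: "y + 2 \<in> set M" if "m = y + 1"
        using bump_mem_next[OF S ry1] less that Ly by (auto simp: add.commute)
      have T'2: "T' = L @ y # M" "out' = [zz, y + 1]"
        using T' less Ly my by (auto simp: bump_append zz_def)
      have pLy: "paired (L @ [y])" "paired M"
        using paired_split_even[of L y M] pair T'2 xy by auto
      have incLx: "T = L @ x # fst (bump M y)" "out = m # snd (bump M y)"
        using T(1) less Ly xy by (auto simp: bump_append)
      have pL: "paired L"
        using paired_split_odd[of L x "fst (bump M y)"] pair incLx ox by auto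
      define G where "G = tl (promote L @ [y])"
      obtain c where c: "promote L @ [y] = c # G" by (cases "promote L @ [y]") (auto simp: G_def)
      have pT': "promote T' = c # G @ promote M"
        using T'2 promote_append[OF pL, of "y # M"] c xy by (metis append_Cons append_Nil append_assoc
            promote.simps(2))
      have hdc: "hd (promote L @ y # A) = c" "tl (promote L @ y # A) = G @ A" for A
        using c by (cases "promote L"; force)+
      show ?thesis
      proof (cases M)
        case Nil
        then have "m \<noteq> y + 1" using my1 by auto
        then have zz: "zz = m" by (simp add: zz_def)
        have T2: "T = L @ [x, y]" "out = [m]" using incLx Nil by auto
        then have "promote T = promote L @ [y, y + 1]"
          using promote_append[OF pL, of "[x, y]"] xy ox x by simp
        then show ?thesis using hdc T2 pT' T'2 Nil zz ox by simp
      next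
        case (Cons z N)
        have z: "m < z" "y < z" using incM Cons my by auto
        have T2: "T = L @ x # y # N" "out = [m, z]" using incLx Cons z by auto
        have pN: "paired N" using paired_split_even[of "L @ [x]" y N] pair T2 xy by simp
        have pT: "promote T = promote L @ y # (y + 1) # promote N"
          using T2 promote_append[OF pL, of "x # y # N"] xy ox x by simp
        have "inc (c # G @ (y + 1) # promote N)" using iP pT c
          by (metis append_Cons append_Nil append_assoc)
        then have "tail_related m ([m, z] @ rev (G @ (y + 1) # promote N))
            ([zz, y + 1] @ rev (G @ promote (z # N)))"
          using pT pT' Cons my incM z my1 pLy pN r T2 T'2 hdc iP
          by (intro tail_adjacent) (auto simp: zz_def)
        then show ?thesis using pT pT' Cons T2 T'2 hdc ox by auto
      qed
    qed
  qed
qed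

section \<open>Entrywise comparison of increasing lists\<close>

fun over :: "int list \<Rightarrow> int list \<Rightarrow> bool" where
  "over (a # A) (f # F) = (a < f \<and> over A F)"
| "over _ _ = True"

fun weakly_over :: "int list \<Rightarrow> int list \<Rightarrow> bool" where
  "weakly_over (a # A) (f # F) = (a \<le> f \<and> weakly_over A F)"
| "weakly_over _ _ = True"

text \<open>The relation between consecutive rows of a tableau of unshifted shape.\<close>

fun covers :: "int list \<Rightarrow> int list \<Rightarrow> bool" where
  "covers A [] = True"
| "covers [] (f # F) = False"
| "covers (a # A) (f # F) = (a < f \<and> covers A F)"

lemma over_single [simp]: "over A [x] \<longleftrightarrow> A = [] \<or> hd A < x"
  by (cases A) auto

lemma weakly_over_single [simp]: "weakly_over A [x] \<longleftrightarrow> A = [] \<or> hd A \<le> x"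
  by (cases A) auto

lemma over_subset:
  "over B S \<Longrightarrow> inc S \<Longrightarrow> inc D \<Longrightarrow> set D \<subseteq> set S \<Longrightarrow> over B D"
proof (induction B S arbitrary: D rule: over.induct)
  case (1 b B s S)
  show ?case
  proof (cases D)
    case (Cons d D')
    then have "set D' \<subseteq> set S" using 1 by fastforce
    then show ?thesis using 1 Cons by fastforce
  qed simp
qed auto

lemma over_take: "over B (take n F) \<longleftrightarrow> over B F" if "length B \<le> n"
  using that by (induction B F arbitrary: n rule: over.induct) (auto simp: take_Cons split: nat.split)

lemma weakly_over_take: "weakly_over B (take n F) \<longleftrightarrow> weakly_over B F" if "length B \<le> n"
  using that
  by (induction B F arbitrary: n rule: weakly_over.induct) (auto simp: take_Cons split: nat.split)

lemma over_append: "over B A \<Longrightarrow> length B \<le> length A \<Longrightarrow> over B (A @ X)"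
  by (induction B A rule: over.induct) auto

lemma over_take1: "over A F \<Longrightarrow> over (take n A) F"
  by (induction A F arbitrary: n rule: over.induct) (auto simp: take_Cons split: nat.split)

lemma over_bump: "over A F \<Longrightarrow> inc A \<Longrightarrow> \<forall>a\<in>set A. a < x \<Longrightarrow> over A (fst (bump F x))"
  by (induction A F rule: over.induct) (auto, meson hd_in_set)

lemma weakly_over_bump:
  "weakly_over A F \<Longrightarrow> inc A \<Longrightarrow> \<forall>a\<in>set A. a \<le> x \<Longrightarrow> weakly_over A (fst (bump F x))"
  by (induction A F rule: weakly_over.induct) (auto, meson hd_in_set)

lemma over_bumps: "over A F \<Longrightarrow> inc A \<Longrightarrow> \<forall>x\<in>set w. \<forall>a\<in>set A. a < x \<Longrightarrow> over A (fst (bumps F w))"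
  by (induction w arbitrary: F) (auto simp: over_bump)

lemma weakly_over_bumps:
  "weakly_over A F \<Longrightarrow> inc A \<Longrightarrow> \<forall>x\<in>set w. \<forall>a\<in>set A. a \<le> x \<Longrightarrow> weakly_over A (fst (bumps F w))"
  by (induction w arbitrary: F) (auto simp: weakly_over_bump)

lemma covers_over: "covers A F \<Longrightarrow> over A F"
  by (induction A F rule: covers.induct) auto

lemma covers_length: "covers A F \<Longrightarrow> length F \<le> length A"
  by (induction A F rule: covers.induct) auto

lemma covers_bump1: "covers S F \<Longrightarrow> covers (fst (bump S x)) F"
  by (induction S F rule: covers.induct) auto

lemma covers_bump:
  "inc S \<Longrightarrow> covers S F \<Longrightarrow> covers (fst (bump S x)) (fst (bumps F (snd (bump S x))))"
proof (induction S F rule: covers.induct)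
  case (1 S)
  show ?case
  proof (cases "snd (bump S x) = []")
    case False
    then obtain b where b: "snd (bump S x) = [b]" using bump_out_cases by blast
    then obtain s S' where S: "fst (bump S x) = s # S'"
      by (cases "fst (bump S x)") (use bump_not_Nil in auto)
    have "s \<le> x" using bump_mem[of x S] inc_bump[of S x] 1 S by auto
    moreover have "x < b" using bump_out_gt[of S x "fst (bump S x)" b] b 1 by (simp add: prod_eq_iff)
    ultimately show ?thesis using S b by simp
  qed simp
next
  case (3 s S f F)
  have sub: "covers (fst (bump S x)) F" using covers_bump1 3 by simp
  have gt: "x < b" if "snd (bump S x) = [b]" for b
    using bump_out_gt[of S x "fst (bump S x)" b] that 3 by (simp add: prod_eq_iff)
  have cas: "snd (bump S x) = [] \<or> (\<exists>b. snd (bump S x) = [b])" by (rule bump_out_cases)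
  consider "x < s" | "x = s" | "s < x" by linarith
  then show ?case
  proof cases
    case 3
    then have "covers (fst (bump S x)) (fst (bumps F (snd (bump S x))))"
      using "3.prems" "3.IH" by simp
    then show ?thesis using cas gt sub "3.prems" 3 by (elim disjE exE) auto
  qed (use 3 in auto)
qed simp

lemma covers_frow_emit: "covers (frow w) (frow (emit w))"
proof (induction w rule: rev_induct)
  case (snoc x w)
  then show ?case
    using covers_bump[of "frow w" "frow (emit w)" x] by (simp add: frow_append emit_append)
qed simp

lemma take_less:
  "inc A \<Longrightarrow> inc S \<Longrightarrow> set A \<subseteq> set S \<Longrightarrow> \<forall>a\<in>set A. a < r \<Longrightarrow> \<forall>s\<in>set (take (length A) S). s < r"
proof (induction A arbitrary: S)
  case (Cons a A)
  show ?case
  proof (cases S)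
    case S: (Cons s S')
    then have "set A \<subseteq> set S'" using Cons.prems by fastforce
    then show ?thesis using Cons S by fastforce
  qed simp
qed simp

lemma inc_subset_length: "inc A \<Longrightarrow> set A \<subseteq> set S \<Longrightarrow> length A \<le> length S"
  by (metis card_length card_mono distinct_card dual_order.trans finite_set strict_sorted_iff)

lemma take_bumps_large:
  assumes "inc A" "inc S" "set A \<subseteq> set S" "\<forall>r\<in>set R. \<forall>a\<in>set A. a < r"
  shows "take (length A) (fst (bumps S R)) = take (length A) S"
proof -
  have "\<forall>s\<in>set (take (length A) S). \<forall>r\<in>set R. s < r"
    using take_less[OF assms(1-3)] assms(4) by blast
  from bumps_prefix[OF this, of "drop (length A) S"] show ?thesis
    using inc_subset_length[OF assms(1,3)] by simp
qed

lemma bumps_subset_keep: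
  "inc S \<Longrightarrow> set A \<subseteq> set S \<Longrightarrow> \<forall>r\<in>set R. \<forall>a\<in>set A. a \<le> r \<Longrightarrow> set A \<subseteq> set (fst (bumps S R))"
proof (induction R arbitrary: S)
  case (Cons r R)
  have "set A \<subseteq> set (fst (bump S r))" using Cons.prems bump_keep by fastforce
  then show ?case using Cons by auto
qed simp

lemma bumps_inc_mem: "inc S \<Longrightarrow> inc D \<Longrightarrow> set D \<subseteq> set (fst (bumps S D))"
proof (induction D arbitrary: S)
  case (Cons d D)
  have "{d} \<subseteq> set (fst (bumps (fst (bump S d)) D))"
    using bumps_subset_keep[of "fst (bump S d)" "[d]" D] Cons.prems by fastforce
  then show ?case using Cons by auto
qed simp

text \<open>Each letter of \<open>A\<close> meets exactly the entry of \<open>D\<close> in its own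
  position, which is larger, and replaces it.\<close>

lemma bumps_over:
  "inc A \<Longrightarrow> over A D \<Longrightarrow> bumps D A = (A @ drop (length A) D, take (length A) D)"
proof (induction A D rule: over.induct)
  case (1 a A d D)
  then show ?case using bumps_prefix[of "[a]" A D] by simp
next
  case ("2_2" A)
  then show ?case
  proof (induction A)
    case (Cons a A)
    then show ?case using bumps_prefix[of "[a]" A "[]"] by simp
  qed simp
qed simp

lemma bumps_weakly_over:
  "inc A \<Longrightarrow> weakly_over A F \<Longrightarrow> take (length A) (fst (bumps F A)) = A"
proof (induction A F rule: weakly_over.induct)
  case (1 a A f F)
  then show ?case using bumps_prefix[of "[a]" A F] by auto
next
  case ("2_2" A)
  then show ?case using bumps_over[of A "[]"] by simp
qed simp

text \<open>The word form of \<open>bumps_over\<close>. It carries the surplus of \<open>D\<close>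
  to the right past a column \<open>A\<close>, closer to the end of the word, where parity is
  known.\<close>

lemma ck_exchange:
  "inc A \<Longrightarrow> inc D \<Longrightarrow> over A D \<Longrightarrow> length A \<le> length D \<Longrightarrow>
    D @ A \<approx> take (length A) D @ A @ drop (length A) D"
proof (induction A rule: rev_induct)
  case (snoc a A)
  define n where "n = length A"
  have n: "n < length D" using snoc.prems by (simp add: n_def)
  have a: "a < D ! n" "over A D"
  proof -
    have "over (A @ [a]) D \<Longrightarrow> length A < length D \<Longrightarrow> a < D ! length A"
      by (induction A D rule: over.induct) (auto, metis list.exhaust nth_Cons_0 over.simps(1) less_numeral_extra(3) list.size(3))
    then show "a < D ! n" using snoc.prems n by (simp add: n_def)
    show "over A D" using over_take1[of "A @ [a]" D n] snoc.prems by (simp add: n_def)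
  qed
  have D: "drop n D = D ! n # drop (Suc n) D" using n by (simp add: Cons_nth_drop_Suc)
  have iA: "inc A" "\<forall>s\<in>set A. s < a" using snoc.prems by (auto simp: sorted_wrt_append)
  have iD: "inc (D ! n # drop (Suc n) D)" using snoc.prems D by (metis sorted_wrt_drop)
  have "D @ A \<approx> take n D @ A @ drop n D"
    using snoc.IH iA snoc.prems a n by (simp add: n_def)
  then have "D @ A @ [a] \<approx> take n D @ A @ D ! n # drop (Suc n) D @ [a]"
    using ck_append2[OF \<open>D @ A \<approx> take n D @ A @ drop n D\<close>, of "[a]"] D by simp
  also have "\<dots> \<approx> take n D @ D ! n # A @ a # drop (Suc n) D"
  proof -
    have "\<forall>s\<in>set A. \<forall>t\<in>set (drop (Suc n) D). s < t" using iA iD a by fastforce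
    then show ?thesis
      using iA iD a by (intro ck_append1 ck_bump_less) (auto simp: sorted_wrt_append)
  qed
  also have "\<dots> = take (Suc n) D @ (A @ [a]) @ drop (Suc n) D"
    using n by (simp add: take_Suc_conv_app_nth)
  finally show ?case by (simp add: n_def)
qed simp

subsection \<open>Splitting off columns\<close>

text \<open>For \<open>k = 0\<close> this is an initial step. In general it is the same move behind an increasing run of
  \<open>k\<close> letters, which represents a column of height \<open>k + 1\<close> of the shifted tableau.\<close>

definition swap_step :: "nat \<Rightarrow> int list \<Rightarrow> int list \<Rightarrow> bool" where
  "swap_step k u v \<longleftrightarrow> (\<exists>p D x y. u = p @ D @ [x, y] \<and> v = p @ D @ swap_end x y \<and> length D = k \<and>
     inc (D @ [x, y]) \<and> even y \<and> (even x \<or> x = y - 1))"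

definition top_col :: "int list list \<Rightarrow> int list" where
  "top_col As = (case As of [] \<Rightarrow> [] | A # _ \<Rightarrow> A)"

lemma top_col_simps [simp]: "top_col [] = []" "top_col (A # As) = A"
  by (simp_all add: top_col_def)

text \<open>\<open>As = [A\<^sub>k, \<dots>, A\<^sub>1]\<close> are columns already split off from the right end of a word,
  the outermost one first.\<close>

fun stacked :: "int list list \<Rightarrow> bool" where
  "stacked [] = True"
| "stacked (A # As) = (stacked As \<and> length A = Suc (length As) \<and> inc A \<and> even (last A) \<and> over (top_col As) A)"

lemma length_top_col: "stacked As \<Longrightarrow> length (top_col As) = length As"
  by (cases As) auto

lemma swap_end_cases:
  assumes "x < y" "even y" "even x \<or> x = y - 1"
  obtains y' x' where "swap_end x y = [y', x']" "x \<le> x'" "x' < y'" "even x'"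
  using assms by (cases "even x") (auto simp: swap_end_def)

text \<open>A reversed symplectic class, reduced to what the argument uses. The conditions on the
  last two letters come from minimality of length, see \<open>R_Sp_even_Cons\<close> and
  \<open>R_Sp_second_letter\<close>.\<close>

locale sp_words =
  fixes K :: "int list set"
  assumes K_ck: "u \<in> K \<Longrightarrow> u \<approx> v \<Longrightarrow> v \<in> K"
    and K_swap_step: "swap_step 0 u v \<Longrightarrow> u \<in> K \<longleftrightarrow> v \<in> K"
    and K_red: "u \<in> K \<Longrightarrow> \<not> unreduced u"
    and K_even: "p @ [y] \<in> K \<Longrightarrow> even y"
    and K_adj: "p @ [x, y] \<in> K \<Longrightarrow> even x \<or> \<bar>x - y\<bar> = 1"
begin

lemma K_ck_iff: "u \<approx> v \<Longrightarrow> u \<in> K \<longleftrightarrow> v \<in> K"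
  using K_ck ck_sym by blast

lemma K_ck_reduced: "p @ u @ q \<in> K \<Longrightarrow> ck_reduced u"
  using ck_reduced_factor[of p u q] K_ck K_red unfolding ck_reduced_def by blast

lemma over_tl_append:
  assumes "stacked (A # As)" "inc (A @ X)"
  shows "over (top_col As) (tl A @ X)" "over (top_col As) (tl A)" "over (top_col As) (butlast A)"
proof -
  have 1: "over (top_col As) (A @ X)"
    using over_append[of "top_col As" A X] assms(1) length_top_col by auto
  have "set (tl A) \<subseteq> set A" "set (butlast A) \<subseteq> set A" "inc (tl A)" "inc (butlast A)" "inc (tl A @ X)"
    using assms by (cases A; auto simp: sorted_wrt_append butlast_conv_take sorted_wrt_take
        dest: in_set_takeD)+
  then show "over (top_col As) (tl A @ X)" "over (top_col As) (tl A)" "over (top_col As) (butlast A)"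
    by (auto intro!: over_subset[OF 1 assms(2)])
qed

text \<open>\<open>ck_exchange\<close> carries \<open>last D\<close> behind the column
  \<open>A\<close>, where it completes \<open>tl A\<close> to a run of the height required one level
  down. At the bottom it is the last letter of a word of \<open>K\<close>.\<close>

lemma even_last:
  "stacked As \<Longrightarrow> length D = Suc (length As) \<Longrightarrow> inc D \<Longrightarrow> over (top_col As) D \<Longrightarrow>
    p @ D @ concat As \<in> K \<Longrightarrow> even (last D)"
proof (induction As arbitrary: p D)
  case Nil
  then obtain d where "D = [d]" by (auto simp: length_Suc_conv)
  then show ?case using Nil K_even by simp
next
  case (Cons A As)
  have lA: "length A = Suc (length As)" "inc A" using Cons.prems by auto
  then obtain a A' where A: "A = a # A'" by (cases A) auto
  have dr: "drop (length A) D = [last D]"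
    using Cons.prems lA by (cases D rule: rev_cases) auto
  have "D @ A \<approx> take (length A) D @ A @ [last D]"
    using ck_exchange[of A D] Cons.prems lA dr by simp
  then have "p @ (D @ A) @ concat As \<approx> p @ (take (length A) D @ A @ [last D]) @ concat As"
    by (rule ck_context)
  then have K: "(p @ take (length A) D @ [a]) @ (A' @ [last D]) @ concat As \<in> K"
    using Cons.prems A K_ck by simp
  have "inc (A @ [last D])"
    using inc_bumps[of D A] bumps_over[of A D] Cons.prems lA dr by simp
  then have "even (last (A' @ [last D]))"
    using over_tl_append(1)[of A As "[last D]"] A Cons.prems K lA
    by (intro Cons.IH[OF _ _ _ _ K]) auto
  then show ?case by simp
qed

lemma parity:
  "stacked As \<Longrightarrow> length D = length As \<Longrightarrow> inc (D @ [x, y]) \<Longrightarrow> over (top_col As) D \<Longrightarrow>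
    p @ D @ [x, y] @ concat As \<in> K \<Longrightarrow> even y \<and> (even x \<or> x = y - 1)"
proof (induction As arbitrary: p D)
  case Nil
  then show ?case using K_even[of "p @ [x]" y] K_adj[of p x y] by auto
next
  case (Cons A As)
  have lA: "length A = Suc (length As)" "inc A" using Cons.prems by auto
  then obtain a A' where A: "A = a # A'" by (cases A) auto
  have ov: "over A (D @ [x, y])" using over_append[of A D] Cons.prems lA by simp
  then have "(D @ [x, y]) @ A \<approx> D @ A @ [x, y]"
    using ck_exchange[of A "D @ [x, y]"] Cons.prems lA by simp
  then have "p @ ((D @ [x, y]) @ A) @ concat As \<approx> p @ (D @ A @ [x, y]) @ concat As"
    by (rule ck_context)
  then have K: "(p @ D @ [a]) @ A' @ [x, y] @ concat As \<in> K"
    using Cons.prems A K_ck by simp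
  have "inc (A @ [x, y])"
    using inc_bumps[of "D @ [x, y]" A] bumps_over[of A "D @ [x, y]"] ov Cons.prems lA by simp
  then show ?case
    using over_tl_append(2)[of A As "[x, y]"] A Cons.prems K lA
    by (intro Cons.IH[OF _ _ _ _ K]) auto
qed

text \<open>A move in front of \<open>A\<close> is composed of two moves behind it:
  \<open>x y\<close> pass \<open>A\<close> and are swapped there, the larger result returns by Knuth
  moves, and the smaller one by a second swap with the last letter of \<open>A\<close>, both being
  even.\<close>

lemma swap_step_K:
  "stacked As \<Longrightarrow> length D = length As \<Longrightarrow> inc (D @ [x, y]) \<Longrightarrow> even y \<Longrightarrow> even x \<or> x = y - 1 \<Longrightarrow>
    over (top_col As) D \<Longrightarrow> p @ D @ [x, y] @ concat As \<in> K \<longleftrightarrow> p @ D @ swap_end x y @ concat As \<in> K"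
proof (induction As arbitrary: p D x y)
  case Nil
  then have "swap_step 0 (p @ [x, y]) (p @ swap_end x y)" unfolding swap_step_def by fastforce
  then show ?case using Nil K_swap_step by simp
next
  case (Cons A As)
  let ?s = "concat As"
  have lA: "length A = Suc (length As)" "inc A" using Cons.prems by auto
  then obtain a A' where A: "A = a # A'" by (cases A) auto
  obtain A0 c where A0: "A = A0 @ [c]" using lA by (cases A rule: rev_cases) auto
  have "x < y" using Cons.prems by (simp add: sorted_wrt_append)
  then obtain y' x' where swap_end: "swap_end x y = [y', x']" "x \<le> x'" "x' < y'" "even x'"
    using swap_end_cases Cons.prems by blast
  have ov: "over A (D @ [x, y])" using over_append[of A D] Cons.prems lA by simp
  have iA: "inc (A @ [x, y])"
    using inc_bumps[of "D @ [x, y]" A] bumps_over[of A "D @ [x, y]"] ov Cons.prems lA by simp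
  then have iA': "inc (A @ [x'])" using swap_end(2) by (force simp: sorted_wrt_append)
  have "(D @ [x, y]) @ A \<approx> D @ A @ [x, y]"
    using ck_exchange[of A "D @ [x, y]"] ov Cons.prems lA by simp
  then have "p @ D @ [x, y] @ A @ ?s \<in> K \<longleftrightarrow> p @ D @ A @ [x, y] @ ?s \<in> K"
    using K_ck_iff[OF ck_context] by fastforce
  also have "\<dots> \<longleftrightarrow> p @ D @ A @ swap_end x y @ ?s \<in> K"
    using Cons.IH[of A' x y "p @ D @ [a]"] over_tl_append(2)[of A As "[x, y]"] A iA Cons.prems by simp
  also have "\<dots> \<longleftrightarrow> p @ D @ y' # A @ [x'] @ ?s \<in> K"
    using K_ck_iff[OF ck_context[OF ck_move_large[OF iA' swap_end(3)], of "p @ D" ?s]] swap_end(1) by simp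
  also have "\<dots> \<longleftrightarrow> p @ D @ y' # A0 @ [x', c] @ ?s \<in> K"
    using Cons.IH[of A0 c x' "p @ D @ [y']"] over_tl_append(3)[of A As "[x, y]"] A0 iA iA' swap_end(4) Cons.prems
    by (simp add: swap_end_def)
  also have "\<dots> \<longleftrightarrow> p @ D @ [y', x'] @ A @ ?s \<in> K"
  proof -
    have "inc (A0 @ [c])" "c < x'" using A0 lA iA' by (auto simp: sorted_wrt_append)
    from K_ck_iff[OF ck_context[OF ck_move_large[OF this], of "p @ D @ [y']" ?s]]
    show ?thesis using A0 by simp
  qed
  finally show ?case using swap_end(1) by simp
qed

text \<open>The comparison with the first row says that the latest column fits against what is left
  of it; it is this clause that a single \<open>peel\<close> may violate.\<close>

definition state :: "int list list \<Rightarrow> int list \<Rightarrow> bool" where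
  "state As q \<longleftrightarrow> stacked As \<and> q @ concat As \<in> K \<and> over (top_col As) (frow q)"

lemma state_red: "state As q \<Longrightarrow> ck_reduced q"
  unfolding state_def using K_ck_reduced[of "[]" q "concat As"] by simp

lemma state_ck: "state As u \<Longrightarrow> u \<approx> v \<Longrightarrow> state As v"
  using ck_frow_emit[of u v] state_red[of As u] K_ck[OF _ ck_append2[of u v "concat As"]]
  unfolding state_def by auto

lemma frow_contains:
  assumes "inc D" "\<forall>r\<in>set R. \<forall>a\<in>set D. a < r"
  shows "set D \<subseteq> set (frow (p @ D @ R))" "take (length D) (frow (p @ D @ R)) = take (length D) (frow (p @ D))"
proof -
  have 1: "set D \<subseteq> set (frow (p @ D))" using assms bumps_inc_mem[of "frow p" D] by (simp add: frow_append)
  have 2: "frow (p @ D @ R) = fst (bumps (frow (p @ D)) R)"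
    using frow_append[of "p @ D" R] by simp
  show "set D \<subseteq> set (frow (p @ D @ R))"
    unfolding 2 using bumps_subset_keep[OF inc_frow 1, of R] assms(2) by force
  show "take (length D) (frow (p @ D @ R)) = take (length D) (frow (p @ D))"
    unfolding 2 using take_bumps_large[OF assms(1) inc_frow 1 assms(2)] .
qed

lemma state_over_suffix:
  assumes "state As (p @ D @ R)" "inc D" "\<forall>r\<in>set R. \<forall>a\<in>set D. a < r"
  shows "over (top_col As) D"
  using over_subset[of "top_col As" "frow (p @ D @ R)" D] frow_contains(1)[OF assms(2,3)] assms(1,2)
  unfolding state_def by auto

text \<open>Only the first \<open>length As\<close> entries of the first row enter the comparison,
  and once \<open>D\<close> is inserted, the two letters behind it are too large to change
  them.\<close>

lemma state_swap_step:
  assumes "swap_step (length As) u v"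
  shows "state As u \<longleftrightarrow> state As v"
proof -
  obtain p D x y where u: "u = p @ D @ [x, y]" "v = p @ D @ swap_end x y" "length D = length As"
    "inc (D @ [x, y])" "even y" "even x \<or> x = y - 1"
    using assms unfolding swap_step_def by blast
  have iD: "inc D" "\<forall>r\<in>set [x, y]. \<forall>a\<in>set D. a < r" "\<forall>r\<in>set (swap_end x y). \<forall>a\<in>set D. a < r"
    using u by (auto simp: sorted_wrt_append swap_end_def)
  have t: "take (length As) (frow u) = take (length As) (frow v)"
    using frow_contains(2)[OF iD(1,2), of p] frow_contains(2)[OF iD(1,3), of p] u by simp
  have ov: "over (top_col As) (frow u) \<longleftrightarrow> over (top_col As) (frow v)" if "stacked As"
    using over_take[of "top_col As" "length As"] length_top_col[OF that] t by (metis order_refl)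
  have "over (top_col As) D" if "state As u \<or> state As v"
    using that state_over_suffix[OF _ iD(1,2), of As p] state_over_suffix[OF _ iD(1,3), of As p] u by auto
  then show ?thesis
    using swap_step_K[of As D x y p] ov u unfolding state_def by fastforce
qed

text \<open>The equivalence induced on the part of the word that is left of the columns \<open>As\<close>.\<close>

definition lev :: "int list list \<Rightarrow> int list \<Rightarrow> int list \<Rightarrow> bool" where
  "lev As = equivclp (\<lambda>u v. (u \<approx> v \<or> swap_step (length As) u v) \<and> state As u \<and> state As v)"

lemma lev_refl [simp]: "lev As u u" by (simp add: lev_def)
lemma lev_sym: "lev As u v \<Longrightarrow> lev As v u" by (simp add: lev_def equivclp_sym)
lemma lev_trans [trans]: "lev As u v \<Longrightarrow> lev As v w \<Longrightarrow> lev As u w"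
  unfolding lev_def by (rule equivclp_trans)

lemma lev_ck: "state As u \<Longrightarrow> u \<approx> v \<Longrightarrow> lev As u v"
  unfolding lev_def using state_ck by (intro r_into_equivclp) auto

lemma lev_swap_step: "state As u \<Longrightarrow> swap_step (length As) u v \<Longrightarrow> lev As u v"
  unfolding lev_def using state_swap_step by (intro r_into_equivclp) auto

lemma lev_state: "lev As u v \<Longrightarrow> state As u \<longleftrightarrow> state As v"
  unfolding lev_def by (induction rule: equivclp_induct) auto

lemma lev_length: "lev As u v \<Longrightarrow> length u = length v"
  unfolding lev_def
  by (induction rule: equivclp_induct) (auto dest!: ck_length simp: swap_step_def swap_end_def split: if_splits)

end

section \<open>Weak comparison, left insertion of runs, and letters emitted by increasing
  words\<close>

lemma weakly_over_subset:
  "weakly_over B S \<Longrightarrow> inc S \<Longrightarrow> inc D \<Longrightarrow> set D \<subseteq> set S \<Longrightarrow> weakly_over B D"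
proof (induction B S arbitrary: D rule: weakly_over.induct)
  case (1 b B s S)
  show ?case
  proof (cases D)
    case (Cons d D')
    then have "set D' \<subseteq> set S" using 1 by fastforce
    then show ?thesis using 1 Cons by fastforce
  qed simp
qed auto

text \<open>Promotion raises the last entry of the new column by at most one, which can turn the
  strict inequality there into an equality.\<close>

lemma over_weakly: "over (P @ t # R) F \<Longrightarrow> c \<le> t + 1 \<Longrightarrow> weakly_over (P @ [c]) F"
proof (induction P arbitrary: F)
  case Nil
  then show ?case by (cases F) auto
next
  case (Cons p P)
  then show ?case by (cases F) auto
qed

lemma over_snoc:
  "weakly_over (A @ [a]) (D @ [d]) \<Longrightarrow> over A (D @ [d]) \<Longrightarrow> length A = length D \<Longrightarrow> a \<noteq> d \<Longrightarrow>
    over (A @ [a]) (D @ [d])"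
  by (induction A D rule: over.induct) auto

lemma paired_snoc: "paired (T @ [y]) \<Longrightarrow> inc (T @ [y - 1]) \<Longrightarrow> even y \<Longrightarrow> paired T"
proof (induction T rule: paired.induct)
  case (2 x xs)
  show ?case
  proof (cases "even x")
    case True
    then show ?thesis using 2 by simp
  next
    case False
    then have "hd (xs @ [y]) = x + 1" "paired (tl (xs @ [y]))" using 2 by auto
    moreover from this have "xs \<noteq> []" using 2(4) by force
    ultimately show ?thesis using 2 False by (cases xs) auto
  qed
qed simp

lemma ck_move_many:
  "inc (A @ [x]) \<Longrightarrow> inc Z \<Longrightarrow> \<forall>z\<in>set Z. x < z \<Longrightarrow> A @ rev Z @ [x] \<approx> rev Z @ A @ [x]"
proof (induction Z rule: rev_induct)
  case (snoc z Z)
  then have z: "x < z" "\<forall>y\<in>set Z. x < y" "inc Z" by (auto simp: sorted_wrt_append)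
  show ?case
  proof (cases Z)
    case Nil
    then show ?thesis using ck_move_large[OF snoc.prems(1) z(1)] by simp
  next
    case (Cons y Y)
    then have "last (rev Z) = y" "rev Z @ [x] = rev Y @ [y, x]" by simp_all
    have "inc (A @ [hd (rev Z @ [x])])" "hd (rev Z @ [x]) < z"
      using snoc.prems Cons by (auto simp: sorted_wrt_append hd_append hd_rev last_in_set split: if_splits)
        (meson last_in_set less_trans list.set_intros(2))+
    then have "A @ [z, hd (rev Z @ [x])] \<approx> z # A @ [hd (rev Z @ [x])]"
      by (rule ck_move_large)
    from ck_append2[OF this, of "tl (rev Z @ [x])"]
    have "A @ z # rev Z @ [x] \<approx> z # A @ rev Z @ [x]"
      by (cases "rev Z") auto
    also have "\<dots> \<approx> z # rev Z @ A @ [x]"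
      using snoc z by (intro ck_Cons) auto
    finally show ?thesis by simp
  qed
qed simp

text \<open>The letters of \<open>d\<close> enter the decreasing run from the last to the first.
  Each is smaller than a letter already there (\<open>w\<close>, then its successor in
  \<open>d\<close>), so each bumps something out, below everything bumped out before. Thus
  \<open>d\<close> reappears at the right end as an increasing run of the same length.\<close>

lemma left_bumps:
  "inc d \<Longrightarrow> inc Z \<Longrightarrow> w \<in> set Z \<Longrightarrow> \<forall>a\<in>set d. a < w \<Longrightarrow> ck_reduced (d @ rev Z) \<Longrightarrow>
    \<exists>Z' bs. d @ rev Z \<approx> rev Z' @ bs \<and> inc Z' \<and> inc bs \<and> length bs = length d \<and> (\<forall>b\<in>set bs. b \<le> w) \<and>
      Z' \<noteq> [] \<and> (\<forall>b\<in>set bs. hd Z' < b) \<and>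
      (d \<noteq> [] \<longrightarrow> hd d \<in> set Z' \<and> (\<forall>b\<in>set bs. hd d < b)) \<and> (d = [] \<longrightarrow> Z' = Z)"
proof (induction d)
  case Nil
  then show ?case by (intro exI[of _ Z] exI[of _ "[]"]) auto
next
  case (Cons a ds)
  then obtain Z1 bs where 1: "ds @ rev Z \<approx> rev Z1 @ bs" "inc Z1" "inc bs" "length bs = length ds"
    "\<forall>b\<in>set bs. b \<le> w" "ds \<noteq> [] \<longrightarrow> hd ds \<in> set Z1 \<and> (\<forall>b\<in>set bs. hd ds < b)" "ds = [] \<longrightarrow> Z1 = Z"
    using ck_reduced_Cons by fastforce
  define w1 where "w1 = (if ds = [] then w else hd ds)"
  have w1: "w1 \<in> set Z1" "a < w1" "w1 \<le> w" "\<forall>b\<in>set bs. w1 < b"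
    using 1 Cons.prems hd_in_set[of ds] by (auto simp: w1_def less_imp_le)
  obtain Z' b where b: "bump Z1 a = (Z', [b])" "b \<le> w1" "a < b"
    using bump_out_le[OF 1(2) w1(1,2)] by (metis prod.exhaust_sel)
  have 2: "(a # ds) @ rev Z \<approx> (a # rev Z1) @ bs" using ck_Cons[OF 1(1), of a] by simp
  then have "ck_reduced (a # rev Z1)" using Cons.prems ck_reduced_ck ck_reduced_prefix by blast
  then have "a # rev Z1 \<approx> rev Z' @ [b]" using ck_bump_left[OF 1(2), of a] b by simp
  then have "(a # rev Z1) @ bs \<approx> (rev Z' @ [b]) @ bs" by (rule ck_append2)
  then have 3: "(a # ds) @ rev Z \<approx> rev Z' @ b # bs" using 2 ck_trans by fastforce
  have iZ': "inc Z'" and aZ': "a \<in> set Z'" using inc_bump[OF 1(2), of a] bump_mem[of a Z1] b by auto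
  have hd: "hd Z' \<le> a" using hd_le_inc[OF iZ' aZ'] .
  show ?case
    using 1 w1 b 3 iZ' aZ' hd by (intro exI[of _ Z'] exI[of _ "b # bs"]) fastforce
qed

lemma bumps_none: "inc S \<Longrightarrow> inc (x # E) \<Longrightarrow> snd (bump S x) = [] \<Longrightarrow> snd (bumps S (x # E)) = []"
proof (induction E arbitrary: S x)
  case (Cons y E)
  then have "snd (bump (fst (bump S x)) y) = []"
    using bump_none_mono[of S x y "fst (bump S x)"] by (simp add: prod_eq_iff)
  then show ?case using Cons inc_bump[of S x] by auto
qed simp

lemma bumps_inc_out: "inc S \<Longrightarrow> inc E \<Longrightarrow> inc (snd (bumps S E))"
proof (induction E arbitrary: S)
  case (Cons x E)
  define S1 where "S1 = fst (bump S x)"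
  have iS1: "inc S1" using Cons.prems inc_bump by (simp add: S1_def)
  have "b < b'" if b: "snd (bump S x) = [b]" and b': "b' \<in> set (snd (bumps S1 E))" for b b'
  proof (cases E)
    case E: (Cons y E')
    show ?thesis
    proof (cases "snd (bump S1 y) = []")
      case True
      then show ?thesis using bumps_none[of S1 y E'] E b' iS1 Cons.prems by auto
    next
      case False
      then obtain c where c: "snd (bump S1 y) = [c]" using bump_out_cases by blast
      have "b < c"
        using bump_mono[of S x y S1 b "fst (bump S1 y)" c] Cons.prems E b c
        by (simp add: S1_def prod_eq_iff)
      moreover have "c \<le> b'" using Cons.IH[OF iS1] Cons.prems E c b' by auto
      ultimately show ?thesis by simp
    qed
  qed (use b' in simp)
  then show ?case
    using Cons.IH[OF iS1] Cons.prems bump_out_cases[of S x] by (auto simp: S1_def)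
qed simp

lemma bumps_all_out:
  "inc S \<Longrightarrow> inc (E @ [x]) \<Longrightarrow> snd (bump (fst (bumps S E)) x) \<noteq> [] \<Longrightarrow> length (snd (bumps S E)) = length E"
proof (induction E arbitrary: S)
  case (Cons y E)
  have "snd (bump S y) \<noteq> []"
  proof
    assume "snd (bump S y) = []"
    then have "snd (bumps S (y # E @ [x])) = []" using bumps_none[of S y "E @ [x]"] Cons.prems by simp
    then show False using Cons.prems(3) by (simp add: bumps_append)
  qed
  then have "length (snd (bump S y)) = 1" using bump_out_cases[of S y] by auto
  then show ?case using Cons inc_bump[of S y] by auto
qed simp

text \<open>Popping the tail of the first row of \<open>q\<close> leaves \<open>next_col k q\<close> at the end of the word,
  preceded by \<open>peel k q\<close>.\<close>

definition next_col :: "nat \<Rightarrow> int list \<Rightarrow> int list" where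
  "next_col k q = take k (frow q) @ [hd (promote (drop k (frow q)))]"

definition peel :: "nat \<Rightarrow> int list \<Rightarrow> int list" where
  "peel k q = emit q @ rev (tl (promote (drop k (frow q))))"

context sp_words
begin

text \<open>One round swaps the last two letters and moves the larger result left past the remaining
  row into \<open>p\<close>. Rounds stop when \<open>k + 1\<close> letters of the row are left;
  \<open>promote\<close> lists the outcome of all of them.\<close>

lemma pop:
  "state As (p @ S) \<Longrightarrow> inc S \<Longrightarrow> length As < length S \<Longrightarrow> k = length As \<Longrightarrow>
    paired (drop k S) \<and>
    lev As (p @ S) (p @ rev (tl (promote (drop k S))) @ take k S @ [hd (promote (drop k S))])"
proof (induction "length S" arbitrary: S p)
  case (Suc n)
  show ?case
  proof (cases "length S = Suc k")
    case True
    have "over (top_col As) S" using state_over_suffix[of As p S "[]"] Suc.prems by simp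
    then have "even (last S)"
      using even_last[of As S p] True Suc.prems unfolding state_def by auto
    moreover have "drop k S = [last S]" "S = take k S @ [last S]"
      using True by (cases S rule: rev_cases; simp)+
    ultimately show ?thesis by simp
  next
    case False
    then obtain S0 x y where S: "S = S0 @ [x, y]"
      using Suc.prems by (metis (no_types, lifting) Suc_lessI append.assoc append_Cons append_Nil length_0_conv
          length_append_singleton less_Suc0 less_nat_zero_code rev_exhaust)
    then have k: "k \<le> length S0" using Suc.prems False by simp
    \<comment> \<open>\<open>swap_step\<close> uses the \<open>k\<close> letters directly before the
      last two, not the first \<open>k\<close> entries of the row, which are the ones that remain at
      the end.\<close>
    define D where "D = drop (length S0 - k) S0"
    define S00 where "S00 = take (length S0 - k) S0"
    have SD: "S0 = S00 @ D" "length D = length As" using k Suc.prems by (auto simp: D_def S00_def)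
    have inc: "inc (D @ [x, y])" "x < y" "inc S0" "\<forall>s\<in>set S0. s < x"
      using Suc.prems S SD by (auto simp: sorted_wrt_append)
    have "over (top_col As) D"
      using state_over_suffix[of As "p @ S00" D "[x, y]"] Suc.prems S SD by (auto simp: sorted_wrt_append)
    then have par: "even y" "even x \<or> x = y - 1"
      using parity[of As D x y "p @ S00"] Suc.prems S SD inc unfolding state_def by auto
    obtain y' x' where swap_end: "swap_end x y = [y', x']" "x \<le> x'" "x' < y'" "even x'"
      using swap_end_cases inc par by blast
    have "swap_step (length As) (p @ S) (p @ S0 @ swap_end x y)"
      unfolding swap_step_def using S SD inc par by (intro exI[of _ "p @ S00"] exI[of _ D] exI) auto
    then have 1: "lev As (p @ S) (p @ S0 @ swap_end x y)" using lev_swap_step Suc.prems by blast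
    have inc': "inc (S0 @ [x'])" using inc swap_end by (force simp: sorted_wrt_append)
    have "p @ S0 @ swap_end x y \<approx> (p @ [y']) @ (S0 @ [x'])"
      using ck_append1[OF ck_move_large[OF inc' swap_end(3)], of p] swap_end(1) by simp
    then have 2: "lev As (p @ S) ((p @ [y']) @ (S0 @ [x']))"
      using 1 lev_ck lev_state lev_trans Suc.prems by blast
    then have IH: "paired (drop k (S0 @ [x']))"
      "lev As ((p @ [y']) @ (S0 @ [x'])) ((p @ [y']) @ rev (tl (promote (drop k (S0 @ [x'])))) @
        take k (S0 @ [x']) @ [hd (promote (drop k (S0 @ [x'])))])"
      using Suc.hyps(1)[of "S0 @ [x']" "p @ [y']"] Suc.hyps(2) S Suc.prems k inc' lev_state by auto
    define t where "t = drop k S0"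
    have t: "drop k (S0 @ [x']) = t @ [x']" "drop k S = t @ [x, y]" "take k (S0 @ [x']) = take k S"
      using k S by (auto simp: t_def)
    have "paired (t @ [x, y]) \<and> promote (t @ [x, y]) = promote (t @ [x']) @ [y']"
    proof (cases "even x")
      case True
      then have "x' = x" "y' = y" using swap_end(1) by (auto simp: swap_end_def)
      then show ?thesis
        using IH(1) t par paired_append[of "t @ [x]" "[y]"] promote_append[of "t @ [x]" "[y]"] by simp
    next
      case False
      then have x: "x' = y" "y' = y + 1" "x = y - 1" using swap_end(1) par by (auto simp: swap_end_def)
      have "inc (t @ [y - 1])" using inc x sorted_wrt_drop[of _ S0 k]
        by (auto simp: t_def sorted_wrt_append dest: in_set_dropD)
      then have "paired t" using paired_snoc[of t y] IH(1) t x par by simp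
      then show ?thesis
        using x par False paired_append[of t] promote_append[of t] by simp
    qed
    then have h: "paired (drop k S)" "rev (tl (promote (drop k S))) = y' # rev (tl (promote (t @ [x'])))"
      "hd (promote (drop k S)) = hd (promote (t @ [x']))"
      unfolding t(2) by (auto simp: hd_append)
    show ?thesis unfolding h(2,3) using h(1) lev_trans[OF 2 IH(2)[unfolded t(1,3)]] by simp
  qed
qed simp

lemma peel_lev:
  assumes "state As q" "length As < length (frow q)"
  shows "paired (drop (length As) (frow q))" "lev As q (peel (length As) q @ next_col (length As) q)"
proof -
  have 1: "q \<approx> emit q @ frow q" using ck_emit_frow state_red assms by blast
  then have "state As (emit q @ frow q)" using state_ck assms by blast
  from pop[OF this _ assms(2) refl]
  have "paired (drop (length As) (frow q))"
    "lev As (emit q @ frow q) (peel (length As) q @ next_col (length As) q)"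
    by (auto simp: peel_def next_col_def)
  then show "paired (drop (length As) (frow q))" "lev As q (peel (length As) q @ next_col (length As) q)"
    using lev_ck[OF assms(1) 1] lev_trans by blast+
qed

lemma tail_Cons:
  assumes "k < length (frow q)" "paired (drop k (frow q))"
  obtains t R c X where "frow q = take k (frow q) @ t # R" "drop k (frow q) = t # R"
    "promote (t # R) = c # X" "next_col k q = take k (frow q) @ [c]" "peel k q = emit q @ rev X"
    "t \<le> c" "c \<le> t + 1" "even c" "inc (c # X)" "even t \<Longrightarrow> c = t"
proof -
  obtain t R where t: "drop k (frow q) = t # R" using assms(1) by (cases "drop k (frow q)") auto
  have "promote (t # R) \<noteq> []" by (simp del: promote.simps)
  then obtain c X where c: "promote (t # R) = c # X" by (meson neq_Nil_conv)
  have "frow q = take k (frow q) @ t # R" using t append_take_drop_id[of k "frow q"] by simp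
  moreover have "inc (c # X)"
    using inc_promote[of "t # R"] assms(2) c t sorted_wrt_drop[OF inc_frow, of k q] by metis
  ultimately show ?thesis
    using that[of t R c X] t c by (auto simp: next_col_def peel_def split: if_splits)
qed

text \<open>The first two rows of the insertion tableau compare strictly; the only change in the new
  column is the promoted last entry. Hence strictness survives for \<open>butlast\<close>, and the
  full column is only guaranteed to compare weakly.\<close>

lemma next_col_props:
  assumes "state As q" "length As < length (frow q)"
  shows "stacked (next_col (length As) q # As)"
    "weakly_over (next_col (length As) q) (frow (peel (length As) q))"
    "over (butlast (next_col (length As) q)) (frow (peel (length As) q))"
proof -
  let ?k = "length As"
  obtain t R c X where t: "frow q = take ?k (frow q) @ t # R" "drop ?k (frow q) = t # R"
    "promote (t # R) = c # X" "next_col ?k q = take ?k (frow q) @ [c]" "peel ?k q = emit q @ rev X"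
    "t \<le> c" "c \<le> t + 1" "even c" "inc (c # X)"
    using tail_Cons[OF assms(2) peel_lev(1)[OF assms]] by metis
  have lt: "length (take ?k (frow q)) = ?k" using assms(2) by simp
  have ti: "inc (take ?k (frow q) @ t # R)" using t(1) inc_frow by metis
  then have ac: "inc (next_col ?k q)" unfolding t(4) using t(6) by (force simp: sorted_wrt_append)
  have "over (top_col As) (take ?k (frow q))"
    using assms(1) length_top_col[of As] over_take[of "top_col As" ?k] unfolding state_def by auto
  then have "over (top_col As) (next_col ?k q)"
    using over_append[of "top_col As"] length_top_col[of As] t(4) lt assms(1) unfolding state_def by auto
  then show "stacked (next_col ?k q # As)" using assms ac t(4,8) lt unfolding state_def by auto
  have ov: "over (take ?k (frow q) @ t # R) (frow (emit q))"
    using covers_over[OF covers_frow_emit, of q] t(1) by metis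
  have fw: "frow (peel ?k q) = fst (bumps (frow (emit q)) (rev X))"
    using t(5) by (simp add: frow_append)
  have big: "\<forall>x\<in>set (rev X). \<forall>a\<in>set (next_col ?k q). a < x"
    using ac t(4,9) by (fastforce simp: sorted_wrt_append)
  show "weakly_over (next_col ?k q) (frow (peel ?k q))"
    unfolding fw using over_weakly[OF ov t(7)] t(4) ac big
    by (intro weakly_over_bumps) (auto intro: less_imp_le)
  have "over (take ?k (frow q)) (frow (emit q))"
    using over_take1[OF covers_over[OF covers_frow_emit]] by blast
  then show "over (butlast (next_col ?k q)) (frow (peel ?k q))"
    unfolding fw using t(4) ac big by (intro over_bumps) (auto simp: sorted_wrt_append)
qed

text \<open>The case without obstruction: an even letter is not altered by promotion, so the popped
  column is an unchanged initial segment of the first row and strictness is kept.\<close>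

definition good :: "int list list \<Rightarrow> int list \<Rightarrow> int list \<Rightarrow> bool" where
  "good As A u \<longleftrightarrow> state As u \<and> take (Suc (length As)) (frow u) = A \<and> length A = Suc (length As) \<and> even (last A)"

lemma good_props:
  assumes "good As A u"
  shows "length As < length (frow u)" "next_col (length As) u = A" "state (A # As) (peel (length As) u)"
    "hd (drop (length As) (frow u)) = last A"
proof -
  let ?k = "length As"
  have state: "state As u" and A: "take (Suc ?k) (frow u) = A" "length A = Suc ?k" "even (last A)"
    using assms by (auto simp: good_def)
  show len: "?k < length (frow u)" using A by auto
  obtain t R c X where t: "frow u = take ?k (frow u) @ t # R" "drop ?k (frow u) = t # R"
    "promote (t # R) = c # X" "next_col ?k u = take ?k (frow u) @ [c]" "peel ?k u = emit u @ rev X"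
    "even t \<Longrightarrow> c = t" "inc (c # X)"
    using tail_Cons[OF len peel_lev(1)[OF state len]] by metis
  have A': "A = take ?k (frow u) @ [t]"
    using A(1) t(2) len by (metis take_Suc_conv_app_nth hd_drop_conv_nth list.sel(1))
  then show "hd (drop ?k (frow u)) = last A" using t(2) by simp
  have ct: "c = t" using t(6) A(3) A' by simp
  then show ac: "next_col ?k u = A" using t(4) A' by simp
  have stacked: "stacked (A # As)" using next_col_props(1)[OF state len] ac by simp
  have "over A (frow (emit u))"
    using over_take1[OF covers_over[OF covers_frow_emit], of "Suc ?k" u] A by simp
  moreover have "\<forall>x\<in>set (rev X). \<forall>a\<in>set A. a < x"
    using A' t(7) ct stacked by (fastforce simp: sorted_wrt_append)
  ultimately have "over A (frow (peel ?k u))"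
    using over_bumps[of A "frow (emit u)" "rev X"] stacked t(5) by (simp add: frow_append)
  moreover have "state As (peel ?k u @ A)" using peel_lev(2)[OF state len] ac state lev_state by simp
  ultimately show "state (A # As) (peel ?k u)" using stacked by (simp add: state_def)
qed

text \<open>Weak comparison is enough, since an equal entry stays in place under insertion: putting
  the popped column back makes it the initial segment of the first row. This is what makes a second
  round succeed.\<close>

lemma good_peel:
  assumes "state As q" "length As < length (frow q)"
  shows "good As (next_col (length As) q) (peel (length As) q @ next_col (length As) q)"
proof -
  note p = next_col_props[OF assms]
  have "state As (peel (length As) q @ next_col (length As) q)"
    using lev_state[OF peel_lev(2)[OF assms]] assms by simp
  moreover have "take (length (next_col (length As) q)) (frow (peel (length As) q @ next_col (length As) q)) = next_col (length As) q"
    using bumps_weakly_over[of "next_col (length As) q"] p by (simp add: frow_append)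
  ultimately show ?thesis using p unfolding good_def by auto
qed

lemma peel_ck:
  assumes "state As u" "u \<approx> v"
  shows "peel k u \<approx> peel k v" "next_col k u = next_col k v"
proof -
  have "frow u = frow v" "emit u \<approx> emit v" using ck_frow_emit[OF assms(2)] state_red assms by blast+
  then show "peel k u \<approx> peel k v" "next_col k u = next_col k v"
    by (simp_all add: peel_def next_col_def ck_append2)
qed

lemma good_ck: "good As A u \<Longrightarrow> u \<approx> v \<Longrightarrow> good As A v"
  using ck_frow_emit[of u v] state_red[of As u] state_ck[of As u v] unfolding good_def by auto

end

text \<open>A \<open>swap_step\<close> one level up, except that the parities of \<open>b\<close>
  and \<open>b'\<close> still have to be derived.\<close>

definition edge_regular :: "nat \<Rightarrow> int list \<Rightarrow> int list \<Rightarrow> bool" where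
  "edge_regular k W W' \<longleftrightarrow> (\<exists>Y D b b' w. W \<approx> Y @ D @ [b, b'] \<and> W' \<approx> Y @ D @ w \<and> length D = Suc k \<and>
     inc (D @ [b, b']) \<and> (w = [b', b] \<or> b = b' - 1 \<and> even b' \<and> w = [b' + 1, b']))"

text \<open>The exception that no move one level up explains; it is resolved only after a column
  ending in \<open>y\<close> has been put behind both words, see
  \<open>linked_special\<close>.\<close>

definition edge_special :: "nat \<Rightarrow> int \<Rightarrow> int list \<Rightarrow> int list \<Rightarrow> bool" where
  "edge_special k y W W' \<longleftrightarrow> (\<exists>Y D. W \<approx> Y @ D @ [y, y + 1, y + 2] \<and>
     W' \<approx> Y @ D @ [y + 1, y + 3, y + 2] \<and> length D = k \<and> inc (D @ [y]))"

lemma edge_regularI: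
  assumes "tail_related w V V'" "\<not> V \<approx> V'" "inc d" "\<forall>a\<in>set d. a < w" "length d = k"
    "ck_reduced (E @ d @ V)"
  shows "edge_regular k (E @ d @ V) (E @ d @ V')"
proof -
  obtain Z b b' v where Z: "inc Z" "w \<in> set Z" "w < b" "b < b'" "V \<approx> rev Z @ [b, b']"
    "V' \<approx> rev Z @ v" "v = [b', b] \<or> b = b' - 1 \<and> even b' \<and> v = [b' + 1, b']"
    using assms(1,2) unfolding tail_related_def by blast
  have "ck_reduced (d @ V)" using assms(6) by (rule ck_reduced_suffix)
  then have "ck_reduced ((d @ rev Z) @ [b, b'])"
    using ck_reduced_ck ck_append1[OF Z(5), of d] by simp
  then have "ck_reduced (d @ rev Z)" by (rule ck_reduced_prefix)
  from left_bumps[OF assms(3) Z(1,2) assms(4) this] obtain Z' bs where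
    bs: "d @ rev Z \<approx> rev Z' @ bs" "inc Z'" "inc bs" "length bs = length d" "\<forall>b\<in>set bs. b \<le> w"
    "Z' \<noteq> []" "\<forall>b\<in>set bs. hd Z' < b" "d = [] \<longrightarrow> Z' = Z"
    by blast
  \<comment> \<open>The run must have one letter more than \<open>d\<close>: \<open>bs\<close> stems
    from \<open>d\<close>, and the smallest letter of the decreasing run supplies the missing
    one.\<close>
  define D where "D = hd Z' # bs"
  have Z': "rev Z' @ bs = rev (tl Z') @ D" using bs(6) by (cases Z') (auto simp: D_def)
  have "hd Z' < b"
  proof (cases bs)
    case Nil
    then have "Z' = Z" using bs by simp
    then show ?thesis using hd_le_inc[OF Z(1,2)] Z(3) by simp
  next
    case (Cons b1 bs')
    then have "hd Z' < b1" "b1 \<le> w" using bs by auto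
    then show ?thesis using Z(3) by simp
  qed
  moreover have "\<forall>x\<in>set bs. x < b" using bs(5) Z(3) by auto
  ultimately have "inc (D @ [b, b'])" using bs Z(4) by (auto simp: D_def sorted_wrt_append)
  moreover have "E @ d @ U \<approx> (E @ rev (tl Z')) @ D @ r" if "U \<approx> rev Z @ r" for U r
  proof -
    have "E @ d @ U \<approx> E @ (d @ rev Z) @ r" using ck_append1[OF that, of "E @ d"] by simp
    also have "\<dots> \<approx> E @ (rev Z' @ bs) @ r" by (rule ck_context[OF bs(1)])
    also have "\<dots> = (E @ rev (tl Z')) @ D @ r" using Z' by simp
    finally show ?thesis .
  qed
  ultimately show ?thesis
    unfolding edge_regular_def using Z(5-7) bs(4) assms(5)
    by (intro exI[of _ "E @ rev (tl Z')"] exI[of _ D] exI[of _ b] exI[of _ b'] exI[of _ v])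
       (simp add: D_def)
qed

lemma edge_specialI:
  assumes "tail_special y V V'" "inc d" "\<forall>a\<in>set d. a < y" "length d = k"
  shows "edge_special k y (E @ d @ V) (E @ d @ V')"
proof -
  obtain Z where Z: "inc Z" "\<forall>z\<in>set Z. y + 1 < z" "V \<approx> rev (y # Z) @ [y + 1, y + 2]"
    "V' \<approx> rev ((y + 1) # Z) @ [y + 3, y + 2]"
    using assms(1) unfolding tail_special_def by blast
  have *: "E @ d @ U \<approx> (E @ rev Z) @ d @ w # r" if "U \<approx> rev (w # Z) @ r" "y \<le> w" "w \<le> y + 1" for U w r
  proof -
    have "inc (d @ [w])" "\<forall>z\<in>set Z. w < z" using assms Z that by (auto simp: sorted_wrt_append)
    from ck_append2[OF ck_move_many[OF this(1) Z(1) this(2)], of r]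
    have "(d @ rev Z @ [w]) @ r \<approx> (rev Z @ d @ [w]) @ r" .
    then have "E @ d @ rev (w # Z) @ r \<approx> E @ rev Z @ d @ w # r"
      using ck_append1 by fastforce
    moreover have "E @ d @ U \<approx> E @ d @ rev (w # Z) @ r"
      using ck_append1[OF that(1), of "E @ d"] by simp
    ultimately show ?thesis using ck_trans by fastforce
  qed
  have "inc (d @ [y])" using assms by (auto simp: sorted_wrt_append)
  then show ?thesis
    unfolding edge_special_def using *[OF Z(3)] *[OF Z(4)] assms(4)
    by (intro exI[of _ "E @ rev Z"] exI[of _ d]) auto
qed

context sp_words
begin

text \<open>The letters \<open>x\<close>, \<open>y\<close> act only behind the first
  \<open>k\<close> entries of the first row, so \<open>tail_core\<close> describes the change there.
  What \<open>D\<close> emitted earlier is then carried through the popped run.\<close>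

lemma edge:
  assumes "state As u" and uv: "u = p @ D @ [x, y]" "v = p @ D @ swap_end x y"
    and k: "length D = length As" "k = length As" and inc: "inc (D @ [x, y])"
    and par: "even y" "even x \<or> x = y - 1"
  shows "k < length (frow u)" "k < length (frow v)" "next_col k u = next_col k v"
    "even x \<Longrightarrow> take (Suc k) (frow u) = take (Suc k) (frow v)"
    "peel k u \<approx> peel k v \<or> edge_regular k (peel k u) (peel k v) \<or>
     edge_special k (last (next_col k u)) (peel k u) (peel k v) \<and> odd (hd (drop k (frow u)))"
proof -
  have swap_step: "swap_step (length As) u v" unfolding swap_step_def using assms by blast
  then have stv: "state As v" using state_swap_step assms(1) by blast
  have xy: "x < y" "inc D" "\<forall>a\<in>set D. a < x" "\<forall>a\<in>set D. a < y"
    using inc by (auto simp: sorted_wrt_append)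
  obtain y' x' where swap_end: "swap_end x y = [y', x']" "x \<le> x'" "x' < y'" using swap_end_cases xy par by metis
  define S where "S = frow (p @ D)"
  have DS: "set D \<subseteq> set S" using bumps_inc_mem[of "frow p" D] xy by (simp add: S_def frow_append)
  have iS: "inc S" by (simp add: S_def)
  have lS: "k \<le> length S" using inc_subset_length[OF xy(2) DS] k by simp
  define Sk where "Sk = take k S"
  define \<sigma> where "\<sigma> = drop k S"
  have S: "S = Sk @ \<sigma>" "length Sk = k" using lS by (auto simp: Sk_def \<sigma>_def)
  have i\<sigma>: "inc \<sigma>" using iS S by (simp add: sorted_wrt_append)
  \<comment> \<open>The row contains all of \<open>D\<close>, whose \<open>k\<close> letters are
    below \<open>x\<close>; so its first \<open>k\<close> entries are below \<open>x\<close> as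
    well.\<close>
  have Skx: "\<forall>s\<in>set Sk. s < x" using take_less[OF xy(2) iS DS xy(3)] k by (simp add: Sk_def)
  obtain T out where T: "bumps \<sigma> [x, y] = (T, out)" by fastforce
  obtain T' out' where T': "bumps \<sigma> (swap_end x y) = (T', out')" by fastforce
  have bS: "bumps S [x, y] = (Sk @ T, out)"
    using bumps_prefix[of Sk "[x, y]" \<sigma>] Skx xy T S by force
  have bS': "bumps S (swap_end x y) = (Sk @ T', out')"
    using bumps_prefix[of Sk "swap_end x y" \<sigma>] Skx swap_end T' S by force
  have fu: "frow u = Sk @ T" "frow v = Sk @ T'" "emit u = emit (p @ D) @ out" "emit v = emit (p @ D) @ out'"
    using uv bS bS' frow_append[of "p @ D"] emit_append[of "p @ D"] by (auto simp: S_def)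
  have ne: "T \<noteq> []" "T' \<noteq> []" using bumps_not_Nil[of \<sigma>] T T' swap_end by (metis fst_conv list.distinct(1))+
  show lu: "k < length (frow u)" and lv: "k < length (frow v)" using fu S ne by auto
  have dr: "drop k (frow u) = T" "drop k (frow v) = T'" "take k (frow u) = Sk" "take k (frow v) = Sk"
    using fu S by auto
  have pr: "paired T" "paired T'"
    using peel_lev(1)[OF assms(1)] peel_lev(1)[OF stv] lu lv dr k by auto
  have W: "peel k u = emit (p @ D) @ out @ rev (tl (promote T))"
    "peel k v = emit (p @ D) @ out' @ rev (tl (promote T'))"
    using fu dr by (auto simp: peel_def)
  have "state As (peel k u @ next_col k u)" "state As (peel k v @ next_col k v)"
    using peel_lev(2)[OF assms(1)] peel_lev(2)[OF stv] lu lv k lev_state assms(1) stv by auto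
  then have redW: "ck_reduced (peel k u)" "ck_reduced (peel k v)"
    using state_red ck_reduced_prefix by blast+
  have r: "ck_reduced (out @ rev (tl (promote T)))" "ck_reduced (out' @ rev (tl (promote T')))"
    using redW ck_reduced_suffix unfolding W by blast+
  have "ck_reduced ((p @ D) @ [x, y])" "ck_reduced ((p @ D) @ swap_end x y)"
    using state_red[OF assms(1)] state_red[OF stv] uv by auto
  then have "ck_reduced (S @ [x, y])" "ck_reduced (S @ swap_end x y)"
    using ck_reduced_frow_append[of "p @ D"] by (auto simp: S_def)
  then have red: "ck_reduced (\<sigma> @ [x, y])" "ck_reduced (\<sigma> @ swap_end x y)"
    using ck_reduced_suffix S by auto
  note core = tail_core[OF i\<sigma> xy(1) par T T' red pr r]
  show ac: "next_col k u = next_col k v" using core dr by (simp add: next_col_def)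
  show "take (Suc k) (frow u) = take (Suc k) (frow v)" if "even x"
  proof -
    have "hd T = hd T'" using core that by blast
    then show ?thesis using fu S ne by (cases T; cases T') auto
  qed
  define d where "d = snd (bumps (frow p) D)"
  have Ed: "emit (p @ D) = emit p @ d" by (simp add: d_def emit_append)
  \<comment> \<open>If \<open>x\<close> or \<open>y\<close> bumps something out, then so did every
    letter of the increasing run before them, and the emitted letters increase. This is the form of
    \<open>d\<close> that the next level needs.\<close>
  have dprops: "length d = k \<and> inc d \<and> (\<forall>a\<in>set d. a < hd out)" if "out \<noteq> []"
  proof -
    have iDx: "inc (D @ [x])" using inc by (auto simp: sorted_wrt_append)
    have S': "S = fst (bumps (frow p) D)" by (simp add: S_def frow_append)
    have out: "out = snd (bump S x) @ snd (bump (fst (bump S x)) y)" using bS by auto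
    have ox: "snd (bump S x) \<noteq> []"
    proof
      assume "snd (bump S x) = []"
      then have "snd (bumps S [x, y]) = []" using bumps_none[of S x "[y]"] iS xy by simp
      then show False using that bS by simp
    qed
    then have "length d = k"
      using bumps_all_out[of "frow p" D x] iDx S' k by (simp add: d_def)
    moreover have "inc (d @ snd (bump S x))"
      using bumps_inc_out[of "frow p" "D @ [x]"] iDx S' by (simp add: d_def bumps_append)
    moreover have "hd out \<in> set (snd (bump S x))" using ox out by (simp add: hd_append)
    ultimately show ?thesis by (auto simp: sorted_wrt_append)
  qed
  have W2: "peel k u = emit p @ d @ out @ rev (tl (promote T))"
    "peel k v = emit p @ d @ out' @ rev (tl (promote T'))"
    using W Ed by auto
  show "peel k u \<approx> peel k v \<or> edge_regular k (peel k u) (peel k v) \<or>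
     edge_special k (last (next_col k u)) (peel k u) (peel k v) \<and> odd (hd (drop k (frow u)))"
  proof (cases "out @ rev (tl (promote T)) \<approx> out' @ rev (tl (promote T'))")
    case True
    then have "peel k u \<approx> peel k v"
      unfolding W2 using ck_append1[OF True, of "emit p @ d"] by simp
    then show ?thesis by simp
  next
    case False
    then consider "out \<noteq> []" "tail_related (hd out) (out @ rev (tl (promote T))) (out' @ rev (tl (promote T')))"
      | "out \<noteq> []" "odd x" "hd (promote T) = y" "hd T = x" "hd out = y"
        "tail_special y (out @ rev (tl (promote T))) (out' @ rev (tl (promote T')))"
      using core by blast
    then show ?thesis
    proof cases
      case 1
      then have "edge_regular k (peel k u) (peel k v)"
        unfolding W2 using dprops False redW(1) W2(1) by (intro edge_regularI) auto
      then show ?thesis by simp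
    next
      case 2
      then have "edge_special k y (peel k u) (peel k v)"
        unfolding W2 using dprops by (intro edge_specialI) auto
      then show ?thesis using 2 dr by (simp add: next_col_def)
    qed
  qed
qed

text \<open>\<open>parity\<close> settles \<open>b b'\<close>. If the other word ends in
  \<open>b' b\<close>, moving \<open>b'\<close> left past \<open>D\<close> exposes
  \<open>D @ [b]\<close> in the position of \<open>even_last\<close>, which forces \<open>b\<close>
  to be even.\<close>

lemma regular_swap_step:
  assumes "stacked (A # As)" "(Y @ D @ [b, b']) @ concat (A # As) \<in> K" "(Y @ D @ w) @ concat (A # As) \<in> K"
    and D: "length D = Suc (length As)" "inc (D @ [b, b'])" "over A D"
    and w: "w = [b', b] \<or> b = b' - 1 \<and> even b' \<and> w = [b' + 1, b']"
  shows "even b'" "even b \<or> b = b' - 1" "w = swap_end b b'"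
proof -
  have par: "even b' \<and> (even b \<or> b = b' - 1)"
    using parity[of "A # As" D b b' Y] assms by simp
  then show "even b'" "even b \<or> b = b' - 1" by auto
  have "even b" if "w = [b', b]"
  proof -
    have iD: "inc (D @ [b])" "b < b'" using D by (auto simp: sorted_wrt_append)
    have "(Y @ D @ w) @ concat (A # As) \<approx> (Y @ [b']) @ (D @ [b]) @ concat (A # As)"
      using ck_context[OF ck_move_large[OF iD], of Y "concat (A # As)"] that by simp
    then have "(Y @ [b']) @ (D @ [b]) @ concat (A # As) \<in> K" using assms(3) K_ck by blast
    from even_last[OF assms(1) _ iD(1) _ this] show ?thesis
      using D over_append[of A D "[b]"] assms(1) by simp
  qed
  then show "w = swap_end b b'" using w par by (auto simp: swap_end_def)
qed

text \<open>The exceptional case needs an odd entry at the head of the tail, whereas in a good word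
  this entry is the even last letter of the column.\<close>

lemma good_edge:
  assumes "good As A u" "good As A v" "swap_step (length As) u v"
  shows "lev (A # As) (peel (length As) u) (peel (length As) v)"
proof -
  let ?k = "length As"
  note pu = good_props[OF assms(1)] and pv = good_props[OF assms(2)]
  have state: "state As u" "even (last A)" using assms(1) by (auto simp: good_def)
  obtain p D x y where uv: "u = p @ D @ [x, y]" "v = p @ D @ swap_end x y" "length D = ?k"
    "inc (D @ [x, y])" "even y" "even x \<or> x = y - 1"
    using assms(3) unfolding swap_step_def by blast
  from edge(5)[OF state(1) uv(1-3) refl uv(4-6)] pu(2,4) state(2)
  consider "peel ?k u \<approx> peel ?k v" | "edge_regular ?k (peel ?k u) (peel ?k v)" by auto
  then show ?thesis
  proof cases
    case 1
    then show ?thesis using lev_ck pu(3) by blast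
  next
    case 2
    then obtain Y D b b' w where Y: "peel ?k u \<approx> Y @ D @ [b, b']" "peel ?k v \<approx> Y @ D @ w"
      "length D = Suc ?k" "inc (D @ [b, b'])" "w = [b', b] \<or> b = b' - 1 \<and> even b' \<and> w = [b' + 1, b']"
      unfolding edge_regular_def by blast
    have s: "state (A # As) (Y @ D @ [b, b'])" "state (A # As) (Y @ D @ w)"
      using state_ck pu(3) pv(3) Y by blast+
    have "over A D"
      using state_over_suffix[of "A # As" Y D "[b, b']"] s(1) Y(4) by (auto simp: sorted_wrt_append)
    then have "even b'" "even b \<or> b = b' - 1" "w = swap_end b b'"
      using regular_swap_step[of A As Y D b b' w] s Y unfolding state_def by auto
    then have "swap_step (length (A # As)) (Y @ D @ [b, b']) (Y @ D @ w)"
      unfolding swap_step_def using Y by (intro exI[of _ Y] exI[of _ D] exI[of _ b] exI[of _ b']) simp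
    then have "lev (A # As) (Y @ D @ [b, b']) (Y @ D @ w)" using lev_swap_step s by blast
    moreover have "lev (A # As) (peel ?k u) (Y @ D @ [b, b'])" "lev (A # As) (Y @ D @ w) (peel ?k v)"
      using lev_ck Y pu(3) pv(3) lev_sym by blast+
    ultimately show ?thesis using lev_trans by blast
  qed
qed

text \<open>Invariance of the second round is shown along chains of good words with a fixed column;
  this is the relation preserved at each link.\<close>

definition linked :: "int list list \<Rightarrow> int list \<Rightarrow> int list \<Rightarrow> int list \<Rightarrow> bool" where
  "linked As A u v \<longleftrightarrow> good As A u \<and> good As A v \<and> lev (A # As) (peel (length As) u) (peel (length As) v)"

lemma linked_trans [trans]: "linked As A u v \<Longrightarrow> linked As A v w \<Longrightarrow> linked As A u w"
  unfolding linked_def using lev_trans by blast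

lemma linked_ck: "good As A u \<Longrightarrow> u \<approx> v \<Longrightarrow> linked As A u v"
  unfolding linked_def
  using good_ck[of As A u v] peel_ck(1)[of As u v] lev_ck good_props(3)[of As A u] by (simp add: good_def)

lemma linked_swap_step:
  assumes "good As A u" "swap_step (length As) u v" "take (Suc (length As)) (frow v) = A"
  shows "linked As A u v"
proof -
  have "good As A v" using assms state_swap_step[OF assms(2)] by (auto simp: good_def)
  then show ?thesis unfolding linked_def using assms good_edge by blast
qed

lemma linked_after:
  assumes "good As A (P @ A @ [x, y])" "inc (A @ [x, y])" "even y" "even x \<or> x = y - 1"
  shows "linked As A (P @ A @ [x, y]) (P @ A @ swap_end x y)"
proof (rule linked_swap_step[OF assms(1)])
  have A: "length A = Suc (length As)" using assms(1) by (auto simp: good_def)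
  then obtain a A' where A': "A = a # A'" by (cases A) auto
  show "swap_step (length As) (P @ A @ [x, y]) (P @ A @ swap_end x y)"
    unfolding swap_step_def using A A' assms by (intro exI[of _ "P @ [a]"] exI[of _ A'] exI) auto
  have iA: "inc A" "\<forall>r\<in>set [x, y]. \<forall>a\<in>set A. a < r" "\<forall>r\<in>set (swap_end x y). \<forall>a\<in>set A. a < r"
    using assms(2) by (auto simp: sorted_wrt_append swap_end_def)
  show "take (Suc (length As)) (frow (P @ A @ swap_end x y)) = A"
    using frow_contains(2)[OF iA(1,2), of P] frow_contains(2)[OF iA(1,3), of P] assms(1) A
    by (simp add: good_def)
qed

text \<open>Both \<open>c\<close> and \<open>x\<close> are even, so a swap step exchanges them, and
  Knuth moves bring \<open>x\<close> in front of the column. Evenness of \<open>c\<close> is also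
  what keeps the initial segment of the first row unchanged.\<close>

lemma linked_insert:
  assumes "good As (A0 @ [c]) (P @ A0 @ [c, x])" "inc (A0 @ [c, x])" "even x"
  shows "linked As (A0 @ [c]) (P @ A0 @ [c, x]) (P @ x # A0 @ [c])"
proof -
  have A: "length A0 = length As" "even c" "state As (P @ A0 @ [c, x])"
    "take (Suc (length As)) (frow (P @ A0 @ [c, x])) = A0 @ [c]"
    using assms(1) by (auto simp: good_def)
  have swap_step: "swap_step (length As) (P @ A0 @ [c, x]) (P @ A0 @ swap_end c x)"
    unfolding swap_step_def using A assms by (intro exI[of _ P] exI[of _ A0] exI) auto
  have "take (Suc (length As)) (frow (P @ A0 @ swap_end c x)) = A0 @ [c]"
    using edge(4)[OF A(3) refl refl A(1) refl assms(2,3)] A by simp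
  then have 1: "linked As (A0 @ [c]) (P @ A0 @ [c, x]) (P @ A0 @ swap_end c x)"
    using linked_swap_step[OF assms(1) swap_step] by blast
  have "inc (A0 @ [c])" "c < x" using assms(2) by (auto simp: sorted_wrt_append)
  then have "P @ A0 @ swap_end c x \<approx> P @ x # A0 @ [c]"
    using ck_append1[OF ck_move_large, of A0 c x P] A by (simp add: swap_end_def)
  then have "linked As (A0 @ [c]) (P @ A0 @ swap_end c x) (P @ x # A0 @ [c])"
    using 1 linked_ck unfolding linked_def by blast
  then show ?thesis using 1 linked_trans by blast
qed

text \<open>The second half of the route in \<open>swap_step_K\<close>, now with every intermediate
  word good for the same column.\<close>

lemma linked_pop:
  assumes "good As A (P @ A @ [x, y])" "inc (A @ [x, y])" "even y" "even x \<or> x = y - 1"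
  shows "linked As A (P @ A @ [x, y]) (P @ swap_end x y @ A)"
proof -
  have "length A = Suc (length As)" using assms(1) by (auto simp: good_def)
  then obtain A0 c where A: "A = A0 @ [c]" by (cases A rule: rev_cases) auto
  have "x < y" using assms(2) by (auto simp: sorted_wrt_append)
  then obtain y' x' where swap_end: "swap_end x y = [y', x']" "x \<le> x'" "x' < y'" "even x'"
    using swap_end_cases assms by metis
  have iA: "inc (A @ [x'])" using assms(2) swap_end by (force simp: sorted_wrt_append)
  have 1: "linked As A (P @ A @ [x, y]) (P @ A @ swap_end x y)" using linked_after assms by blast
  moreover have "P @ A @ swap_end x y \<approx> (P @ [y']) @ A0 @ [c, x']"
    using ck_append1[OF ck_move_large[OF iA swap_end(3)], of P] swap_end(1) A by simp
  then have 2: "linked As A (P @ A @ swap_end x y) ((P @ [y']) @ A0 @ [c, x'])"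
    using 1 linked_ck unfolding linked_def by blast
  moreover have "linked As A ((P @ [y']) @ A0 @ [c, x']) ((P @ [y']) @ x' # A0 @ [c])"
    using linked_insert[of As A0 c "P @ [y']" x'] 2 iA swap_end(4) A unfolding linked_def by simp
  ultimately have "linked As A (P @ A @ [x, y]) ((P @ [y']) @ x' # A0 @ [c])"
    using linked_trans by blast
  then show ?thesis using swap_end(1) A by simp
qed

lemma linked_regular:
  assumes "good As A (Y @ D @ [b, b'] @ A)" "stacked (A # As)" "over A D" "length D = Suc (length As)"
    "inc (D @ [b, b'])" "even b'" "even b \<or> b = b' - 1"
  shows "linked As A (Y @ D @ [b, b'] @ A) (Y @ D @ swap_end b b' @ A)"
proof -
  have A: "inc A" "length A = Suc (length As)" using assms(2) by auto
  have ov: "over A (D @ [b, b'])" using over_append[of A D] assms A by simp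
  have "(D @ [b, b']) @ A \<approx> D @ A @ [b, b']"
    using ck_exchange[of A "D @ [b, b']"] ov assms A by simp
  then have "Y @ D @ [b, b'] @ A \<approx> (Y @ D) @ A @ [b, b']" using ck_append1 by fastforce
  then have 1: "linked As A (Y @ D @ [b, b'] @ A) ((Y @ D) @ A @ [b, b'])"
    using linked_ck assms(1) by blast
  have "inc (A @ [b, b'])"
    using inc_bumps[of "D @ [b, b']" A] bumps_over[OF A(1) ov] assms A by simp
  then have "linked As A ((Y @ D) @ A @ [b, b']) ((Y @ D) @ swap_end b b' @ A)"
    using linked_pop 1 assms unfolding linked_def by blast
  then show ?thesis using linked_trans[OF 1] by simp
qed

text \<open>The column supplies the missing copy of \<open>y\<close>: with it, Knuth and braid moves
  bring \<open>y + 1\<close> to the front and leave \<open>y + 1, y + 2\<close> behind the column.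
  As \<open>y + 1\<close> is odd, swapping this pair gives \<open>y + 3, y + 2\<close>.\<close>

lemma linked_special:
  assumes "good As (A0 @ [y]) (Y @ D @ [y, y + 1, y + 2] @ A0 @ [y])" "stacked ((A0 @ [y]) # As)"
    "over A0 D" "length D = length As" "inc (D @ [y])"
  shows "linked As (A0 @ [y]) (Y @ D @ [y, y + 1, y + 2] @ A0 @ [y]) (Y @ D @ [y + 1, y + 3, y + 2] @ A0 @ [y])"
    (is "linked As ?A ?u ?v")
proof -
  have A: "inc A0" "length A0 = length As" "inc (A0 @ [y])" "even y"
    using assms(2) by (auto simp: sorted_wrt_append)
  define D3 where "D3 = D @ [y, y + 1, y + 2]"
  have D3: "inc D3" "over A0 D3"
    using assms(5) over_append[of A0 D] assms A by (auto simp: D3_def sorted_wrt_append)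
  have "D3 @ A0 \<approx> D @ A0 @ [y, y + 1, y + 2]"
    using ck_exchange[of A0 D3] D3 A assms(4) by (simp add: D3_def)
  then have "?u \<approx> (Y @ D) @ A0 @ [y, y + 1, y + 2, y]"
    using ck_context[of "D3 @ A0" _ Y "[y]"] by (fastforce simp: D3_def)
  also have "\<dots> \<approx> (Y @ D) @ A0 @ [y, y + 1, y, y + 2]"
    using ck_append1[OF ck_bca[of y "y + 1" "y + 2"], of "Y @ D @ A0 @ [y]"] by simp
  also have "\<dots> \<approx> (Y @ D) @ A0 @ [y + 1, y, y + 1, y + 2]"
    using ck_context[OF ck_braid[of y "y + 1"], of "Y @ D @ A0" "[y + 2]"] by simp
  also have "\<dots> \<approx> (Y @ D @ [y + 1]) @ ?A @ [y + 1, y + 2]"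
    using ck_context[OF ck_move_large[OF A(3), of "y + 1"], of "Y @ D" "[y + 1, y + 2]"] by simp
  finally have 1: "linked As ?A ?u ((Y @ D @ [y + 1]) @ ?A @ [y + 1, y + 2])"
    using linked_ck assms(1) by blast
  have "inc (?A @ [y + 1, y + 2])" using A by (fastforce simp: sorted_wrt_append)
  moreover have "good As ?A ((Y @ D @ [y + 1]) @ ?A @ [y + 1, y + 2])" using 1 by (simp add: linked_def)
  ultimately have "linked As ?A ((Y @ D @ [y + 1]) @ ?A @ [y + 1, y + 2]) ((Y @ D @ [y + 1]) @ swap_end (y + 1) (y + 2) @ ?A)"
    using A(4) by (intro linked_pop) simp_all
  moreover have "swap_end (y + 1) (y + 2) = [y + 3, y + 2]" using A(4) by (simp add: swap_end_def)
  ultimately show ?thesis using linked_trans[OF 1] by simp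
qed

end

text \<open>\<open>peel k q\<close> may fail to be admissible in front of \<open>next_col k q\<close>; a second round repairs this
  without changing the column.\<close>

definition peel_twice :: "nat \<Rightarrow> int list \<Rightarrow> int list" where
  "peel_twice k q = peel k (peel k q @ next_col k q)"

section \<open>Column words as normal forms\<close>

definition word_of :: "int list list \<Rightarrow> int list" where
  "word_of N = concat (rev N)"

lemma word_of_simps [simp]: "word_of [] = []" "word_of (A # N) = word_of N @ A"
  by (simp_all add: word_of_def)

text \<open>The columns of a shifted tableau to the right of the first \<open>k\<close> columns, from left to right:
  their heights increase by one until the first column that misses the diagonal.\<close>

fun normal :: "nat \<Rightarrow> int list list \<Rightarrow> bool" where
  "normal k [] = True"
| "normal k (A # N) = (A \<noteq> [] \<and> inc A \<and> over A (top_col N) \<and>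
     (if length A = Suc k then normal (Suc k) N
      else length A \<le> k \<and> length (top_col N) \<le> length A \<and> normal k N))"

lemma word_of_eq_Nil: "normal k N \<Longrightarrow> word_of N = [] \<longleftrightarrow> N = []"
  by (cases N) auto

lemma inc_top_normal: "normal k N \<Longrightarrow> inc (top_col N)"
  by (cases N) auto

lemma length_top_normal: "normal k N \<Longrightarrow> length (top_col N) \<le> Suc k"
  by (cases N) (auto split: if_splits)

lemma normal_over_frow:
  assumes "normal (Suc k) N" "length A = Suc k" "over A (top_col N)" "frow (word_of N) = top_col N @ X"
    "length (top_col N) \<le> Suc k \<longrightarrow> X = []"
  shows "over A (frow (word_of N))"
proof (cases "length (top_col N) \<le> Suc k")
  case False
  then show ?thesis using over_append[of A "top_col N" X] assms by simp
qed (use assms in simp)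

text \<open>Insertion of a reversed column word produces columns as rows. Only a column reaching the
  diagonal can be prolonged, by the surplus \<open>X\<close> of longer columns to its right.\<close>

lemma normal_frow:
  "normal k N \<Longrightarrow> \<exists>X. frow (word_of N) = top_col N @ X \<and> (length (top_col N) \<le> k \<longrightarrow> X = [])"
proof (induction k N rule: normal.induct)
  case (2 k A N)
  show ?case
  proof (cases "length A = Suc k")
    case True
    then obtain X where "frow (word_of N) = top_col N @ X" "length (top_col N) \<le> Suc k \<longrightarrow> X = []"
      using 2 by auto
    then have "over A (frow (word_of N))" using normal_over_frow 2 True by auto
    then show ?thesis using bumps_over[of A "frow (word_of N)"] 2 True by (simp add: frow_append)
  next
    case False
    then have "frow (word_of N) = top_col N" "length (top_col N) \<le> length A" using 2 by auto
    then show ?thesis using bumps_over[of A "top_col N"] 2 False by (simp add: frow_append)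
  qed
qed simp

lemma normal_emit: "normal k N \<Longrightarrow> length (top_col N) \<le> k \<Longrightarrow> emit (word_of N) = word_of (tl N)"
proof (induction k N rule: normal.induct)
  case (2 k A N)
  then have N: "frow (word_of N) = top_col N" "length (top_col N) \<le> length A" "length A \<le> k" "normal k N"
    using normal_frow[of k N] by auto
  then have "emit (word_of N) = word_of (tl N)" using 2 by simp
  then have "emit (word_of N @ A) = word_of (tl N) @ top_col N"
    using emit_append[of "word_of N" A] bumps_over[of A "top_col N"] 2 N by simp
  then show ?case by (cases N) auto
qed simp

text \<open>With no column on the diagonal left, the columns are recovered one after the other as
  first rows.\<close>

lemma normal_small_unique:
  "normal k N \<Longrightarrow> normal k M \<Longrightarrow> length (top_col N) \<le> k \<Longrightarrow> length (top_col M) \<le> k \<Longrightarrow>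
    ck_reduced (word_of N) \<Longrightarrow> word_of N \<approx> word_of M \<Longrightarrow> N = M"
proof (induction N arbitrary: M)
  case Nil
  then show ?case using word_of_eq_Nil[of k M] ck_length[of "[]" "word_of M"] by auto
next
  case (Cons A N)
  then have "M \<noteq> []" using ck_length[of "word_of (A # N)" "word_of M"] by auto
  then obtain B M' where M: "M = B # M'" by (cases M) auto
  have e: "frow (word_of (A # N)) = frow (word_of M)" "emit (word_of (A # N)) \<approx> emit (word_of M)"
    using ck_frow_emit[OF Cons.prems(6,5)] by auto
  then have "A = B" using normal_frow[OF Cons.prems(1)] normal_frow[OF Cons.prems(2)] Cons.prems M by auto
  moreover have "word_of N \<approx> word_of M'" "ck_reduced (word_of N)"
    using e(2) normal_emit[OF Cons.prems(1,3)] normal_emit[OF Cons.prems(2,4)] M ck_reduced_emit[OF Cons.prems(5)]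
    by auto
  ultimately show ?case using Cons M by (auto split: if_splits)
qed

text \<open>The rows of the insertion tableau are themselves the required columns if
  \<open>k\<close> is large enough that none of them reaches the diagonal.\<close>

lemma rows_normal:
  "ck_reduced w \<Longrightarrow> \<exists>N. w \<approx> word_of N \<and> top_col N = frow w \<and> (\<forall>k\<ge>length (frow w). normal k N)"
proof (induction "length w" arbitrary: w rule: less_induct)
  case less
  show ?case
  proof (cases "w = []")
    case True
    then show ?thesis by (intro exI[of _ "[]"]) simp
  next
    case False
    then have "length (emit w) < length w"
      using length_frow_emit[of w] frow_eq_Nil[of w] by (cases "frow w") auto
    then obtain N where N: "emit w \<approx> word_of N" "top_col N = frow (emit w)"
      "\<forall>k\<ge>length (frow (emit w)). normal k N"
      using less ck_reduced_emit by blast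
    have c: "covers (frow w) (frow (emit w))" by (rule covers_frow_emit)
    have "w \<approx> word_of (frow w # N)"
      using ck_emit_frow[OF less.prems] ck_append2[OF N(1), of "frow w"] ck_trans by auto
    moreover have "normal k (frow w # N)" if "k \<ge> length (frow w)" for k
      using that N c covers_over[OF c] covers_length[OF c] False by auto
    ultimately show ?thesis by (intro exI[of _ "frow w # N"]) simp
  qed
qed

section \<open>Two rounds of popping as an invariant, and uniqueness of the columns\<close>

context sp_words
begin

lemma peel_reduced:
  assumes "state As q" "length As < length (frow q)"
  shows "ck_reduced (peel (length As) q)"
  using good_peel[OF assms] state_red ck_reduced_prefix unfolding good_def by blast

text \<open>After one round the results need not be states, so they cannot be compared by
  \<open>lev\<close>. Put back in front of the common column they are good words, and each outcome
  of \<open>edge\<close> is realized by a chain of linked words.\<close>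

lemma peel_twice_edge:
  assumes "state As u" "swap_step (length As) u v"
  shows "length As < length (frow u)" "length As < length (frow v)"
    "next_col (length As) u = next_col (length As) v"
    "lev (next_col (length As) u # As) (peel_twice (length As) u) (peel_twice (length As) v)"
proof -
  let ?k = "length As"
  let ?A = "next_col ?k u"
  obtain p D x y where uv: "u = p @ D @ [x, y]" "v = p @ D @ swap_end x y" "length D = ?k"
    "inc (D @ [x, y])" "even y" "even x \<or> x = y - 1"
    using assms(2) unfolding swap_step_def by blast
  note e = edge[OF assms(1) uv(1-3) refl uv(4-6)]
  have stv: "state As v" using state_swap_step assms by blast
  show lu: "?k < length (frow u)" and lv: "?k < length (frow v)" and ac: "?A = next_col ?k v"
    using e by auto
  note gu = good_peel[OF assms(1) lu] and gv = good_peel[OF stv lv, folded ac]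
  note props = next_col_props[OF assms(1) lu]
  have A: "inc ?A" "length ?A = Suc ?k" "even (last ?A)" using props(1) by auto
  then obtain A0 a where A0: "?A = A0 @ [a]" by (cases ?A rule: rev_cases) auto
  note redu = peel_reduced[OF assms(1) lu]
  have "linked As ?A (peel ?k u @ ?A) (peel ?k v @ ?A)"
    using e(5)
  proof (elim disjE conjE)
    assume "peel ?k u \<approx> peel ?k v"
    then show ?thesis using linked_ck[OF gu] ck_append2 by blast
  next
    assume "edge_regular ?k (peel ?k u) (peel ?k v)"
    then obtain Y D b b' w where Y: "peel ?k u \<approx> Y @ D @ [b, b']" "peel ?k v \<approx> Y @ D @ w"
      "length D = Suc ?k" "inc (D @ [b, b'])" "w = [b', b] \<or> b = b' - 1 \<and> even b' \<and> w = [b' + 1, b']"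
      unfolding edge_regular_def by blast
    have YA: "peel ?k u @ ?A \<approx> Y @ D @ [b, b'] @ ?A" "peel ?k v @ ?A \<approx> Y @ D @ w @ ?A"
      using ck_append2[OF Y(1), of ?A] ck_append2[OF Y(2), of ?A] by simp_all
    have cu: "linked As ?A (peel ?k u @ ?A) (Y @ D @ [b, b'] @ ?A)"
      and cv: "linked As ?A (Y @ D @ w @ ?A) (peel ?k v @ ?A)"
      using linked_ck[OF gu YA(1)] linked_ck[OF good_ck[OF gv YA(2)] ck_sym[OF YA(2)]] by auto
    then have KK: "(Y @ D @ [b, b'] @ ?A) @ concat As \<in> K" "(Y @ D @ w @ ?A) @ concat As \<in> K"
      unfolding linked_def good_def state_def by auto
    obtain D0 d where D0: "D = D0 @ [d]" using Y(3) by (cases D rule: rev_cases) auto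
    have iD: "inc D" "\<forall>r\<in>set [b, b']. \<forall>a\<in>set D. a < r" using Y(4) by (auto simp: sorted_wrt_append)
    have "set D \<subseteq> set (frow (peel ?k u))"
      using frow_contains(1)[OF iD, of Y] ck_frow_emit[OF Y(1) redu] by simp
    then have ov: "weakly_over ?A D" "over A0 D"
      using weakly_over_subset[OF props(2) inc_frow iD(1)] over_subset[OF props(3) inc_frow iD(1)] A0 by auto
    \<comment> \<open>If \<open>D\<close> and the column ended in the same letter \<open>a\<close>,
      moving letters together would give \<open>a x' a\<close>. Reducedness forces
      \<open>x' = a + 1\<close>, and after a braid move \<open>parity\<close> makes
      \<open>a + 1\<close> even, although \<open>a\<close> is even.\<close>
    have "a \<noteq> d"
    proof
      assume ad: "a = d"
      obtain y' x' where w: "w = [y', x']" "x' < y'" "b \<le> x'"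
        using Y(4,5) by (auto simp: sorted_wrt_append)
      have iDx: "inc (D @ [x'])" using Y(4) w by (force simp: sorted_wrt_append)
      have "over A0 (D0 @ [a, x'])"
        using over_append[OF ov(2), of "[x']"] A A0 Y(3) D0 ad by simp
      then have "(D0 @ [a, x']) @ A0 \<approx> D0 @ A0 @ [a, x']"
        using ck_exchange[of A0 "D0 @ [a, x']"] iDx A A0 Y(3) D0 ad by (simp add: sorted_wrt_append)
      from ck_context[OF this, of "Y @ [y']" "a # concat As"]
      have 1: "Y @ y' # D @ [x'] @ ?A @ concat As \<approx> (Y @ y' # D0) @ (A0 @ [a, x', a]) @ concat As"
        using A0 D0 ad by simp
      have "Y @ D @ [y', x'] @ ?A @ concat As \<approx> Y @ y' # D @ [x'] @ ?A @ concat As"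
        using ck_context[OF ck_move_large[OF iDx w(2)], of Y "?A @ concat As"] by simp
      then have K2: "(Y @ y' # D0) @ (A0 @ [a, x', a]) @ concat As \<in> K"
        using 1 KK(2) w(1) K_ck by (metis append_assoc)
      have "inc (A0 @ a # [x'])" using iDx A A0 D0 ad by (fastforce simp: sorted_wrt_append)
      moreover have "ck_reduced (A0 @ a # [x'] @ [a])" using K_ck_reduced[OF K2] by simp
      ultimately obtain M' where "[x'] = (a + 1) # M'" by (rule bump_eq_next)
      then have x': "x' = a + 1" by simp
      have iA: "inc (A0 @ [a, a + 1])" using A A0 by (fastforce simp: sorted_wrt_append)
      have "A0 @ [a, x', a] \<approx> (a + 1) # A0 @ [a, a + 1]"
        using ck_bump_eq[of A0 a "[]"] iA x' by simp
      then have "(Y @ y' # D0) @ ((a + 1) # A0 @ [a, a + 1]) @ concat As \<in> K"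
        using K2 K_ck ck_context by blast
      then have "even (a + 1)"
        using parity[of As A0 a "a + 1" "Y @ y' # D0 @ [a + 1]"] props(1) iA A A0
          over_tl_append(3)[of ?A As "[]"] by simp
      then show False using A A0 by simp
    qed
    then have ovD: "over ?A D" using over_snoc[of A0 a D0 d] ov A A0 D0 Y(3) by simp
    have "even b'" "even b \<or> b = b' - 1" "w = swap_end b b'"
      using regular_swap_step[of ?A As Y D b b' w] props(1) KK Y ovD by auto
    then have "linked As ?A (Y @ D @ [b, b'] @ ?A) (Y @ D @ w @ ?A)"
      using linked_regular[of As ?A Y D b b'] cu props(1) ovD Y unfolding linked_def by simp
    then show ?thesis using cu cv linked_trans by blast
  next
    assume "edge_special ?k (last ?A) (peel ?k u) (peel ?k v)"
    then obtain Y D where Y: "peel ?k u \<approx> Y @ D @ [a, a + 1, a + 2]"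
      "peel ?k v \<approx> Y @ D @ [a + 1, a + 3, a + 2]" "length D = ?k" "inc (D @ [a])"
      unfolding edge_special_def A0 by auto
    have YA: "peel ?k u @ ?A \<approx> Y @ D @ [a, a + 1, a + 2] @ A0 @ [a]"
      "peel ?k v @ ?A \<approx> Y @ D @ [a + 1, a + 3, a + 2] @ A0 @ [a]"
      using ck_append2[OF Y(1), of ?A] ck_append2[OF Y(2), of ?A] A0 by simp_all
    have cu: "linked As ?A (peel ?k u @ ?A) (Y @ D @ [a, a + 1, a + 2] @ A0 @ [a])"
      and cv: "linked As ?A (Y @ D @ [a + 1, a + 3, a + 2] @ A0 @ [a]) (peel ?k v @ ?A)"
      using linked_ck[OF gu YA(1)] linked_ck[OF good_ck[OF gv YA(2)] ck_sym[OF YA(2)]] by auto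
    have iD: "inc D" "\<forall>r\<in>set [a, a + 1, a + 2]. \<forall>x\<in>set D. x < r"
      using Y(4) by (auto simp: sorted_wrt_append)
    have "set D \<subseteq> set (frow (peel ?k u))"
      using frow_contains(1)[OF iD, of Y] ck_frow_emit[OF Y(1) redu] by simp
    then have "over A0 D"
      using over_subset[OF props(3) inc_frow iD(1)] A0 by auto
    then have "linked As ?A (Y @ D @ [a, a + 1, a + 2] @ A0 @ [a]) (Y @ D @ [a + 1, a + 3, a + 2] @ A0 @ [a])"
      using linked_special[of As A0 a Y D] cu props(1) Y A0 unfolding linked_def by simp
    then show ?thesis using cu cv linked_trans by blast
  qed
  then show "lev (?A # As) (peel_twice ?k u) (peel_twice ?k v)" using ac by (simp add: linked_def peel_twice_def)
qed

lemma peel_twice_ck: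
  assumes "state As u" "u \<approx> v" "length As < length (frow u)"
  shows "lev (next_col (length As) u # As) (peel_twice (length As) u) (peel_twice (length As) v)"
proof -
  let ?k = "length As"
  have "peel ?k u @ next_col ?k u \<approx> peel ?k v @ next_col ?k v"
    using peel_ck[OF assms(1,2), of ?k] ck_append2 by simp
  from linked_ck[OF good_peel[OF assms(1,3)] this] show ?thesis by (simp add: linked_def peel_twice_def)
qed

text \<open>A swap step is possible only if more than \<open>length As\<close> entries stand in the
  first row; otherwise the class is a plain Coxeter--Knuth class.\<close>

lemma lev_peel_twice:
  assumes "lev As u v"
  shows "(length As < length (frow u) \<longleftrightarrow> length As < length (frow v)) \<and>
    (length As < length (frow u) \<longrightarrow> next_col (length As) u = next_col (length As) v \<and>
       lev (next_col (length As) u # As) (peel_twice (length As) u) (peel_twice (length As) v)) \<and>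
    (\<not> length As < length (frow u) \<longrightarrow> u \<approx> v)"
    (is "?P u v")
proof -
  have sym: "?P y x" if "?P x y" for x y using that lev_sym ck_sym by auto
  have tr: "?P x z" if "?P x y" "?P y z" for x y z
    using that by (auto intro: lev_trans ck_trans)
  have one: "?P x y" if "(x \<approx> y \<or> swap_step (length As) x y) \<and> state As x \<and> state As y" for x y
  proof (cases "x \<approx> y")
    case True
    then show ?thesis
      using that peel_twice_ck[of As x y] peel_ck(2)[of As x y] ck_frow_emit[OF True] state_red by auto
  next
    case False
    then show ?thesis using that peel_twice_edge[of As x y] by auto
  qed
  show ?thesis using assms unfolding lev_def
  proof (induction rule: equivclp_induct)
    case base
    show ?case by simp
  next
    case (step y z)
    have "?P y z" using step(2) one sym by blast
    then show ?case using tr step(3) unfolding lev_def by blast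
  qed
qed

text \<open>Appending an admissible column and popping it are inverse to each other. Popping
  \<open>q @ A\<close> pops everything behind the first \<open>k + 1\<close> entries, since
  \<open>last A\<close> is what remains; popping \<open>q\<close> one level up keeps
  \<open>hd P\<close>, and \<open>ck_move_many\<close> reconciles the two words.\<close>

lemma peel_formula:
  assumes "state (A # As) q"
  shows "good As A (q @ A)" "lev (A # As) (peel (length As) (q @ A)) q"
proof -
  let ?k = "length As"
  define F where "F = frow q"
  have A: "stacked (A # As)" "over A F" "(q @ A) @ concat As \<in> K"
    using assms by (auto simp: state_def F_def)
  then have lA: "length A = Suc ?k" "inc A" "even (last A)" by auto
  have fu: "frow (q @ A) = A @ drop (Suc ?k) F" "emit (q @ A) = emit q @ take (Suc ?k) F"
    using bumps_over[OF lA(2) A(2)] lA by (simp_all add: frow_append emit_append F_def)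
  have "over (top_col As) (A @ drop (Suc ?k) F)"
    using over_append[of "top_col As" A] A(1) length_top_col[of As] by auto
  then show "good As A (q @ A)" using A lA fu by (auto simp: good_def state_def)
  obtain A0 c where A0: "A = A0 @ [c]" using lA by (cases A rule: rev_cases) auto
  define P where "P = promote (drop (Suc ?k) F)"
  have w: "peel ?k (q @ A) = emit q @ take (Suc ?k) F @ rev P"
    using fu lA A0 by (simp add: peel_def P_def)
  have q: "q \<approx> emit q @ F" using ck_emit_frow state_red assms by (auto simp: F_def)
  show "lev (A # As) (peel ?k (q @ A)) q"
  proof (cases "length F \<le> Suc ?k")
    case True
    then have "peel ?k (q @ A) = emit q @ F" using w by (simp add: P_def)
    then show ?thesis using lev_ck[OF assms q] lev_sym by simp
  next
    case False
    have F: "inc F" by (simp add: F_def)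
    have "state (A # As) (emit q @ F)" using state_ck[OF assms q] .
    from pop[OF this F _ refl]
    have pp: "paired (drop (Suc ?k) F)"
      "lev (A # As) (emit q @ F) (emit q @ rev (tl P) @ take (Suc ?k) F @ [hd P])"
      using False lA by (auto simp: P_def)
    obtain t R where t: "drop (Suc ?k) F = t # R" using False by (cases "drop (Suc ?k) F") auto
    have "inc (promote (drop (Suc ?k) F))" by (rule inc_promote[OF pp(1) sorted_wrt_drop[OF F]])
    then have P: "P \<noteq> []" "t \<le> hd P" "inc P"
      using t by (simp_all add: P_def)
    then have "inc (hd P # tl P)" by simp
    have "inc (take (Suc ?k) F @ t # R)" using t F by (metis append_take_drop_id)
    then have "inc (take (Suc ?k) F @ [hd P])" using P by (force simp: sorted_wrt_append)
    from ck_append1[OF ck_move_many[OF this, of "tl P"], of "emit q"]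
    have "emit q @ take (Suc ?k) F @ rev (tl P) @ [hd P] \<approx> emit q @ rev (tl P) @ take (Suc ?k) F @ [hd P]"
      using \<open>inc (hd P # tl P)\<close> by simp
    moreover have "rev (tl P) @ [hd P] = rev P" using P by (cases P) auto
    ultimately have "peel ?k (q @ A) \<approx> emit q @ rev (tl P) @ take (Suc ?k) F @ [hd P]"
      using w by simp
    then show ?thesis
      using pp(2) lev_ck[OF assms q] lev_ck good_props(3)[OF \<open>good As A (q @ A)\<close>] lev_sym lev_trans by blast
  qed
qed

lemma peel_twice_formula:
  assumes "state (A # As) q"
  shows "length As < length (frow (q @ A))" "next_col (length As) (q @ A) = A"
    "lev (A # As) (peel_twice (length As) (q @ A)) q"
proof -
  note w = peel_formula[OF assms]
  show "length As < length (frow (q @ A))" and ac: "next_col (length As) (q @ A) = A"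
    using good_props[OF w(1)] by auto
  have "lev (A # As) (peel_twice (length As) (q @ A)) (peel (length As) (q @ A))"
    using peel_formula(2)[OF good_props(3)[OF w(1)]] ac by (simp add: peel_twice_def)
  then show "lev (A # As) (peel_twice (length As) (q @ A)) q" using w(2) lev_trans by blast
qed

lemma normal_state:
  assumes "normal (length As) (A # N)" "length A = Suc (length As)" "state As (word_of (A # N))"
  shows "state (A # As) (word_of N)"
proof -
  have A: "inc A" "over A (top_col N)" "normal (Suc (length As)) N" using assms by auto
  have "over (top_col As) A" using state_over_suffix[of As "word_of N" A "[]"] assms A by simp
  moreover from this have "even (last A)"
    using even_last[of As A "word_of N"] assms A unfolding state_def by simp
  moreover have "over A (frow (word_of N))"
    using normal_frow[OF A(3)] normal_over_frow A assms(2) by blast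
  ultimately show ?thesis using assms A unfolding state_def by simp
qed

text \<open>A first column of height \<open>k + 1\<close> is the invariant \<open>next_col\<close>,
  and \<open>peel_twice\<close> yields the class of the remaining columns. A shorter one means that
  the diagonal has ended, and \<open>normal_small_unique\<close> applies.\<close>

lemma normal_unique:
  "normal (length As) N \<Longrightarrow> normal (length As) M \<Longrightarrow> state As (word_of N) \<Longrightarrow> lev As (word_of N) (word_of M) \<Longrightarrow> N = M"
proof (induction N arbitrary: As M)
  case Nil
  then show ?case using lev_length[of As "[]" "word_of M"] word_of_eq_Nil by auto
next
  case (Cons A N)
  let ?k = "length As"
  have "M \<noteq> []" using lev_length[OF Cons.prems(4)] Cons.prems(1) by auto
  then obtain B M' where M: "M = B # M'" by (cases M) auto
  have stM: "state As (word_of M)" using lev_state Cons.prems by blast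
  note l = lev_peel_twice[OF Cons.prems(4)]
  have big: "?k < length (frow (word_of L)) \<longleftrightarrow> length (top_col L) = Suc ?k" if nL: "normal ?k L" for L
  proof -
    obtain X where "frow (word_of L) = top_col L @ X" "length (top_col L) \<le> ?k \<longrightarrow> X = []"
      using normal_frow[OF nL] by blast
    then show ?thesis using length_top_normal[OF nL] by auto
  qed
  show ?case
  proof (cases "length A = Suc ?k")
    case True
    then have B: "length B = Suc ?k" using l big[OF Cons.prems(1)] big[OF Cons.prems(2)] M by auto
    have s: "state (A # As) (word_of N)" "state (B # As) (word_of M')"
      using normal_state Cons.prems stM True B M by auto
    note fA = peel_twice_formula[OF s(1)] and fB = peel_twice_formula[OF s(2)]
    have AB: "A = B" "lev (A # As) (peel_twice ?k (word_of N @ A)) (peel_twice ?k (word_of M' @ B))"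
      using l fA fB M by auto
    then have "lev (A # As) (word_of N) (word_of M')" using fA(3) fB(3) lev_sym lev_trans by metis
    then have "N = M'" using Cons.IH[of "A # As" M'] s Cons.prems True B AB M by auto
    then show ?thesis using AB M by simp
  next
    case False
    then have "length (top_col (A # N)) \<le> ?k" "length (top_col M) \<le> ?k"
      using l big[OF Cons.prems(1)] big[OF Cons.prems(2)] length_top_normal Cons.prems by fastforce+
    moreover have "word_of (A # N) \<approx> word_of M" using l big[OF Cons.prems(1)] False by simp
    ultimately show ?thesis using normal_small_unique Cons.prems state_red by blast
  qed
qed

lemma normal_exists: "state As q \<Longrightarrow> \<exists>N. normal (length As) N \<and> state As (word_of N) \<and> length (word_of N) = length q"
proof (induction "length q" arbitrary: As q rule: less_induct)
  case less
  let ?k = "length As"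
  show ?case
  proof (cases "?k < length (frow q)")
    case True
    let ?A = "next_col ?k q"
    have g: "good As ?A (peel ?k q @ ?A)" using good_peel less.prems True by blast
    note p = good_props[OF g]
    have A: "length ?A = Suc ?k" using g by (simp add: good_def)
    have "lev As q (peel ?k q @ ?A)" using peel_lev(2)[OF less.prems True] .
    moreover have "lev As (peel ?k q @ ?A) (peel_twice ?k q @ ?A)"
      using peel_lev(2)[of As "peel ?k q @ ?A"] g p by (simp add: good_def peel_twice_def)
    ultimately have len: "length q = length (peel_twice ?k q) + length ?A" using lev_length by fastforce
    have "state (?A # As) (peel_twice ?k q)" using p by (simp add: peel_twice_def)
    then obtain N where N: "normal (Suc ?k) N" "state (?A # As) (word_of N)" "length (word_of N) = length (peel_twice ?k q)"
      using less.hyps[of "peel_twice ?k q" "?A # As"] len A by auto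
    have "over ?A (top_col N)"
    proof -
      have "set (top_col N) \<subseteq> set (frow (word_of N))" using normal_frow[OF N(1)] by auto
      then show ?thesis using over_subset[of ?A "frow (word_of N)" "top_col N"] N inc_top_normal
        unfolding state_def by auto
    qed
    moreover have "inc ?A" using N(2) unfolding state_def by simp
    ultimately have "normal ?k (?A # N)" using N A by auto
    moreover have "state As (word_of (?A # N))" using peel_formula(1)[OF N(2)] by (simp add: good_def)
    ultimately show ?thesis using N(3) len by (intro exI[of _ "?A # N"]) simp
  next
    case False
    obtain N where "q \<approx> word_of N" "\<forall>k\<ge>length (frow q). normal k N"
      using rows_normal state_red less.prems by blast
    then show ?thesis using False state_ck[OF less.prems] ck_length by (intro exI[of _ N]) auto
  qed
qed

end

subsection \<open>Cells in the first rows and columns\<close>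

text \<open>\<open>cells r t w\<close> counts the cells of the Edelman--Greene tableau of \<open>w\<close> that lie in the first
  \<open>r\<close> rows or in the first \<open>t\<close> columns.\<close>

function cells :: "nat \<Rightarrow> nat \<Rightarrow> int list \<Rightarrow> nat" where
  "cells r t w = (if w = [] then 0
     else (if 0 < r then length (frow w) else min (length (frow w)) t) + cells (r - 1) t (emit w))"
  by auto

lemma length_emit_less: "w \<noteq> [] \<Longrightarrow> length (emit w) < length w"
  using length_frow_emit[of w] frow_eq_Nil[of w] by (cases "frow w") auto

termination
  by (relation "measure (\<lambda>(r, t, w). length w)") (auto simp: length_emit_less)

declare cells.simps [simp del]

lemma cells_Nil [simp]: "cells r t [] = 0"
  by (simp add: cells.simps)

lemma cells_step:
  "cells r t w = (if 0 < r then length (frow w) else min (length (frow w)) t) + cells (r - 1) t (emit w)"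
  by (cases "w = []") (auto simp: cells.simps[of r t w])

lemma cells_ck: "u \<approx> v \<Longrightarrow> ck_reduced u \<Longrightarrow> cells r t u = cells r t v"
proof (induction "length u" arbitrary: r u v rule: less_induct)
  case less
  note e = ck_frow_emit[OF less.prems]
  show ?case
  proof (cases "u = []")
    case True
    then show ?thesis using ck_length[OF less.prems(1)] by simp
  next
    case False
    then have "cells (r - 1) t (emit u) = cells (r - 1) t (emit v)"
      using less e length_emit_less ck_reduced_emit by blast
    then show ?thesis using e cells_step[of r t u] cells_step[of r t v] by simp
  qed
qed

lemma length_bumps_ge: "length S \<le> length (fst (bumps S w))"
proof (induction w arbitrary: S)
  case (Cons x w)
  then show ?case using length_bump_ge[of S x] le_trans by fastforce
qed simp

lemma cells_mono: "cells r t e \<le> cells r t (e @ v)"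
proof (induction "length e" arbitrary: r e v rule: less_induct)
  case less
  show ?case
  proof (cases "e = []")
    case False
    have "cells (r - 1) t (emit e) \<le> cells (r - 1) t (emit (e @ v))"
      using less length_emit_less[OF False] by (simp add: emit_append)
    moreover have "length (frow e) \<le> length (frow (e @ v))"
      by (simp add: frow_append length_bumps_ge)
    ultimately show ?thesis using cells_step[of r t e] cells_step[of r t "e @ v"] by auto
  qed simp
qed

lemma bumps_dec_aux:
  "inc S \<Longrightarrow> inc (rev E) \<Longrightarrow> w \<in> set S \<Longrightarrow> \<forall>e\<in>set E. e < w \<Longrightarrow>
    length (fst (bumps S E)) = length S \<and> inc (rev (snd (bumps S E))) \<and> (\<forall>b\<in>set (snd (bumps S E)). b \<le> w)"
proof (induction E arbitrary: S w)
  case (Cons x E)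
  obtain S1 b where b: "bump S x = (S1, [b])" "b \<le> w" "x < b"
    using bump_out_le[of S w x] Cons.prems by (metis list.set_intros(1) prod.exhaust_sel)
  have S1: "inc S1" "x \<in> set S1" "length S1 = length S"
    using inc_bump[of S x] bump_mem[of x S] length_bump[of S x] Cons.prems b by auto
  have E: "inc (rev E)" "\<forall>e\<in>set E. e < x" using Cons.prems by (auto simp: sorted_wrt_append)
  show ?case using Cons.IH[OF S1(1) E(1) S1(2) E(2)] b S1 by (fastforce simp: sorted_wrt_append)
qed simp

lemma bumps_dec:
  assumes "inc S" "inc X"
  shows "length (fst (bumps S (rev X))) \<le> Suc (length S)" "inc (rev (snd (bumps S (rev X))))"
proof -
  have "length (fst (bumps S (rev X))) \<le> Suc (length S) \<and> inc (rev (snd (bumps S (rev X))))"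
  proof (cases X rule: rev_cases)
    case (snoc Y x)
    define S1 where "S1 = fst (bump S x)"
    have S1: "inc S1" "x \<in> set S1" "length S1 \<le> Suc (length S)"
      using inc_bump[OF assms(1), of x] length_bump[of S x] by (auto simp: S1_def)
    have Y: "inc (rev (rev Y))" "\<forall>e\<in>set (rev Y). e < x" using assms snoc by (auto simp: sorted_wrt_append)
    note a = bumps_dec_aux[OF S1(1) Y(1) S1(2) Y(2)]
    have "\<forall>b\<in>set (snd (bump S x)). x < b"
      using bump_out_cases[of S x] bump_out_gt[OF assms(1), of x S1] by (auto simp: S1_def prod_eq_iff)
    then show ?thesis
      using a S1 bump_out_cases[of S x] snoc by (fastforce simp: sorted_wrt_append S1_def)
  qed simp
  then show "length (fst (bumps S (rev X))) \<le> Suc (length S)" "inc (rev (snd (bumps S (rev X))))"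
    by auto
qed

text \<open>Inserting a decreasing word adds a vertical strip.\<close>

lemma cells_strip: "inc X \<Longrightarrow> length X + cells r t e \<le> cells r (Suc t) (e @ rev X)"
proof (induction "length (e @ rev X)" arbitrary: r e X rule: less_induct)
  case less
  show ?case
  proof (cases "e @ rev X = []")
    case False
    define S where "S = frow e"
    define S' where "S' = fst (bumps S (rev X))"
    define X2 where "X2 = rev (snd (bumps S (rev X)))"
    have f: "frow (e @ rev X) = S'" "emit (e @ rev X) = emit e @ rev X2"
      by (simp_all add: S_def S'_def X2_def frow_append emit_append)
    have p: "length S' \<le> Suc (length S)" "inc X2" "length S \<le> length S'"
      "length S' + length X2 = length S + length X"
      using bumps_dec[of S X] less.prems length_bumps_ge[of S "rev X"] length_bumps[of S "rev X"]
      by (auto simp: S_def S'_def X2_def)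
    have "length X2 + cells (r - 1) t (emit e) \<le> cells (r - 1) (Suc t) (emit e @ rev X2)"
      using less.hyps[of "emit e" X2] p(2) length_emit_less[OF False] f by simp
    then show ?thesis
      using p cells_step[of r t e] cells_step[of r "Suc t" "e @ rev X"] f by (auto simp: S_def)
  qed simp
qed

lemma bumps_blocks:
  "inc S \<Longrightarrow> \<forall>B\<in>set Bs. inc B \<Longrightarrow>
    \<exists>Os. snd (bumps S (concat Bs)) = concat Os \<and> length Os = length Bs \<and> (\<forall>B\<in>set Os. inc B)"
proof (induction Bs arbitrary: S)
  case (Cons B Bs)
  then obtain Os where "snd (bumps (fst (bumps S B)) (concat Bs)) = concat Os" "length Os = length Bs"
    "\<forall>B\<in>set Os. inc B"
    using inc_bumps by (metis list.set_intros(2))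
  then show ?case
    using bumps_inc_out[of S B] Cons.prems
    by (intro exI[of _ "snd (bumps S B) # Os"]) (simp add: bumps_append)
qed simp

text \<open>The first row uses up one block, and the word passed on to the next row is a
  concatenation of one block fewer. So \<open>J\<close> increasing blocks fill at most
  \<open>J\<close> rows, in the spirit of Greene's theorem.\<close>

lemma cells_blocks:
  "\<forall>B\<in>set Bs. inc B \<Longrightarrow> length Bs \<le> J \<Longrightarrow> length (concat Bs) \<le> cells J 0 (concat Bs @ w)"
proof (induction J arbitrary: Bs w)
  case (Suc J)
  show ?case
  proof (cases Bs)
    case (Cons B Bs')
    define C where "C = concat Bs"
    have "bumps [] B = (B, [])" using bumps_over[of B "[]"] Suc.prems Cons by simp
    then have "emit C = snd (bumps B (concat Bs'))"
      using Cons by (simp add: emit_def C_def bumps_append)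
    then obtain Os where Os: "emit C = concat Os" "length Os = length Bs'" "\<forall>B\<in>set Os. inc B"
      using bumps_blocks[of B Bs'] Suc.prems Cons by auto
    have "length (concat Os) \<le> cells J 0 (emit (C @ w))"
      using Suc.IH[of Os] Os Suc.prems Cons by (simp add: emit_append)
    moreover have "length (frow C) \<le> length (frow (C @ w))"
      by (simp add: frow_append length_bumps_ge)
    ultimately show ?thesis
      using length_frow_emit[of C] Os cells_step[of "Suc J" 0 "C @ w"] by (simp add: C_def)
  qed simp
qed simp

text \<open>The emitted letter is \<open>f\<close>, or \<open>f + 1\<close> when
  \<open>a = f\<close>; a strict inequality between \<open>f\<close> and the entry of
  \<open>G\<close> below it leaves a weak one.\<close>

lemma bumps_weakly_over_all:
  "inc A \<Longrightarrow> weakly_over A F \<Longrightarrow> length A \<le> length F \<Longrightarrow>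
    fst (bumps F A) = A @ drop (length A) F \<and> length (snd (bumps F A)) = length A \<and>
    (\<forall>G. over F G \<longrightarrow> weakly_over (snd (bumps F A)) G)"
proof (induction A F rule: weakly_over.induct)
  case (1 a A f F)
  then have IH: "fst (bumps F A) = A @ drop (length A) F" "length (snd (bumps F A)) = length A"
    "\<And>G. over F G \<Longrightarrow> weakly_over (snd (bumps F A)) G" by auto
  have "bumps (f # F) (a # A) = (a # fst (bumps F A), (if a < f then f else a + 1) # snd (bumps F A))"
    using bumps_prefix[of "[a]" A F] 1 by auto
  moreover have "weakly_over ((if a < f then f else a + 1) # snd (bumps F A)) G" if "over (f # F) G" for G
    using that IH(3) 1 by (cases G) auto
  ultimately show ?case using IH by auto
qed auto

lemma weakly_over_take1: "weakly_over A F \<Longrightarrow> weakly_over (take n A) F"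
  by (induction A F arbitrary: n rule: weakly_over.induct) (auto simp: take_Cons split: nat.split)

lemma weakly_over_snoc:
  "weakly_over A F \<Longrightarrow> length A = length F \<Longrightarrow> a \<le> f \<Longrightarrow> weakly_over (A @ [a]) (F @ f # G)"
  by (induction A F rule: weakly_over.induct) auto

text \<open>An equality propagates to the right: if \<open>a = f\<close>, reducedness makes the next
  entry of \<open>F\<close> equal to \<open>a + 1\<close>, and the next entry of \<open>A\<close>
  exceeds \<open>a\<close>, so it cannot be smaller. Hence it suffices to exclude equality in the
  last position.\<close>

lemma over_if_last_strict:
  "inc A \<Longrightarrow> inc F \<Longrightarrow> weakly_over A F \<Longrightarrow> ck_reduced (F @ A) \<Longrightarrow>
    (A \<noteq> [] \<and> length A \<le> length F \<longrightarrow> last A \<noteq> F ! (length A - 1)) \<Longrightarrow> over A F"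
proof (induction A F rule: weakly_over.induct)
  case (1 a A f F)
  have step: "(f # F) @ a # A \<approx> snd (bump (f # F) a) @ a # F @ A"
  proof -
    have "ck_reduced ((f # F) @ [a])" using 1 ck_reduced_prefix[of "(f # F) @ [a]" A] by simp
    from ck_append2[OF ck_bump[OF _ this], of A] show ?thesis using 1 by auto
  qed
  have "ck_reduced (snd (bump (f # F) a) @ a # F @ A)" using step 1 ck_reduced_ck by blast
  then have "ck_reduced (F @ A)" using ck_reduced_Cons ck_reduced_suffix by blast
  then have ov: "over A F"
    using 1 by (auto split: if_splits simp: nth_Cons')
  have "a \<noteq> f"
  proof
    assume af: "a = f"
    have "ck_reduced ([] @ a # F @ [a])" using 1(5) af ck_reduced_prefix[of "(f # F) @ [a]" A] by simp
    then obtain F' where F: "F = (a + 1) # F'" using bump_eq_next[of "[]" a F] 1 af by auto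
    show False
    proof (cases A)
      case Nil
      then show ?thesis using 1 af by simp
    next
      case (Cons a' A')
      then show ?thesis using ov F 1 by auto
    qed
  qed
  then show ?case using 1 ov by simp
qed auto

section \<open>Bounding the cell count by the columns of the increasing tableau\<close>

context sp_words
begin

lemma normal_split:
  assumes "state As q" "normal (length As) N" "lev As q (word_of N)" "length As < length (frow q)"
  obtains N' where "N = next_col (length As) q # N'" "normal (Suc (length As)) N'"
    "lev (next_col (length As) q # As) (peel_twice (length As) q) (word_of N')" "length (next_col (length As) q) = Suc (length As)"
proof -
  let ?k = "length As"
  note l = lev_peel_twice[OF assms(3)]
  obtain A N' where N: "N = A # N'" using l assms(4) by (cases N) auto
  obtain X where "frow (word_of N) = top_col N @ X" "length (top_col N) \<le> ?k \<longrightarrow> X = []"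
    using normal_frow[OF assms(2)] by blast
  then have A: "length A = Suc ?k" using l assms(2,4) N length_top_normal[OF assms(2)] by auto
  have "state As (word_of N)" using lev_state assms by blast
  then have "state (A # As) (word_of N')" using normal_state assms(2) A N by blast
  note f = peel_twice_formula[OF this]
  have "next_col ?k q = A" using l f assms(4) N by simp
  then show ?thesis
    using that[of N'] l f(3) assms(2,4) N A lev_trans by auto
qed

text \<open>Here the rows of the insertion tableau are exactly the columns in \<open>N\<close>, of
  length at most \<open>k\<close>; for \<open>k < J\<close> counting a whole row therefore counts no
  more than \<open>min (length A) J\<close>.\<close>

lemma cells_small:
  "normal k N \<Longrightarrow> length (top_col N) \<le> k \<Longrightarrow> r = 0 \<or> k < J \<Longrightarrow>
    cells r (min k J) (word_of N) \<le> (\<Sum>A\<leftarrow>N. min (length A) J)"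
proof (induction N arbitrary: r)
  case (Cons A N)
  have f: "frow (word_of (A # N)) = A" "emit (word_of (A # N)) = word_of N" "normal k N" "length (top_col N) \<le> k"
    using normal_frow[OF Cons.prems(1)] normal_emit[OF Cons.prems(1,2)] Cons.prems by auto
  have "cells (r - 1) (min k J) (word_of N) \<le> (\<Sum>A\<leftarrow>N. min (length A) J)"
    using Cons.IH[OF f(3,4), of "r - 1"] Cons.prems(3) by auto
  then show ?case
    using cells_step[of r "min k J" "word_of (A # N)"] f Cons.prems by auto
qed simp

text \<open>Passing from level \<open>k\<close> to \<open>k + 1\<close> drops the number of counted
  rows by one and raises the number of counted columns by one, up to \<open>J\<close>. The second
  statement treats the word after a first round, which may fail to be a state. The first needs the
  second for a shorter word; the second needs the first for a word of the same length or itself for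
  a shorter one.\<close>

lemma cells_bound:
  "(\<forall>As q N. length q = n \<longrightarrow> state As q \<longrightarrow> normal (length As) N \<longrightarrow> lev As q (word_of N) \<longrightarrow>
      cells (J - length As) (min (length As) J) q \<le> (\<Sum>A\<leftarrow>N. min (length A) J)) \<and>
   (\<forall>A As W N. length W = n \<longrightarrow> good As A (W @ A) \<longrightarrow> weakly_over A (frow W) \<longrightarrow> normal (Suc (length As)) N \<longrightarrow>
      lev (A # As) (peel (length As) (W @ A)) (word_of N) \<longrightarrow>
      cells (J - Suc (length As)) (min (Suc (length As)) J) W \<le> (\<Sum>A\<leftarrow>N. min (length A) J))"
proof (induction n rule: less_induct)
  case (less n)
  have IH: "cells (J - Suc (length As)) (min (Suc (length As)) J) W \<le> (\<Sum>A\<leftarrow>N. min (length A) J)"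
    if "length W < n" "good As A (W @ A)" "weakly_over A (frow W)" "normal (Suc (length As)) N"
      "lev (A # As) (peel (length As) (W @ A)) (word_of N)" for A As W N
    using less.IH that by blast
  have compat: "cells (J - length As) (min (length As) J) q \<le> (\<Sum>A\<leftarrow>N. min (length A) J)"
    if q: "length q = n" "state As q" "normal (length As) N" "lev As q (word_of N)" for As q N
  proof (cases "length As < length (frow q)")
    case False
    let ?k = "length As"
    have l: "q \<approx> word_of N" "length (frow (word_of N)) \<le> ?k" using lev_peel_twice[OF q(4)] False by auto
    obtain X where "frow (word_of N) = top_col N @ X" using normal_frow[OF q(3)] by blast
    then have "length (top_col N) \<le> ?k" using l by simp
    then have "cells (J - ?k) (min ?k J) (word_of N) \<le> (\<Sum>A\<leftarrow>N. min (length A) J)"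
      by (intro cells_small[OF q(3)]) auto
    then show ?thesis using cells_ck[OF l(1) state_red[OF q(2)]] by simp
  next
    case True
    let ?k = "length As"
    let ?A = "next_col ?k q"
    let ?W = "peel ?k q"
    obtain N' where N: "N = ?A # N'" "normal (Suc ?k) N'" "lev (?A # As) (peel_twice ?k q) (word_of N')" "length ?A = Suc ?k"
      using normal_split[OF q(2-4) True] by blast
    have len: "length q = length ?W + Suc ?k" using lev_length[OF peel_lev(2)[OF q(2) True]] N(4) by simp
    have I: "cells (J - Suc ?k) (min (Suc ?k) J) ?W \<le> (\<Sum>A\<leftarrow>N'. min (length A) J)"
      using IH[of ?W As ?A N'] len q(1) good_peel[OF q(2) True] next_col_props(2)[OF q(2) True] N
      by (simp add: peel_twice_def)
    define X where "X = tl (promote (drop ?k (frow q)))"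
    have W: "?W = emit q @ rev X" by (simp add: peel_def X_def)
    have pr: "paired (drop ?k (frow q))" by (rule peel_lev(1)[OF q(2) True])
    have ip: "inc (promote (drop ?k (frow q)))" by (rule inc_promote[OF pr sorted_wrt_drop[OF inc_frow]])
    then have X: "inc X" "length (frow q) = Suc ?k + length X"
      using length_promote[OF pr] True by (cases "promote (drop ?k (frow q))"; force simp: X_def)+
    show ?thesis
    proof (cases "?k < J")
      case J: True
      \<comment> \<open>The first row has \<open>k + 1\<close> cells for the new column and
        \<open>length X\<close> popped ones; the latter reappear as the vertical strip and are
        recovered by the additional counted column.\<close>
      have "length X + cells (J - Suc ?k) ?k (emit q) \<le> cells (J - Suc ?k) (Suc ?k) ?W"
        unfolding W by (rule cells_strip[OF X(1)])
      then show ?thesis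
        using I J X(2) N(1,4) cells_step[of "J - ?k" "min ?k J" q] by (simp add: min_absorb1)
    next
      case J: False
      have "cells 0 J (emit q) \<le> cells 0 J ?W" unfolding W by (rule cells_mono)
      then show ?thesis
        using I J X(2) N(1,4) cells_step[of "J - ?k" "min ?k J" q] by (simp add: min_absorb2)
    qed
  qed
  have "cells (J - Suc (length As)) (min (Suc (length As)) J) W \<le> (\<Sum>A\<leftarrow>N. min (length A) J)"
    if W: "length W = n" "good As A (W @ A)" "weakly_over A (frow W)" "normal (Suc (length As)) N"
      "lev (A # As) (peel (length As) (W @ A)) (word_of N)" for A As W N
  proof -
    let ?k = "length As"
    define F where "F = frow W"
    note g = good_props[OF W(2)]
    have A: "length A = Suc ?k" "even (last A)" "inc A" "stacked (A # As)" "state As (W @ A)"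
      using W(2) g(3) by (auto simp: good_def state_def)
    have F: "inc F" by (simp add: F_def)
    have red: "ck_reduced (F @ A)"
      using ck_reduced_frow_append[of W A] state_red[OF A(5)] by (simp add: F_def)
    show ?thesis
    proof (cases "over A F")
      case True
      then have "state (A # As) W" using A by (auto simp: state_def F_def)
      moreover from this have "lev (A # As) W (word_of N)"
        using W(5) peel_formula(2) lev_sym lev_trans by blast
      ultimately show ?thesis using compat[of W "A # As" N] W(1,4) by simp
    next
      case False
      define l where "l = last A"
      obtain A0 where A0: "A = A0 @ [l]" "length A0 = ?k"
        using A(1) by (cases A rule: rev_cases) (auto simp: l_def)
      \<comment> \<open>The comparison fails to be strict, so it fails in the last entry of
        \<open>A\<close>.\<close>
      have "length A \<le> length F" "l = F ! ?k"
        using over_if_last_strict[OF A(3) F _ red] W(3) False A(1) by (auto simp: F_def l_def)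
      note all = bumps_weakly_over_all[OF A(3) W(3)[folded F_def] this(1)]
      define E where "E = snd (bumps F A)"
      have E: "length E = Suc ?k" using all A by (simp add: E_def)
      have Fk: "F = take ?k F @ l # drop (Suc ?k) F"
        using \<open>length A \<le> length F\<close> \<open>l = F ! ?k\<close> A(1) by (simp add: id_take_nth_drop)
      have w0: "weakly_over A0 F" "length A0 \<le> length F" "inc A0"
        using W(3) A0 A \<open>length A \<le> length F\<close> weakly_over_take1[of A F ?k]
        by (auto simp: F_def sorted_wrt_append)
      have b0: "fst (bumps F A0) = A0 @ l # drop (Suc ?k) F"
        using bumps_weakly_over_all[OF w0(3,1,2)] Fk A0 A(1) \<open>length A \<le> length F\<close> \<open>l = F ! ?k\<close>
        by (simp add: Cons_nth_drop_Suc)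
      have "F @ A0 \<approx> snd (bumps F A0) @ fst (bumps F A0)" "inc (fst (bumps F A0))"
        using ck_bumps[OF F] red A0 ck_reduced_prefix[of "F @ A0" "[l]"] by auto
      then have h: "F @ A \<approx> snd (bumps F A0) @ (A0 @ l # drop (Suc ?k) F) @ [l]"
        "inc (A0 @ l # drop (Suc ?k) F)"
        using ck_append2[of "F @ A0" "snd (bumps F A0) @ fst (bumps F A0)" "[l]"] b0 A0 by auto
      have "ck_reduced (A0 @ l # drop (Suc ?k) F @ [l])"
        using ck_reduced_suffix[OF ck_reduced_ck[OF red h(1)]] by simp
      with h(2) obtain G2 where G2: "drop (Suc ?k) F = (l + 1) # G2" by (rule bump_eq_next)
      have fw: "frow (W @ A) = A @ (l + 1) # G2" "emit (W @ A) = emit W @ E"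
        using all A G2 by (auto simp: frow_append emit_append F_def E_def)
      then have dr: "drop ?k (frow (W @ A)) = l # (l + 1) # G2" using A0 by simp
      \<comment> \<open>As \<open>l\<close> is even, \<open>l + 1\<close> is the first half of a
        pair, so \<open>l + 2\<close> follows; it becomes the letter that the next column ends
        in.\<close>
      have "paired (l # (l + 1) # G2)" using peel_lev(1)[OF A(5) g(1)] dr by simp
      then obtain G3 where G3: "G2 = (l + 2) # G3" "paired G3"
        using A(2) by (cases G2) (auto simp: l_def)
      define X where "X = (l + 3) # promote G3"
      have wf: "peel ?k (W @ A) = emit W @ E @ rev X @ [l + 2]"
        using fw dr A(2) G3 by (simp add: peel_def X_def l_def)
      have iG: "inc ((l + 1) # (l + 2) # G3)"
        using sorted_wrt_drop[OF F, of "Suc ?k"] G2 G3 by simp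
      have "inc (promote (l # (l + 1) # (l + 2) # G3))"
        using iG G3 A(2) by (intro inc_promote) (auto simp: l_def)
      then have iX: "inc X" "\<forall>x\<in>set X. l + 2 < x" using A(2) G3 by (auto simp: X_def l_def)
      have Al: "inc (A @ [l + 1])" using A(3) A0 by (fastforce simp: sorted_wrt_append)
      have wA1: "weakly_over (A @ [l + 1]) F" "length (A @ [l + 1]) \<le> length F"
      proof -
        have "weakly_over (A @ [l + 1]) (take (length A) F @ (l + 1) # G2)"
          using weakly_over_snoc[of A "take (length A) F" "l + 1" "l + 1" G2] W(3)
            weakly_over_take[of A "length A" F] \<open>length A \<le> length F\<close> by (simp add: F_def)
        moreover have "take (length A) F @ (l + 1) # G2 = F"
          using G2 A(1) append_take_drop_id[of "Suc ?k" F] by simp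
        ultimately show "weakly_over (A @ [l + 1]) F" by simp
        show "length (A @ [l + 1]) \<le> length F"
          using arg_cong[OF G2, of length] A(1) \<open>length A \<le> length F\<close> by simp
      qed
      \<comment> \<open>The next column is what \<open>A @ [l + 1]\<close> bumps out of
        \<open>F\<close>. In this form, monotonicity and the weak comparison with the row below
        follow from the general lemmas.\<close>
      have E2: "snd (bumps F (A @ [l + 1])) = E @ [l + 2]"
      proof -
        have "bump (A @ (l + 1) # G2) (l + 1) = (A @ (l + 1) # G2, [l + 2])"
          using Al by (simp add: bump_append sorted_wrt_append)
        moreover have "fst (bumps F A) = A @ (l + 1) # G2" using all A(1) G2 by simp
        ultimately show ?thesis by (simp add: bumps_append E_def)
      qed
      \<comment> \<open>The column of height \<open>k + 2\<close> after \<open>A\<close>; with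
        \<open>W'\<close> in front, the situation is that of the second statement one level
        up.\<close>
      define A2 where "A2 = E @ [l + 2]"
      define W' where "W' = emit W @ rev X"
      have iA2: "inc A2" using bumps_inc_out[OF F Al] E2 by (simp add: A2_def)
      have "over F (frow (emit W))" using covers_over[OF covers_frow_emit] by (simp add: F_def)
      then have "weakly_over A2 (frow (emit W))"
        using bumps_weakly_over_all[OF Al wA1] E2 by (simp add: A2_def)
      moreover have "\<forall>x\<in>set (rev X). \<forall>a\<in>set A2. a \<le> x"
        using iX iA2 by (fastforce simp: A2_def sorted_wrt_append)
      ultimately have wW': "weakly_over A2 (frow W')"
        using weakly_over_bumps iA2 by (simp add: W'_def frow_append)
      have "inc (E @ [l + 2])" using iA2 by (simp add: A2_def)
      from ck_append1[OF ck_move_many[OF this iX], of "emit W"]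
      have ckW: "peel ?k (W @ A) \<approx> W' @ A2" using wf by (simp add: W'_def A2_def)
      have st2: "state (A # As) (W' @ A2)" using state_ck g(3) ckW by blast
      have lA2: "length A2 = Suc (Suc ?k)" "last A2 = l + 2" using E by (simp_all add: A2_def)
      have "take (length A2) (frow (W' @ A2)) = A2"
        using bumps_weakly_over[OF iA2 wW'] by (simp add: frow_append)
      then have g2: "good (A # As) A2 (W' @ A2)"
        using st2 lA2 A(2) by (simp add: good_def l_def)
      note gp2 = good_props[OF g2]
      have "lev (A # As) (W' @ A2) (word_of N)"
        using lev_ck[OF g(3) ckW] W(5) lev_sym lev_trans by blast
      then obtain N' where N: "N = A2 # N'" "normal (Suc (Suc ?k)) N'"
        "lev (A2 # A # As) (peel_twice (Suc ?k) (W' @ A2)) (word_of N')"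
        using normal_split[of "A # As" "W' @ A2" N] st2 W(4) gp2(1,2) by auto
      have "lev (A2 # A # As) (peel_twice (Suc ?k) (W' @ A2)) (peel (Suc ?k) (W' @ A2))"
        using peel_formula(2)[OF gp2(3)] gp2(2) by (simp add: peel_twice_def)
      then have "lev (A2 # A # As) (peel (Suc ?k) (W' @ A2)) (word_of N')"
        using N(3) lev_sym lev_trans by blast
      moreover have lW: "length W' < n"
        using ck_length[OF ckW] lev_length[OF peel_lev(2)[OF A(5) g(1)]] g(2) W(1) lA2(1) A(1) by simp
      ultimately have I: "cells (J - Suc (Suc ?k)) (min (Suc (Suc ?k)) J) W' \<le> (\<Sum>A\<leftarrow>N'. min (length A) J)"
        using IH[of W' "A # As" A2 N'] g2 wW' N(2) A(1) by simp
      have lF: "length (frow W) = Suc (Suc ?k) + length X"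
        using arg_cong[OF G2, of length] G2 G3 A(1) \<open>length A \<le> length F\<close> by (simp add: F_def X_def)
      show ?thesis
      proof (cases "Suc ?k < J")
        case J: True
        have "length X + cells (J - Suc (Suc ?k)) (Suc ?k) (emit W) \<le> cells (J - Suc (Suc ?k)) (Suc (Suc ?k)) W'"
          unfolding W'_def by (rule cells_strip[OF iX(1)])
        then show ?thesis
          using I J lF N(1) lA2(1) cells_step[of "J - Suc ?k" "min (Suc ?k) J" W] by (simp add: min_absorb1)
      next
        case J: False
        have "cells 0 J (emit W) \<le> cells 0 J W'" unfolding W'_def by (rule cells_mono)
        then show ?thesis
          using I J lF N(1) lA2(1) cells_step[of "J - Suc ?k" "min (Suc ?k) J" W] by (simp add: min_absorb2)
      qed
    qed
  qed
  then show ?case using compat by blast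
qed

end

subsection \<open>Rows and columns of a shifted tableau\<close>

text \<open>Puts a row on top of given columns; entries of the row beyond them start new columns of
  height one.\<close>

fun conscols :: "int list \<Rightarrow> int list list \<Rightarrow> int list list" where
  "conscols [] C = []"
| "conscols (r # R) [] = [r] # conscols R []"
| "conscols (r # R) (c # C) = (r # c) # conscols R C"

text \<open>The empty column accounts for the diagonal shift: under the first entry of a row there
  is no box.\<close>

fun cols :: "int list list \<Rightarrow> int list list" where
  "cols [] = []"
| "cols (R # Rs) = conscols R ([] # cols Rs)"

fun shifted_rows :: "int list list \<Rightarrow> bool" where
  "shifted_rows [] = True"
| "shifted_rows (R # Rs) = (R \<noteq> [] \<and> inc R \<and> covers (tl R) (top_col Rs) \<and> shifted_rows Rs)"

lemma length_conscols [simp]: "length (conscols R C) = length R"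
  by (induction R C rule: conscols.induct) auto

lemma map_hd_conscols [simp]: "map hd (conscols R C) = R"
  by (induction R C rule: conscols.induct) auto

lemma length_cols: "shifted_rows Rs \<Longrightarrow> length (cols Rs) = length (top_col Rs)"
  by (cases Rs) auto

lemma map_hd_cols: "map hd (cols Rs) = top_col Rs"
  by (cases Rs) auto

lemma conscols_Nil2: "conscols R [] = map (\<lambda>r. [r]) R"
  by (induction R) auto

lemma conscols_nonempty: "[] \<notin> set (conscols R C)"
  by (induction R C rule: conscols.induct) auto

lemma cols_nonempty: "[] \<notin> set (cols Rs)"
  by (cases Rs) (auto simp: conscols_nonempty)

lemma filter_tl_conscols:
  "length C \<le> length R \<Longrightarrow> filter (\<lambda>c. c \<noteq> []) (map tl (conscols R C)) = filter (\<lambda>c. c \<noteq> []) C"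
  by (induction R C rule: conscols.induct) (auto simp: conscols_Nil2)

lemma cols_inj: "shifted_rows Rs \<Longrightarrow> shifted_rows Ss \<Longrightarrow> cols Rs = cols Ss \<Longrightarrow> Rs = Ss"
proof (induction Rs arbitrary: Ss)
  case Nil
  then show ?case by (cases Ss) (auto simp: neq_Nil_conv)
next
  case (Cons R Rs)
  obtain S Ss' where S: "Ss = S # Ss'"
    using Cons.prems by (cases Ss) (auto simp: neq_Nil_conv)
  have R: "R = S" using Cons.prems S map_hd_cols[of "R # Rs"] map_hd_cols[of Ss] by simp
  have *: "cols T = filter (\<lambda>c. c \<noteq> []) (map tl (cols (Q # T)))" if "shifted_rows (Q # T)" for Q T
  proof -
    have "length ([] # cols T) \<le> length Q"
      using that covers_length[of "tl Q" "top_col T"] length_cols[of T] by (cases Q) auto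
    from filter_tl_conscols[OF this] show ?thesis
      using filter_True[of "cols T" "\<lambda>c. c \<noteq> []"] cols_nonempty[of T] by fastforce
  qed
  have "cols Rs = cols Ss'" using *[of R Rs] *[of S Ss'] Cons.prems S by simp
  then show ?case using Cons S R by simp
qed

lemma normal_conscols:
  "normal k C \<Longrightarrow> inc R \<Longrightarrow> covers R (map hd C) \<Longrightarrow> normal (Suc k) (conscols R C)"
proof (induction R C arbitrary: k rule: conscols.induct)
  case (2 r R)
  have "over [r] (top_col (conscols R []))" using 2 by (cases R) auto
  moreover have "length (top_col (conscols R [])) \<le> 1" by (cases R) auto
  ultimately show ?case using 2 by auto
next
  case (3 r R c C)
  have "over (r # c) (top_col (conscols R C))" using 3 by (cases R; cases C) (auto simp: conscols_Nil2)
  moreover have "length (top_col (conscols R C)) \<le> Suc (length (top_col C))"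
    by (cases R; cases C) auto
  moreover have "\<forall>x\<in>set c. r < x" using 3 by (cases c) auto
  ultimately show ?case using 3 by (auto split: if_splits)
qed simp

lemma normal_cols: "shifted_rows Rs \<Longrightarrow> normal 0 (cols Rs)"
proof (induction Rs)
  case (Cons R Rs)
  obtain r R' where R: "R = r # R'" using Cons.prems by (cases R) auto
  have "normal (Suc 0) (conscols R' (cols Rs))"
    using Cons R by (intro normal_conscols) (auto simp: map_hd_cols)
  moreover have "over [r] (top_col (conscols R' (cols Rs)))"
    using Cons.prems R by (cases R'; cases "cols Rs") auto
  ultimately show ?case using R by simp
qed simp

text \<open>Removing the top row lowers all columns and the diagonal by one; a column of height one
  disappears, and then so do all columns to its right.\<close>

lemma normal_uncons:
  "normal (Suc k) M \<Longrightarrow> \<exists>R C. M = conscols R C \<and> normal k C \<and> inc R \<and> covers R (map hd C)"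
proof (induction M arbitrary: k)
  case Nil
  then show ?case by (intro exI[of _ "[]"]) simp
next
  case (Cons A M)
  obtain r c where A: "A = r # c" using Cons.prems by (cases A) auto
  have rM: "inc (r # R)" if "M = conscols R C" "inc R" for R C
    using that Cons.prems A by (cases R; cases C; force)
  have top: "top_col M = (case R of [] \<Rightarrow> [] | r # _ \<Rightarrow> r # top_col C)" if "M = conscols R C" for R C
    using that by (cases R; cases C) auto
  have ov: "over c (top_col C)" if "M = conscols R C" "covers R (map hd C)" for R C
    using that Cons.prems A by (cases R; cases C) auto
  show ?case
  proof (cases "length A = Suc (Suc k)")
    case True
    then obtain R C where RC: "M = conscols R C" "normal (Suc k) C" "inc R" "covers R (map hd C)"
      using Cons.IH[of "Suc k"] Cons.prems by auto
    have "normal k (c # C)" using RC ov True Cons.prems A by (cases c) auto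
    moreover have "r < hd c" using Cons.prems A True by (cases c) auto
    ultimately show ?thesis
      using RC A rM[OF RC(1,3)] by (intro exI[of _ "r # R"] exI[of _ "c # C"]) auto
  next
    case False
    then obtain R C where RC: "M = conscols R C" "normal k C" "inc R" "covers R (map hd C)"
      using Cons.IH[of k] Cons.prems by auto
    have len: "length (top_col C) \<le> length c"
      using top[OF RC(1)] Cons.prems A False RC(4) by (cases R; cases C) auto
    show ?thesis
    proof (cases c)
      case Nil
      then have "C = []" using len RC(2) by (cases C) auto
      then show ?thesis
        using RC A Nil rM[OF RC(1,3)] by (intro exI[of _ "r # R"] exI[of _ "[]"]) auto
    next
      case c: (Cons c1 c2)
      have "normal k (c # C)" using RC ov[OF RC(1,4)] len False Cons.prems A c by auto
      moreover have "r < hd c" using Cons.prems A c by auto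
      ultimately show ?thesis
        using RC A rM[OF RC(1,3)] by (intro exI[of _ "r # R"] exI[of _ "c # C"]) auto
    qed
  qed
qed

lemma sum_conscols:
  "length C \<le> length R \<Longrightarrow>
    (\<Sum>A\<leftarrow>conscols R C. min (length A) (Suc J)) = length R + (\<Sum>A\<leftarrow>C. min (length A) J)"
  by (induction R C rule: conscols.induct) auto

lemma normal_rows: "normal 0 N \<Longrightarrow> \<exists>Rs. shifted_rows Rs \<and> cols Rs = N"
proof (induction "sum_list (map length N)" arbitrary: N rule: less_induct)
  case less
  show ?case
  proof (cases N)
    case Nil
    then show ?thesis by (intro exI[of _ "[]"]) simp
  next
    case (Cons A M)
    then obtain r where A: "A = [r]" and M: "normal (Suc 0) M" "over [r] (top_col M)"
      using less.prems by (cases A) (auto split: if_splits)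
    obtain R C where RC: "M = conscols R C" "normal 0 C" "inc R" "covers R (map hd C)"
      using normal_uncons[OF M(1)] by blast
    have "length C \<le> length R" using covers_length[OF RC(4)] by simp
    have "sum_list (map length C) \<le> sum_list (map length (conscols R C))" if "length C \<le> length R"
      for R and C :: "int list list"
      using that by (induction R C rule: conscols.induct) auto
    then have "sum_list (map length C) < sum_list (map length N)"
      using Cons A RC(1) \<open>length C \<le> length R\<close> by (simp add: less_Suc_eq_le)
    then obtain Rs where Rs: "shifted_rows Rs" "cols Rs = C" using less.hyps RC(2) by blast
    have "inc (r # R)" using RC M by (cases R; cases C; force)
    then have "shifted_rows ((r # R) # Rs)" using Rs RC(4) map_hd_cols[of Rs] by simp
    moreover have "cols ((r # R) # Rs) = N" using Rs Cons A RC(1) by simp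
    ultimately show ?thesis by blast
  qed
qed

lemma sum_cols:
  "shifted_rows Rs \<Longrightarrow> (\<Sum>A\<leftarrow>cols Rs. min (length A) J) = sum_list (take J (map length Rs))"
proof (induction Rs arbitrary: J)
  case (Cons R Rs)
  have "length ([] # cols Rs) \<le> length R"
    using Cons.prems covers_length[of "tl R" "top_col Rs"] length_cols[of Rs] by (cases R) auto
  then show ?case
    using Cons by (cases J) (auto simp: sum_conscols)
qed simp

lemma ck_conscols:
  "inc (A @ R) \<Longrightarrow> covers R (map hd C) \<Longrightarrow> \<forall>c\<in>set C. inc c \<and> c \<noteq> [] \<Longrightarrow>
    A @ concat (map rev (conscols R C)) \<approx> concat (map rev C) @ A @ R"
proof (induction R C arbitrary: A rule: conscols.induct)
  case (1 C)
  then show ?case by (cases C) auto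
next
  case (2 r R)
  then show ?case by (simp add: conscols_Nil2 comp_def concat_map_singleton)
next
  case (3 r R c C)
  have i: "inc (A @ [r])" using "3.prems" by (auto simp: sorted_wrt_append)
  have c: "inc c" "\<forall>x\<in>set c. r < x" using "3.prems" by (cases c; force)+
  have "A @ concat (map rev (conscols (r # R) (c # C))) =
      (A @ rev c @ [r]) @ concat (map rev (conscols R C))" by simp
  also have "\<dots> \<approx> (rev c @ A @ [r]) @ concat (map rev (conscols R C))"
    by (intro ck_append2 ck_move_many i c)
  also have "\<dots> \<approx> rev c @ concat (map rev C) @ (A @ [r]) @ R"
    using ck_append1[OF "3.IH"[of "A @ [r]"], of "rev c"] "3.prems" by simp
  finally show ?case by simp
qed

lemma normal_inc: "normal k N \<Longrightarrow> \<forall>c\<in>set N. inc c \<and> c \<noteq> []"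
  by (induction k N rule: normal.induct) (auto split: if_splits)

text \<open>The left side reads columns from left to right, each from bottom to top. Moving every
  top entry right past the lower parts of later columns turns this into the row reading.\<close>

lemma ck_cols: "shifted_rows Rs \<Longrightarrow> rev (word_of (cols Rs)) \<approx> concat (rev Rs)"
proof (induction Rs)
  case (Cons R Rs)
  obtain r R' where R: "R = r # R'" using Cons.prems by (cases R) auto
  have w: "rev (word_of N) = concat (map rev N)" for N
    by (simp add: word_of_def rev_concat rev_map[symmetric])
  have "rev (word_of (cols (R # Rs))) = [r] @ concat (map rev (conscols R' (cols Rs)))"
    unfolding w using R by simp
  also have "\<dots> \<approx> concat (map rev (cols Rs)) @ [r] @ R'"
    using Cons.prems R normal_inc[OF normal_cols[of Rs]] by (intro ck_conscols) (auto simp: map_hd_cols)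
  also have "\<dots> \<approx> concat (rev Rs) @ R"
    using Cons R ck_append2[of "concat (map rev (cols Rs))" "concat (rev Rs)" R] by (simp add: w)
  finally show ?case by simp
qed simp

subsection \<open>Symplectic classes\<close>

text \<open>Keeps only properties that are visibly stable under negating all letters, so that the
  result for increasing tableaux also serves for decreasing ones without relating
  \<open>one_fpf\<close> to negation.\<close>

definition sp_class :: "int list set \<Rightarrow> bool" where
  "sp_class K \<longleftrightarrow> (\<exists>u. K = {v. symplectic_coxeter_knuth u v}) \<and> (\<forall>w\<in>K. \<not> unreduced w) \<and>
     (\<forall>a w. a # w \<in> K \<longrightarrow> even a) \<and> (\<forall>a b w. a # b # w \<in> K \<longrightarrow> even b \<or> \<bar>a - b\<bar> = 1)"

lemma symp_sym: "symplectic_coxeter_knuth u v \<Longrightarrow> symplectic_coxeter_knuth v u"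
  by (simp add: symplectic_coxeter_knuth_def equivclp_sym)

lemma symp_trans: "symplectic_coxeter_knuth u v \<Longrightarrow> symplectic_coxeter_knuth v w \<Longrightarrow> symplectic_coxeter_knuth u w"
  unfolding symplectic_coxeter_knuth_def by (rule equivclp_trans)

lemma symp_step: "u \<approx> v \<or> initial_step u v \<Longrightarrow> symplectic_coxeter_knuth u v"
  unfolding symplectic_coxeter_knuth_def by (rule r_into_equivclp) auto

lemma sp_class_step:
  assumes "sp_class K" "u \<in> K" "u \<approx> v \<or> initial_step u v \<or> initial_step v u"
  shows "v \<in> K"
  using assms symp_trans symp_step symp_sym unfolding sp_class_def by blast

lemma swap_step_0_initial:
  assumes "swap_step 0 u v"
  shows "initial_step (rev u) (rev v)"
proof -
  obtain p x y where uv: "u = p @ [x, y]" "v = p @ swap_end x y" "even y" "even x \<or> x = y - 1"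
    using assms unfolding swap_step_def by auto
  show ?thesis
  proof (cases "even x")
    case True
    then have "y mod 2 = x mod 2" using uv by presburger
    then show ?thesis using initial_step.intros(2)[of y x "rev p"] uv True by (simp add: swap_end_def)
  next
    case False
    then show ?thesis using initial_step.intros(1)[of y "rev p"] uv by (simp add: swap_end_def)
  qed
qed

text \<open>Since first letters are even, two exchanged letters of equal parity are both even, and
  \<open>a\<close> in the other initial move is even; both moves are thus instances of
  \<open>swap_end\<close>.\<close>

lemma initial_swap_step_0:
  assumes "initial_step u v" "\<And>a w. a # w \<in> {u, v} \<Longrightarrow> even a"
  shows "rev u = rev v \<or> swap_step 0 (rev u) (rev v) \<or> swap_step 0 (rev v) (rev u)"
  using assms(1)
proof cases
  case (1 a q)
  then have "even a" using assms(2)[of a "(a - 1) # q"] by simp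
  then have "swap_step 0 (rev u) (rev v)"
    unfolding swap_step_def using 1 by (intro exI[of _ "rev q"] exI[of _ "[]"] exI[of _ "a - 1"] exI[of _ a])
      (simp add: swap_end_def)
  then show ?thesis by simp
next
  case (2 a b q)
  then have ev: "even a" "even b" using assms(2)[of a "b # q"] assms(2)[of b "a # q"] by auto
  have *: "swap_step 0 (rev q @ [x, y]) (rev q @ [y, x])" if "x < y" "even x" "even y" for x y
    unfolding swap_step_def using that by (intro exI[of _ "rev q"] exI[of _ "[]"] exI[of _ x] exI[of _ y])
      (simp add: swap_end_def)
  consider "a = b" | "a < b" | "b < a" by linarith
  then show ?thesis using *[of a b] *[of b a] ev 2 by cases auto
qed

lemma sp_words_rev: "sp_class K \<Longrightarrow> sp_words (rev ` K)"
proof (rule sp_words.intro)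
  assume K: "sp_class K"
  have mem: "u \<in> rev ` K \<longleftrightarrow> rev u \<in> K" for u by (metis image_iff rev_rev_ident)
  show "v \<in> rev ` K" if "u \<in> rev ` K" "u \<approx> v" for u v
    using that sp_class_step[OF K, of "rev u" "rev v"] by (simp add: mem)
  show "u \<in> rev ` K \<longleftrightarrow> v \<in> rev ` K" if "swap_step 0 u v" for u v
    using sp_class_step[OF K] swap_step_0_initial[OF that] by (auto simp: mem)
  show "\<not> unreduced u" if "u \<in> rev ` K" for u
    using that K unfolding sp_class_def mem by (metis unreduced_rev)
  show "even y" if "p @ [y] \<in> rev ` K" for p y
    using that K unfolding sp_class_def mem by simp blast
  show "even x \<or> \<bar>x - y\<bar> = 1" if "p @ [x, y] \<in> rev ` K" for p x y
    using that K unfolding sp_class_def mem by (fastforce simp: abs_minus_commute)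
qed

lemma sp_class_lev:
  assumes K: "sp_class K" and uv: "u \<in> K" "v \<in> K"
  shows "sp_words.lev (rev ` K) [] (rev u) (rev v)"
proof -
  interpret sp_words "rev ` K" using K by (rule sp_words_rev)
  have mem: "state [] (rev w) \<longleftrightarrow> w \<in> K" for w by (auto simp: state_def)
  have ev: "\<And>a w. a # w \<in> K \<Longrightarrow> even a" using K unfolding sp_class_def by blast
  have one: "lev [] (rev x) (rev y)" if "x \<approx> y \<or> initial_step x y" "x \<in> K" for x y
  proof -
    have y: "y \<in> K" using that sp_class_step[OF K] by blast
    show ?thesis
    proof (cases "x \<approx> y")
      case True
      then show ?thesis using lev_ck that mem by simp
    next
      case False
      then have "rev x = rev y \<or> swap_step 0 (rev x) (rev y) \<or> swap_step 0 (rev y) (rev x)"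
        using that y ev by (intro initial_swap_step_0) auto
      then show ?thesis using lev_swap_step[of "[]"] mem that y lev_sym by auto
    qed
  qed
  have "symplectic_coxeter_knuth u v"
    using K uv symp_sym symp_trans unfolding sp_class_def by blast
  then have "lev [] (rev u) (rev v) \<and> v \<in> K"
    unfolding symplectic_coxeter_knuth_def
  proof (induction rule: equivclp_induct)
    case base
    show ?case using uv by simp
  next
    case (step y z)
    then have "z \<in> K" using sp_class_step[OF K, of y z] ck_sym[of z y] by auto
    moreover have "lev [] (rev y) (rev z)"
      using step one[of y z] one[of z y] lev_sym \<open>z \<in> K\<close> by auto
    ultimately show ?case using step lev_trans by blast
  qed
  then show ?thesis by simp
qed

lemma sp_class_mem_cols:
  assumes "sp_class K" "shifted_rows Rs"
  shows "concat (rev Rs) \<in> K \<longleftrightarrow> rev (word_of (cols Rs)) \<in> K"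
  using sp_class_step[OF assms(1)] ck_cols[OF assms(2)] ck_sym by blast

lemma sp_class_unique_rows:
  assumes K: "sp_class K"
  shows "\<exists>!Rs. shifted_rows Rs \<and> concat (rev Rs) \<in> K"
proof -
  interpret sp_words "rev ` K" using K by (rule sp_words_rev)
  have mem: "state [] (rev w) \<longleftrightarrow> w \<in> K" for w by (auto simp: state_def)
  obtain u where "u \<in> K" using K unfolding sp_class_def symplectic_coxeter_knuth_def by auto
  then obtain N where N: "normal 0 N" "state [] (word_of N)" using normal_exists[of "[]" "rev u"] mem by auto
  obtain Rs where Rs: "shifted_rows Rs" "cols Rs = N" using normal_rows[OF N(1)] by blast
  then have "concat (rev Rs) \<in> K"
    using sp_class_mem_cols[OF K] N(2) mem[of "rev (word_of N)"] by simp
  moreover have "S = Rs" if "shifted_rows S" "concat (rev S) \<in> K" for S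
  proof -
    have "rev (word_of (cols S)) \<in> K" "rev (word_of (cols Rs)) \<in> K"
      using sp_class_mem_cols[OF K] that Rs \<open>concat (rev Rs) \<in> K\<close> by auto
    then have "lev [] (word_of (cols S)) (word_of (cols Rs))" "state [] (word_of (cols S))"
      using sp_class_lev[OF K] mem[of "rev (word_of (cols S))"] by fastforce+
    then have "cols S = cols Rs" using normal_unique[of "[]"] normal_cols[OF that(1)] normal_cols[OF Rs(1)] by simp
    then show ?thesis using cols_inj that Rs by blast
  qed
  ultimately show ?thesis using Rs by blast
qed

lemma sp_class_dominance:
  assumes K: "sp_class K" and R: "shifted_rows Rs" "concat (rev Rs) \<in> K"
    and S: "shifted_rows Ss" "map uminus (concat (rev Ss)) \<in> K"
  shows "sum_list (take J (map length Ss)) \<le> sum_list (take J (map length Rs))"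
proof -
  interpret sp_words "rev ` K" using K by (rule sp_words_rev)
  have mem: "state [] (rev w) \<longleftrightarrow> w \<in> K" for w by (auto simp: state_def)
  define q where "q = rev (map uminus (concat (rev Ss)))"
  \<comment> \<open>Negation makes the rows decreasing and reversal makes them increasing again,
    with the first row in front, so \<open>cells_blocks\<close> applies to the first
    \<open>J\<close> of them.\<close>
  define Bs where "Bs = map (\<lambda>S. rev (map uminus S)) Ss"
  have q: "q = concat Bs" by (simp add: q_def Bs_def rev_concat map_concat rev_map comp_def)
  have "\<forall>S\<in>set Ss. inc S" using S(1) by (induction Ss) auto
  then have "\<forall>B\<in>set Bs. inc B" by (auto simp: Bs_def sorted_wrt_rev sorted_wrt_map)
  then have "\<forall>B\<in>set (take J Bs). inc B" by (blast dest: in_set_takeD)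
  from cells_blocks[OF this, of J "concat (drop J Bs)"]
  have "length (concat (take J Bs)) \<le> cells J 0 q"
    unfolding q by (metis append_take_drop_id concat_append length_take min.cobounded2)
  moreover have "length (concat (take J Bs)) = sum_list (take J (map length Ss))"
    by (simp add: Bs_def length_concat take_map comp_def)
  moreover have "cells J 0 q \<le> (\<Sum>A\<leftarrow>cols Rs. min (length A) J)"
  proof -
    have "rev (word_of (cols Rs)) \<in> K" using sp_class_mem_cols[OF K R(1)] R(2) by simp
    then have "lev [] q (word_of (cols Rs))" "state [] q"
      using sp_class_lev[OF K S(2)] mem S(2) by (fastforce simp: q_def)+
    then show ?thesis
      using cells_bound[of "length q" J] normal_cols[OF R(1)] by fastforce
  qed
  ultimately show ?thesis using sum_cols[OF R(1)] by simp
qed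

lemma take_sums_eq:
  fixes a b :: "nat list"
  assumes "\<And>J. sum_list (take J a) = sum_list (take J b)" "0 \<notin> set a" "0 \<notin> set b"
  shows "a = b"
  using assms
proof (induction a arbitrary: b)
  case Nil
  then show ?case using Nil(1)[of 1] by (cases b) auto
next
  case (Cons x a)
  obtain y b' where b: "b = y # b'" using Cons.prems(1)[of 1] Cons.prems(2) by (cases b) auto
  have "x = y" using Cons.prems(1)[of 1] b by simp
  moreover have "a = b'"
  proof (rule Cons.IH)
    show "sum_list (take J a) = sum_list (take J b')" for J
      using Cons.prems(1)[of "Suc J"] b \<open>x = y\<close> by simp
  qed (use Cons.prems b in simp_all)
  ultimately show ?case using b by simp
qed

subsection \<open>Words of minimal length\<close>

lemma word_perm_append: "word_perm (p @ q) = word_perm p \<circ> word_perm q"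
  by (induction p) (auto simp: comp_assoc)

lemma simple_transposition_involutory [simp]:
  "simple_transposition x \<circ> simple_transposition x = id"
  by (simp add: simple_transposition_def)

lemma simple_transposition_commute:
  "\<bar>x - y\<bar> \<ge> 2 \<Longrightarrow>
    simple_transposition x \<circ> simple_transposition y = simple_transposition y \<circ> simple_transposition x"
  by (auto simp: simple_transposition_def transpose_def fun_eq_iff)

lemma permutation_word_perm: "permutation (word_perm w)"
  by (induction w) (auto simp: simple_transposition_def simp del: comp_apply
      intro!: permutation_compose permutation_swap_id)

lemma perm_length_le: "word_perm w = f \<Longrightarrow> perm_length f \<le> length w"
  unfolding perm_length_def by (rule Least_le) auto

lemma not_unreduced_reduced_word:
  assumes "w \<in> reduced_words f"
  shows "\<not> unreduced w"
proof
  have len: "length w \<le> length v" if "word_perm v = word_perm w" for v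
    using assms perm_length_le[OF that] unfolding reduced_words_def by auto
  assume "unreduced w"
  then show False unfolding unreduced_def
  proof (elim disjE exE conjE)
    fix p x q assume w: "w = p @ [x, x] @ q"
    have "word_perm (p @ q) = word_perm w"
      unfolding w word_perm_append
      by (simp add: comp_assoc[symmetric])
    from len[OF this] show False by (simp add: w)
  next
    fix p x y q assume "2 \<le> \<bar>x - y\<bar>" and w: "w = p @ [x, y, x] @ q"
    have "word_perm [x, y, x] = word_perm [y]"
      using simple_transposition_commute[OF \<open>2 \<le> \<bar>x - y\<bar>\<close>]
      by simp (metis comp_assoc id_comp simple_transposition_involutory)
    then have "word_perm (p @ [y] @ q) = word_perm w"
      unfolding w word_perm_append by simp
    from len[OF this] show False by (simp add: w)
  qed
qed

definition conj_fpf :: "int list \<Rightarrow> int \<Rightarrow> int" where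
  "conj_fpf w = inv (word_perm w) \<circ> one_fpf \<circ> word_perm w"

lemma R_Sp_conj: "w \<in> R_Sp z \<Longrightarrow> conj_fpf w = z"
  unfolding R_Sp_def A_Sp_def reduced_words_def conj_fpf_def by auto

lemma R_Sp_minimal:
  assumes "w \<in> R_Sp z" "conj_fpf v = z"
  shows "length w \<le> length v"
proof -
  have "word_perm v \<in> S_int" by (simp add: S_int_def permutation_word_perm)
  then have "perm_length (word_perm w) \<le> perm_length (word_perm v)"
    using assms unfolding R_Sp_def A_Sp_def reduced_words_def conj_fpf_def by auto
  moreover have "length w = perm_length (word_perm w)"
    using assms unfolding R_Sp_def reduced_words_def by auto
  ultimately show ?thesis using perm_length_le[of v "word_perm v"] by simp
qed

text \<open>For odd \<open>a\<close>, the transposition of \<open>a\<close> and \<open>a + 1\<close>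
  is one of the cycles of \<open>one_fpf\<close> and hence commutes with it.\<close>

lemma conj_fpf_Cons_odd:
  assumes "odd a"
  shows "conj_fpf (a # w) = conj_fpf w"
proof -
  let ?s = "simple_transposition a" and ?f = "word_perm w"
  have s: "bij ?s" "inv ?s = ?s" by (simp_all add: simple_transposition_def)
  have f: "bij ?f" by (rule permutation_bijective[OF permutation_word_perm])
  have "?s \<circ> one_fpf \<circ> ?s = one_fpf"
    using assms by (auto simp: fun_eq_iff simple_transposition_def transpose_def one_fpf_def)
  then have "inv ?f \<circ> (?s \<circ> one_fpf \<circ> ?s) \<circ> ?f = inv ?f \<circ> one_fpf \<circ> ?f" by simp
  then show ?thesis by (simp add: conj_fpf_def o_inv_distrib[OF s(1) f] s(2) comp_assoc)
qed

lemma R_Sp_even_Cons: "a # w \<in> R_Sp z \<Longrightarrow> even a"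
  using R_Sp_minimal[of "a # w" z w] R_Sp_conj[of "a # w" z] conj_fpf_Cons_odd[of a w] by fastforce

text \<open>Otherwise the odd letter \<open>b\<close> commutes to the front, where it can be deleted
  without changing the conjugate, against minimality.\<close>

lemma R_Sp_second_letter:
  assumes "a # b # w \<in> R_Sp z"
  shows "even b \<or> \<bar>a - b\<bar> = 1"
proof (rule ccontr)
  assume *: "\<not> ?thesis"
  then have "a \<noteq> b" using R_Sp_even_Cons[OF assms] by auto
  then have "\<bar>a - b\<bar> \<ge> 2" using * by linarith
  then have "word_perm (a # b # w) = word_perm (b # a # w)"
    using simple_transposition_commute[of a b] by (simp add: comp_assoc[symmetric])
  then have "conj_fpf (a # w) = z"
    using R_Sp_conj[OF assms] conj_fpf_Cons_odd[of b "a # w"] * by (simp add: conj_fpf_def)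
  from R_Sp_minimal[OF assms this] show False by simp
qed

lemma R_Sp_not_unreduced: "w \<in> R_Sp z \<Longrightarrow> \<not> unreduced w"
  unfolding R_Sp_def using not_unreduced_reduced_word by blast

lemma sp_class_R_Sp:
  assumes "K \<in> UNIV // {(u, v). symplectic_coxeter_knuth u v}" "K \<subseteq> R_Sp z"
  shows "sp_class K"
proof -
  obtain u where "K = {v. symplectic_coxeter_knuth u v}"
    using assms(1) by (elim quotientE) blast
  moreover have "\<forall>w\<in>K. \<not> unreduced w" using assms(2) R_Sp_not_unreduced by blast
  moreover have "\<forall>a w. a # w \<in> K \<longrightarrow> even a" using assms(2) R_Sp_even_Cons by blast
  moreover have "\<forall>a b w. a # b # w \<in> K \<longrightarrow> even b \<or> \<bar>a - b\<bar> = 1"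
    using assms(2) R_Sp_second_letter by blast
  ultimately show ?thesis unfolding sp_class_def by blast
qed

subsection \<open>Negating the letters\<close>

lemma map_uminus_id [simp]: "map uminus (map uminus w) = (w :: int list)"
  by (simp add: comp_def)

lemma ck_step_uminus: "ck_step u v \<Longrightarrow> map uminus u \<approx> map uminus v"
proof (induction rule: ck_step.induct)
  case (1 a b c p q)
  then have "ck_step (map uminus (p @ [c, a, b] @ q)) (map uminus (p @ [a, c, b] @ q))"
    using ck_step.intros(1)[of "- c" "- b" "- a" "map uminus p" "map uminus q"] by simp
  then show ?case unfolding coxeter_knuth_def by blast
next
  case (2 a b c p q)
  then have "ck_step (map uminus (p @ [b, a, c] @ q)) (map uminus (p @ [b, c, a] @ q))"
    using ck_step.intros(2)[of "- c" "- b" "- a" "map uminus p" "map uminus q"] by simp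
  then show ?case unfolding coxeter_knuth_def by blast
next
  case (3 a b p q)
  then have "ck_step (map uminus (p @ [a, b, a] @ q)) (map uminus (p @ [b, a, b] @ q))"
    using ck_step.intros(3)[of "- a" "- b" "map uminus p" "map uminus q"] by simp
  then show ?case unfolding coxeter_knuth_def by blast
qed

lemma ck_uminus: "u \<approx> v \<Longrightarrow> map uminus u \<approx> map uminus v"
  using equivclp_map[of ck_step ck_step "map uminus" u v] ck_step_uminus
  unfolding coxeter_knuth_def by blast

lemma initial_step_uminus: "initial_step u v \<Longrightarrow> initial_step (map uminus v) (map uminus u)"
proof (induction rule: initial_step.induct)
  case (1 a q)
  then show ?case using initial_step.intros(1)[of "- a" "map uminus q"] by simp
next
  case (2 a b q)
  then have "(- b) mod 2 = (- a) mod 2" by presburger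
  then show ?case using initial_step.intros(2)[of "- b" "- a" "map uminus q"] by simp
qed

lemma symp_uminus:
  "symplectic_coxeter_knuth u v \<Longrightarrow> symplectic_coxeter_knuth (map uminus u) (map uminus v)"
  unfolding symplectic_coxeter_knuth_def
proof (rule equivclp_map[where f = "map uminus"])
  show "equivclp (sup coxeter_knuth initial_step) (map uminus a) (map uminus b)"
    if "sup coxeter_knuth initial_step a b" for a b
    using that ck_uminus initial_step_uminus by blast
qed

lemma unreduced_uminus:
  assumes "unreduced w"
  shows "unreduced (map uminus w)"
proof -
  consider p x q where "w = p @ [x, x] @ q"
    | p x y q where "2 \<le> \<bar>x - y\<bar>" "w = p @ [x, y, x] @ q"
    using assms unfolding unreduced_def by blast
  then show ?thesis
  proof cases
    case 1
    then have "map uminus w = map uminus p @ [- x, - x] @ map uminus q" by simp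
    then show ?thesis unfolding unreduced_def by blast
  next
    case 2
    then have "2 \<le> \<bar>(- x) - (- y)\<bar>" "map uminus w = map uminus p @ [- x, - y, - x] @ map uminus q"
      by simp_all
    then show ?thesis unfolding unreduced_def by blast
  qed
qed

lemma sp_class_uminus:
  assumes "sp_class K"
  shows "sp_class (map uminus ` K)"
proof -
  obtain u where u: "K = {v. symplectic_coxeter_knuth u v}" using assms unfolding sp_class_def by blast
  have mem: "w \<in> map uminus ` K \<longleftrightarrow> map uminus w \<in> K" for w by (metis image_iff map_uminus_id)
  have "w \<in> map uminus ` K \<longleftrightarrow> symplectic_coxeter_knuth (map uminus u) w" for w
    using symp_uminus[of u "map uminus w"] symp_uminus[of "map uminus u" w] unfolding mem by (auto simp: u)
  then have "map uminus ` K = {v. symplectic_coxeter_knuth (map uminus u) v}" by blast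
  moreover have "even b \<or> \<bar>a - b\<bar> = 1" if "a # b # w \<in> map uminus ` K" for a b w
  proof -
    have "- a # - b # map uminus w \<in> K" using that mem[of "a # b # w"] by simp
    then have "even (- b) \<or> \<bar>- a - - b\<bar> = 1" using assms unfolding sp_class_def by blast
    then show ?thesis by (simp add: abs_minus_commute)
  qed
  moreover have "even a" if "a # w \<in> map uminus ` K" for a w
  proof -
    have "- a # map uminus w \<in> K" using that mem[of "a # w"] by simp
    then have "even (- a)" using assms unfolding sp_class_def by blast
    then show ?thesis by simp
  qed
  moreover have "\<not> unreduced w" if "w \<in> map uminus ` K" for w
    using that assms unreduced_uminus[of w] mem[of w] unfolding sp_class_def by auto
  ultimately show ?thesis unfolding sp_class_def by blast
qed

subsection \<open>Fillings with integer rows\<close>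

definition fill :: "int list list \<Rightarrow> filling" where
  "fill Rs = (\<lambda>(i, c). if 1 \<le> i \<and> i \<le> length Rs \<and> i \<le> c \<and> c - i < length (Rs ! (i - 1))
     then Some (of_int (Rs ! (i - 1) ! (c - i))) else None)"

lemma fill_Some_iff:
  "fill Rs (i, c) = Some x \<longleftrightarrow> (\<exists>k j. i = Suc k \<and> c = Suc k + j \<and> k < length Rs \<and>
     j < length (Rs ! k) \<and> x = of_int (Rs ! k ! j))"
proof
  assume "fill Rs (i, c) = Some x"
  then show "\<exists>k j. i = Suc k \<and> c = Suc k + j \<and> k < length Rs \<and> j < length (Rs ! k) \<and> x = of_int (Rs ! k ! j)"
    by (intro exI[of _ "i - 1"] exI[of _ "c - i"]) (auto simp: fill_def split: if_splits)
qed (auto simp: fill_def)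

lemma shifted_diagram_iff:
  "(i, c) \<in> shifted_diagram \<mu> \<longleftrightarrow> (\<exists>k j. i = Suc k \<and> c = Suc k + j \<and> k < length \<mu> \<and> j < \<mu> ! k)"
proof
  assume "(i, c) \<in> shifted_diagram \<mu>"
  then obtain j where "c = i + j - 1" "1 \<le> i" "i \<le> length \<mu>" "1 \<le> j" "j \<le> \<mu> ! (i - 1)"
    unfolding shifted_diagram_def by auto
  then show "\<exists>k j. i = Suc k \<and> c = Suc k + j \<and> k < length \<mu> \<and> j < \<mu> ! k"
    by (intro exI[of _ "i - 1"] exI[of _ "j - 1"]) auto
next
  assume "\<exists>k j. i = Suc k \<and> c = Suc k + j \<and> k < length \<mu> \<and> j < \<mu> ! k"
  then obtain k j where *: "i = Suc k" "c = Suc k + j" "k < length \<mu>" "j < \<mu> ! k" by blast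
  then have "c = i + Suc j - 1 \<and> 1 \<le> i \<and> i \<le> length \<mu> \<and> 1 \<le> Suc j \<and> Suc j \<le> \<mu> ! (i - 1)" by simp
  then show "(i, c) \<in> shifted_diagram \<mu>" unfolding shifted_diagram_def by blast
qed

lemma dom_fill: "dom (fill Rs) = shifted_diagram (map length Rs)"
proof -
  have "p \<in> dom (fill Rs) \<longleftrightarrow> p \<in> shifted_diagram (map length Rs)" for p
    by (cases p) (auto simp: dom_def fill_Some_iff shifted_diagram_iff)
  then show ?thesis by blast
qed

lemma row_reading_word_rows:
  assumes "has_shifted_shape U \<mu>"
  shows "row_reading_word U =
    concat (rev (map (\<lambda>k. map (\<lambda>j. the (U (Suc k, Suc k + j))) [0..<\<mu> ! k]) [0..<length \<mu>]))"
proof -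
  have dom: "(i, c) \<in> dom U \<longleftrightarrow> (\<exists>k j. i = Suc k \<and> c = Suc k + j \<and> k < length \<mu> \<and> j < \<mu> ! k)" for i c
    using assms shifted_diagram_iff unfolding has_shifted_shape_def by simp
  have "\<mu> ! k > 0" if "k < length \<mu>" for k
    using assms that nth_mem[of k \<mu>] unfolding has_shifted_shape_def strict_partition_def
    by (metis neq0_conv)
  then have "fst ` dom U = Suc ` {..<length \<mu>}"
  proof (intro set_eqI iffI)
    fix i assume "i \<in> Suc ` {..<length \<mu>}"
    then have "(i, i + 0) \<in> dom U" unfolding dom using \<open>\<And>k. k < length \<mu> \<Longrightarrow> \<mu> ! k > 0\<close> by auto
    then show "i \<in> fst ` dom U" by force
  next
    fix i assume "i \<in> fst ` dom U"
    then obtain c where "(i, c) \<in> dom U" by force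
    then show "i \<in> Suc ` {..<length \<mu>}" unfolding dom by blast
  qed
  then have "fst ` dom U = set (map Suc [0..<length \<mu>])" by (simp add: atLeast0LessThan)
  then have rows: "sorted_list_of_set (fst ` dom U) = map Suc [0..<length \<mu>]"
    by (simp only: sorted_list_of_set.idem_if_sorted_distinct map_Suc_upt sorted_upt distinct_upt)
  have row: "row_word U (Suc k) = map (\<lambda>j. the (U (Suc k, Suc k + j))) [0..<\<mu> ! k]"
    if "k < length \<mu>" for k
  proof -
    have "{j. (Suc k, j) \<in> dom U} = {Suc k..<Suc k + \<mu> ! k}"
      using that by (auto simp: dom le_iff_add)
    moreover have upt: "map ((+) (Suc k)) [0..<\<mu> ! k] = [Suc k..<Suc k + \<mu> ! k]"
      by (rule nth_equalityI) (simp_all del: upt_Suc)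
    ultimately have "{j. (Suc k, j) \<in> dom U} = set (map ((+) (Suc k)) [0..<\<mu> ! k])"
      by (simp only: set_upt)
    then have "sorted_list_of_set {j. (Suc k, j) \<in> dom U} = map ((+) (Suc k)) [0..<\<mu> ! k]"
      by (simp only: sorted_list_of_set.idem_if_sorted_distinct upt sorted_upt distinct_upt)
    then show ?thesis by (simp add: row_word_def)
  qed
  have "map (row_word U) (map Suc [0..<length \<mu>]) =
      map (\<lambda>k. map (\<lambda>j. the (U (Suc k, Suc k + j))) [0..<\<mu> ! k]) [0..<length \<mu>]"
    using row by simp
  then show ?thesis unfolding row_reading_word_def rows by (simp only: rev_map[symmetric])
qed

lemma row_reading_word_fill:
  assumes "strict_partition (map length Rs)"
  shows "row_reading_word (fill Rs) = map of_int (concat (rev Rs))"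
proof -
  have "has_shifted_shape (fill Rs) (map length Rs)"
    using assms dom_fill by (simp add: has_shifted_shape_def)
  then have "row_reading_word (fill Rs) = concat (rev (map (\<lambda>k. map (\<lambda>j. the (fill Rs (Suc k, Suc k + j)))
      [0..<map length Rs ! k]) [0..<length (map length Rs)]))"
    by (rule row_reading_word_rows)
  moreover have "map (\<lambda>k. map (\<lambda>j. the (fill Rs (Suc k, Suc k + j))) [0..<map length Rs ! k])
      [0..<length (map length Rs)] = map (map of_int) Rs"
    by (intro nth_equalityI) (auto simp: fill_def)
  ultimately show ?thesis
    by (simp only: rev_map map_concat)
qed

text \<open>Every entry occurs in the reading word, whose letters are integers; this excludes
  half-integers, and taking floors loses nothing.\<close>

lemma integral_reading_word:
  assumes U: "has_shifted_shape U \<mu>" "row_reading_word U = map rat_of_int w"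
  obtains Rs where "U = fill Rs" "map length Rs = \<mu>" "w = concat (rev Rs)"
proof
  let ?r = "\<lambda>k j. the (U (Suc k, Suc k + j))"
  define Rs where "Rs = map (\<lambda>k. map (\<lambda>j. \<lfloor>?r k j\<rfloor>) [0..<\<mu> ! k]) [0..<length \<mu>]"
  have w: "map rat_of_int w = concat (rev (map (\<lambda>k. map (?r k) [0..<\<mu> ! k]) [0..<length \<mu>]))"
    using row_reading_word_rows[OF U(1)] U(2) by simp
  have int: "of_int \<lfloor>?r k j\<rfloor> = ?r k j" if "k < length \<mu>" "j < \<mu> ! k" for k j
  proof -
    have "?r k j \<in> set (concat (rev (map (\<lambda>k. map (?r k) [0..<\<mu> ! k]) [0..<length \<mu>])))"
      using that by (auto intro!: bexI[of _ k] image_eqI[of _ _ j])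
    then have "?r k j \<in> set (map rat_of_int w)" unfolding w .
    then show ?thesis by auto
  qed
  show len: "map length Rs = \<mu>" by (intro nth_equalityI) (auto simp: Rs_def)
  have "map (map rat_of_int) Rs = map (\<lambda>k. map (?r k) [0..<\<mu> ! k]) [0..<length \<mu>]"
    using int by (auto simp: Rs_def)
  then have "map rat_of_int w = concat (rev (map (map rat_of_int) Rs))" by (simp only: w)
  then have "map rat_of_int w = map rat_of_int (concat (rev Rs))" by (simp only: rev_map map_concat)
  then show "w = concat (rev Rs)" using inj_map_eq_map[of rat_of_int] by (simp add: inj_on_def)
  show "U = fill Rs"
  proof
    fix p :: "nat \<times> nat"
    obtain i c where p: "p = (i, c)" by fastforce
    have dom: "p \<in> dom U \<longleftrightarrow> p \<in> dom (fill Rs)"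
      using U(1) len dom_fill unfolding has_shifted_shape_def by simp
    show "U p = fill Rs p"
    proof (cases "p \<in> dom (fill Rs)")
      case True
      then obtain k j where kj: "i = Suc k" "c = Suc k + j" "k < length \<mu>" "j < \<mu> ! k"
        using dom_fill[of Rs] shifted_diagram_iff len p by auto
      then have "fill Rs p = Some (of_int (Rs ! k ! j))" by (simp add: p fill_def Rs_def)
      also have "\<dots> = Some (?r k j)" using kj int by (simp add: Rs_def)
      also have "\<dots> = U p" using True dom kj p by (auto simp: dom_def)
      finally show ?thesis by simp
    qed (use dom in \<open>auto simp: dom_def\<close>)
  qed
qed

lemma covers_nth:
  "covers A F \<longleftrightarrow> length F \<le> length A \<and> (\<forall>j<length F. A ! j < F ! j)"
  by (induction A F rule: covers.induct) (auto simp: less_Suc_eq_0_disj)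

lemma shifted_rows_nth:
  "shifted_rows Rs \<longleftrightarrow> (\<forall>k<length Rs. Rs ! k \<noteq> [] \<and> inc (Rs ! k)) \<and>
     (\<forall>k. Suc k < length Rs \<longrightarrow> covers (tl (Rs ! k)) (Rs ! Suc k))"
proof (induction Rs)
  case (Cons R Rs)
  have "covers (tl R) (top_col Rs) \<longleftrightarrow> (0 < length Rs \<longrightarrow> covers (tl R) (Rs ! 0))"
    by (cases Rs) auto
  moreover have all0: "(\<forall>k. P k) \<longleftrightarrow> P 0 \<and> (\<forall>k. P (Suc k))" for P :: "nat \<Rightarrow> bool"
    by (metis nat.exhaust)
  have "(\<forall>k<length (R # Rs). (R # Rs) ! k \<noteq> [] \<and> inc ((R # Rs) ! k)) \<longleftrightarrow>
      R \<noteq> [] \<and> inc R \<and> (\<forall>k<length Rs. Rs ! k \<noteq> [] \<and> inc (Rs ! k))"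
    by (subst all0) simp
  moreover have "(\<forall>k. Suc k < length (R # Rs) \<longrightarrow> covers (tl ((R # Rs) ! k)) ((R # Rs) ! Suc k)) \<longleftrightarrow>
      (0 < length Rs \<longrightarrow> covers (tl R) (Rs ! 0)) \<and>
      (\<forall>k. Suc k < length Rs \<longrightarrow> covers (tl (Rs ! k)) (Rs ! Suc k))"
    by (subst all0) simp
  ultimately show ?case
    using Cons.IH by (simp only: shifted_rows.simps) blast
qed simp

lemma shifted_rows_partition: "shifted_rows Rs \<Longrightarrow> strict_partition (map length Rs)"
proof (induction Rs)
  case (Cons R Rs)
  obtain r R' where R: "R = r # R'" using Cons.prems by (cases R) auto
  have "length S < length R" if "S \<in> set Rs" for S
    using that Cons R covers_length[of "tl R" "top_col Rs"]
    by (cases Rs) (auto simp: strict_partition_def)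
  then show ?case using Cons R by (auto simp: strict_partition_def)
qed (simp add: strict_partition_def)

lemma shifted_rows_column:
  assumes "shifted_rows Rs" "k + Suc d < length Rs" "j < length (Rs ! (k + Suc d))"
  shows "j + Suc d < length (Rs ! k) \<and> Rs ! k ! (j + Suc d) < Rs ! (k + Suc d) ! j"
  using assms(2,3)
proof (induction d arbitrary: j)
  case (0 j)
  then have "covers (tl (Rs ! k)) (Rs ! Suc k)" using assms(1) shifted_rows_nth by simp
  then show ?case using 0 by (auto simp: covers_nth nth_tl)
next
  case (Suc d j)
  have "covers (tl (Rs ! (k + Suc d))) (Rs ! (k + Suc (Suc d)))"
    using assms(1) shifted_rows_nth Suc.prems by simp
  then have "Suc j < length (Rs ! (k + Suc d))"
    "Rs ! (k + Suc d) ! Suc j < Rs ! (k + Suc (Suc d)) ! j"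
    using Suc.prems by (auto simp: covers_nth nth_tl)
  then show ?case using Suc.IH[of "Suc j"] Suc.prems by simp
qed

lemma increasing_fill:
  assumes "strict_partition (map length Rs)"
  shows "increasing_shifted_tableau (fill Rs) \<longleftrightarrow> shifted_rows Rs"
proof
  assume inc: "increasing_shifted_tableau (fill Rs)"
  have val: "fill Rs (Suc k, Suc k + j) = Some (of_int (Rs ! k ! j))"
    if "k < length Rs" "j < length (Rs ! k)" for k j
    using that by (simp add: fill_def)
  have "Rs ! k \<noteq> []" if "k < length Rs" for k
    using assms that nth_mem[of k "map length Rs"] unfolding strict_partition_def by fastforce
  moreover have "inc (Rs ! k)" if "k < length Rs" for k
    unfolding sorted_wrt_iff_nth_less
  proof (intro allI impI)
    fix i j assume ij: "i < j" "j < length (Rs ! k)"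
    then have "Suc k + i < Suc k + j" by simp
    then have "rat_of_int (Rs ! k ! i) < of_int (Rs ! k ! j)"
      using inc val[OF that, of i] val[OF that, of j] ij unfolding increasing_shifted_tableau_def
      by (meson less_trans)
    then show "Rs ! k ! i < Rs ! k ! j" by simp
  qed
  moreover have "covers (tl (Rs ! k)) (Rs ! Suc k)" if k: "Suc k < length Rs" for k
    unfolding covers_nth
  proof (intro conjI allI impI)
    have len: "length (Rs ! Suc k) < length (Rs ! k)"
      using assms k unfolding strict_partition_def sorted_wrt_iff_nth_less by simp
    then show "length (Rs ! Suc k) \<le> length (tl (Rs ! k))" by simp
    fix j assume j: "j < length (Rs ! Suc k)"
    then have "Suc j < length (Rs ! k)" using len by simp
    then have "fill Rs (Suc k, Suc (Suc k) + j) = Some (of_int (Rs ! k ! Suc j))"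
      using val[of k "Suc j"] k by simp
    moreover have "fill Rs (Suc (Suc k), Suc (Suc k) + j) = Some (of_int (Rs ! Suc k ! j))"
      using val[of "Suc k" j] k j by simp
    ultimately have "rat_of_int (Rs ! k ! Suc j) < of_int (Rs ! Suc k ! j)"
      using inc unfolding increasing_shifted_tableau_def by (meson lessI)
    then show "tl (Rs ! k) ! j < Rs ! Suc k ! j"
      using \<open>Suc j < length (Rs ! k)\<close> by (simp add: nth_tl)
  qed
  ultimately show "shifted_rows Rs" unfolding shifted_rows_nth by blast
next
  assume sh: "shifted_rows Rs"
  have "shifted_tableau (fill Rs)"
    unfolding shifted_tableau_def has_shifted_shape_def ran_def
    using assms dom_fill by (auto simp: fill_Some_iff)
  moreover have "x < y" if "j < j'" "fill Rs (i, j) = Some x" "fill Rs (i, j') = Some y" for i j j' x y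
    using that sh by (auto simp: fill_Some_iff shifted_rows_nth sorted_wrt_iff_nth_less)
  moreover have "x < y"
    if "i < i'" and x: "fill Rs (i, c) = Some x" and y: "fill Rs (i', c) = Some y" for i i' c x y
  proof -
    obtain k j where k: "i = Suc k" "c = Suc k + j" "x = of_int (Rs ! k ! j)"
      using x unfolding fill_Some_iff by blast
    obtain k' j' where k': "i' = Suc k'" "c = Suc k' + j'" "k' < length Rs" "j' < length (Rs ! k')"
        "y = of_int (Rs ! k' ! j')"
      using y unfolding fill_Some_iff by blast
    obtain d where d: "k' = k + Suc d" using \<open>i < i'\<close> k k' less_imp_Suc_add[of k k'] by auto
    then have j: "j = j' + Suc d" using k k' by simp
    have "Rs ! k ! j < Rs ! k' ! j'"
      using shifted_rows_column[OF sh, of k d j'] k'(3,4) unfolding j d by blast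
    then show ?thesis using k k' by simp
  qed
  ultimately show "increasing_shifted_tableau (fill Rs)"
    unfolding increasing_shifted_tableau_def by blast
qed

lemma increasing_reading_iff:
  "increasing_shifted_tableau U \<and> contains_row_reading_word K U \<longleftrightarrow>
    (\<exists>Rs. shifted_rows Rs \<and> concat (rev Rs) \<in> K \<and> U = fill Rs)"
proof
  assume *: "increasing_shifted_tableau U \<and> contains_row_reading_word K U"
  then obtain \<mu> w where U: "has_shifted_shape U \<mu>" "row_reading_word U = map rat_of_int w" "w \<in> K"
    unfolding increasing_shifted_tableau_def shifted_tableau_def contains_row_reading_word_def by auto
  then obtain Rs where Rs: "U = fill Rs" "map length Rs = \<mu>" "w = concat (rev Rs)"
    using integral_reading_word by metis
  then have "shifted_rows Rs" using * U increasing_fill[of Rs] by (simp add: has_shifted_shape_def)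
  then show "\<exists>Rs. shifted_rows Rs \<and> concat (rev Rs) \<in> K \<and> U = fill Rs" using Rs U by blast
next
  assume "\<exists>Rs. shifted_rows Rs \<and> concat (rev Rs) \<in> K \<and> U = fill Rs"
  then show "increasing_shifted_tableau U \<and> contains_row_reading_word K U"
    using shifted_rows_partition increasing_fill row_reading_word_fill
    unfolding contains_row_reading_word_def by auto
qed

subsection \<open>Decreasing tableaux\<close>

definition neg_filling :: "filling \<Rightarrow> filling" where
  "neg_filling T = map_option uminus \<circ> T"

lemma neg_filling_neg_filling [simp]: "neg_filling (neg_filling T) = T"
  by (auto simp: neg_filling_def fun_eq_iff option.map_comp comp_def option.map_ident)

lemma dom_neg_filling [simp]: "dom (neg_filling T) = dom T"
  by (auto simp: neg_filling_def dom_def)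

lemma shape_neg_filling [simp]: "has_shifted_shape (neg_filling T) \<mu> \<longleftrightarrow> has_shifted_shape T \<mu>"
  by (simp add: has_shifted_shape_def)

lemma neg_filling_Some_iff: "neg_filling T p = Some x \<longleftrightarrow> T p = Some (- x)"
  by (cases "T p") (auto simp: neg_filling_def)

lemma shifted_tableau_neg: "shifted_tableau T \<Longrightarrow> shifted_tableau (neg_filling T)"
proof -
  assume T: "shifted_tableau T"
  have "x \<in> \<int> \<union> {x - 1/2 |x. x \<in> \<int>}" if "neg_filling T p = Some x" for p x
  proof -
    have "- x \<in> ran T" using that by (auto simp: neg_filling_Some_iff intro: ranI)
    then consider "- x \<in> \<int>" | n where "n \<in> \<int>" "- x = n - 1/2"
      using T unfolding shifted_tableau_def by blast
    then show ?thesis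
    proof cases
      case 2
      then have "x = (1 - n) - 1/2" "1 - n \<in> \<int>" by (auto simp: field_simps)
      then show ?thesis by blast
    qed simp
  qed
  then show "shifted_tableau (neg_filling T)"
    using T unfolding shifted_tableau_def ran_def by auto
qed

lemma decreasing_iff_neg: "decreasing_shifted_tableau T \<longleftrightarrow> increasing_shifted_tableau (neg_filling T)"
proof -
  have "shifted_tableau (neg_filling T) \<longleftrightarrow> shifted_tableau T"
    using shifted_tableau_neg[of T] shifted_tableau_neg[of "neg_filling T"] by auto
  moreover have "(\<forall>x y. A \<and> T p = Some (- x) \<and> T q = Some (- y) \<longrightarrow> x < y) \<longleftrightarrow>
      (\<forall>x y. A \<and> T p = Some x \<and> T q = Some y \<longrightarrow> x > y)" for A p q
    by (metis neg_less_iff_less minus_minus)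
  ultimately show ?thesis
    unfolding decreasing_shifted_tableau_def increasing_shifted_tableau_def neg_filling_Some_iff by simp
qed

lemma row_reading_word_neg: "row_reading_word (neg_filling T) = map uminus (row_reading_word T)"
proof -
  have "row_word (neg_filling T) = map uminus \<circ> row_word T"
  proof
    fix i
    have "the (neg_filling T (i, j)) = - the (T (i, j))"
      if "j \<in> set (sorted_list_of_set {j. (i, j) \<in> dom T})" for j
    proof -
      have "(i, j) \<in> dom T"
        using that by (cases "finite {j. (i, j) \<in> dom T}") auto
      then show ?thesis by (auto simp: neg_filling_def)
    qed
    then show "row_word (neg_filling T) i = (map uminus \<circ> row_word T) i" by (simp add: row_word_def)
  qed
  then show ?thesis by (simp add: row_reading_word_def map_concat comp_def)
qed

lemma contains_neg: "contains_row_reading_word K T \<longleftrightarrow>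
    contains_row_reading_word (map uminus ` K) (neg_filling T)"
proof -
  have 1: "contains_row_reading_word (map uminus ` K) (neg_filling T)"
    if "contains_row_reading_word K T" for K T
  proof -
    obtain w where "w \<in> K" "row_reading_word T = map rat_of_int w"
      using \<open>contains_row_reading_word K T\<close> unfolding contains_row_reading_word_def by auto
    then have "row_reading_word (neg_filling T) = map rat_of_int (map uminus w)"
      by (simp add: row_reading_word_neg)
    then show ?thesis using \<open>w \<in> K\<close> unfolding contains_row_reading_word_def by blast
  qed
  show ?thesis using 1[of K T] 1[of "map uminus ` K" "neg_filling T"] by (auto simp: image_image)
qed

theorem theorem4p7:
  fixes z :: "int \<Rightarrow> int" and K :: "int list set"
  assumes "z \<in> I_fpf"
    and "K \<in> UNIV // {(u, v). symplectic_coxeter_knuth u v}"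
    and "K \<subseteq> R_Sp z"
  shows "(\<exists>!U. increasing_shifted_tableau U \<and> contains_row_reading_word K U) \<and>
    (\<exists>!V. decreasing_shifted_tableau V \<and> contains_row_reading_word K V) \<and>
    (\<forall>U V. increasing_shifted_tableau U \<and> contains_row_reading_word K U \<and>
        decreasing_shifted_tableau V \<and> contains_row_reading_word K V \<longrightarrow>
      (\<exists>\<mu>. has_shifted_shape U \<mu> \<and> has_shifted_shape V \<mu>))"
proof -
  have K: "sp_class K" using assms(2,3) by (rule sp_class_R_Sp)
  then have K': "sp_class (map uminus ` K)" by (rule sp_class_uminus)
  have inc: "\<exists>!U. increasing_shifted_tableau U \<and> contains_row_reading_word L U" if "sp_class L" for L
    using sp_class_unique_rows[OF that] unfolding increasing_reading_iff by blast
  have dec: "decreasing_shifted_tableau V \<and> contains_row_reading_word K V \<longleftrightarrow>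
      increasing_shifted_tableau (neg_filling V) \<and>
        contains_row_reading_word (map uminus ` K) (neg_filling V)" for V
    by (simp only: decreasing_iff_neg contains_neg[of K V])
  have "\<exists>!V. decreasing_shifted_tableau V \<and> contains_row_reading_word K V"
  proof -
    obtain W where W: "increasing_shifted_tableau W \<and> contains_row_reading_word (map uminus ` K) W"
      "\<And>T. increasing_shifted_tableau T \<and> contains_row_reading_word (map uminus ` K) T \<Longrightarrow> T = W"
      using inc[OF K'] by blast
    show ?thesis
    proof (rule ex1I[of _ "neg_filling W"])
      show "V = neg_filling W" if "decreasing_shifted_tableau V \<and> contains_row_reading_word K V" for V
      proof -
        have "neg_filling V = W" using that by (intro W(2)) (simp only: dec)
        then show ?thesis by auto
      qed
      show "decreasing_shifted_tableau (neg_filling W) \<and> contains_row_reading_word K (neg_filling W)"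
        using W(1) by (simp only: dec neg_filling_neg_filling)
    qed
  qed
  moreover have "\<exists>\<mu>. has_shifted_shape U \<mu> \<and> has_shifted_shape V \<mu>"
    if U: "increasing_shifted_tableau U \<and> contains_row_reading_word K U"
      and V: "decreasing_shifted_tableau V \<and> contains_row_reading_word K V" for U V
  proof -
    obtain Rs where R: "shifted_rows Rs" "concat (rev Rs) \<in> K" "U = fill Rs"
      using U unfolding increasing_reading_iff by blast
    obtain Ss where S: "shifted_rows Ss" "concat (rev Ss) \<in> map uminus ` K" "neg_filling V = fill Ss"
      using V unfolding dec increasing_reading_iff by blast
    have "map uminus (concat (rev Ss)) \<in> K" using S(2) by auto
    \<comment> \<open>Dominance holds in both directions: once for \<open>K\<close>, and once for
      the negated class, where the two tableaux exchange their parts.\<close>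
    then have "sum_list (take J (map length Rs)) = sum_list (take J (map length Ss))" for J
      using sp_class_dominance[OF K R(1,2) S(1)] sp_class_dominance[OF K' S(1,2) R(1)] R(2)
      by (intro antisym) auto
    moreover have sp: "strict_partition (map length Rs)" "strict_partition (map length Ss)"
      using R(1) S(1) shifted_rows_partition by blast+
    ultimately have "map length Rs = map length Ss"
      unfolding strict_partition_def by (intro take_sums_eq) blast+
    moreover have "has_shifted_shape U (map length Rs)"
      using sp(1) by (simp add: R(3) has_shifted_shape_def dom_fill)
    moreover have "has_shifted_shape (neg_filling V) (map length Ss)"
      using sp(2) by (simp only: S(3) has_shifted_shape_def dom_fill)
    ultimately show ?thesis unfolding shape_neg_filling by auto
  qed
  ultimately show ?thesis using inc[OF K] by blast
qed

end
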